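(* Consider the index-1 differential-algebraic problem $\mathbf{x}'=\mathbf{f}(\mathbf{x},\mathbf{z})$, $0=\mathbf{g}(\mathbf{x},\mathbf{z})$ with $\mathbf{f},\mathbf{g}$ smooth and $\mathbf{g}_{\mathbf{z}}$ invertible in a neighborhood of the solution. Consider an IMEX general linear method of order $p$ from the class of interest (see context). The method applied (with fixed step $h$, in its DAE form given in the context) to the index-1 problem yields a solution that converges with order $p$: $$\Delta X^{[n]}=\mathcal{O}(h^p),\quad \Delta\xi^{[n]}=\mathcal{O}(h^p),\quad \Delta Z^{[n]}=\mathcal{O}(h^p),\quad \Delta\zeta^{[n]}=\mathcal{O}(h^p).$$
   Context: **Method.** Coefficients: abscissae $\mathbf{c}\in\mathbb{R}^s$ common to both components; explicit component $(\mathbf{A}^E,\mathbf{U}^E,\mathbf{B}^E,\mathbf{V}^E)$ with $\mathbf{A}^E$ strictly lower triangular; implicit component $(\mathbf{A}^I,\mathbf{U}^I,\mathbf{B}^I,\mathbf{V}^I)$; sizes $s\times s$, $s\times r$, $r\times s$, $r\times r$. On the DAE (the limit $\varepsilon\to0$ of the method applied to $\mathbf{x}'=\mathbf{f}$, $\mathbf{z}'=\varepsilon^{-1}\mathbf{g}$), with $\mathbf{x},\mathbf{z}\in\mathbb{R}^m$ and functions applied stage by stage, one step is $$X^{[n]}=h(\mathbf{A}^E\otimes\mathbf{I}_m)\mathbf{f}(X^{[n]},Z^{[n]})+(\mathbf{U}^E\otimes\mathbf{I}_m)\xi^{[n-1]},\qquad 0=\mathbf{g}(X^{[n]},Z^{[n]}),$$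 $$\xi^{[n]}=h(\mathbf{B}^E\otimes\mathbf{I}_m)\mathbf{f}(X^{[n]},Z^{[n]})+(\mathbf{V}^E\otimes\mathbf{I}_m)\xi^{[n-1]},$$ $$\zeta^{[n]}=(\mathbf{B}^I(\mathbf{A}^I)^{-1}\otimes\mathbf{I}_m)Z^{[n]}+(\mathbf{M}^I(\infty)\otimes\mathbf{I}_m)\zeta^{[n-1]},\qquad \mathbf{M}^I(\infty)=\mathbf{V}^I-\mathbf{B}^I(\mathbf{A}^I)^{-1}\mathbf{U}^I.$$ By the implicit function theorem the algebraic equation is locally solved as $Z^{[n]}=\mathcal{G}(X^{[n]})$. **Order.** A GLM $(\mathbf{c},\mathbf{A},\mathbf{U},\mathbf{B},\mathbf{V})$ has order $p$ and stage order $q\in\{p-1,p\}$ with $\mathbf{W}=[\mathbf{w}_0\cdots\mathbf{w}_p]\in\mathbb{R}^{r\times(p+1)}$ if $\mathbf{U}\mathbf{w}_0=\mathbf{1}_s$, $\mathbf{V}\mathbf{w}_0=\mathbf{w}_0$, and (componentwise powers) $$\frac{\mathbf{c}^{\times k}}{k!}-\frac{\mathbf{A}\mathbf{c}^{\times(k-1)}}{(k-1)!}-\mathbf{U}\mathbf{w}_k=0,\ 1\le k\le q;\qquad \sum_{\ell=0}^k\frac{\mathbf{w}_{k-\ell}}{\ell!}-\frac{\mathbf{B}\mathbf{c}^{\times(k-1)}}{(k-1)!}-\mathbf{V}\mathbf{w}_k=0,\ 1\le k\le p.$$ The IMEX method has order $p$ if both components have order $p$ (with matrices $\mathbf{W}^E,\mathbf{W}^I$);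 $q^E,q^I$ are their stage orders. **Class of interest.** IMEX GLMs such that: (1) both components share the same abscissae $\mathbf{c}$; (2) $q^E,q^I\in\{p-1,p\}$; (3) $\mathbf{A}^I$ has strictly positive eigenvalues; (4) the spectral radius satisfies $\rho(\mathbf{M}^I(\infty))<1$. **Errors.** With $t_n=t_0+nh\in[t_0,t_F]$, $\eta_p(h,\mathbf{y},t)=[\mathbf{y}(t)^T,h\mathbf{y}'(t)^T,\dots,h^p\mathbf{y}^{(p)}(t)^T]^T$, and $(\mathbf{x}(t),\mathbf{z}(t))$ the exact DAE solution on $[t_0,t_F]$: $$\Delta\xi^{[n]}=\xi^{[n]}-(\mathbf{W}^E\otimes\mathbf{I}_m)\eta_p(h,\mathbf{x},t_n),\quad \Delta\zeta^{[n]}=\zeta^{[n]}-(\mathbf{W}^I\otimes\mathbf{I}_m)\eta_p(h,\mathbf{z},t_n),$$ $$\Delta X^{[n]}=X^{[n]}-\mathbf{x}(t_{n-1}+\mathbf{c}h),\quad \Delta Z^{[n]}=Z^{[n]}-\mathbf{z}(t_{n-1}+\mathbf{c}h),$$ where $\mathbf{x}(t_{n-1}+\mathbf{c}h)$ stacks the values $\mathbf{x}(t_{n-1}+c_ih)$, $i=1,\dots,s$.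
   Formalization: Two hypotheses are added, without which the claim fails: the starting vectors satisfy Δξ^[0] = O(h^p) and Δζ^[0] = O(h^p), and the explicit component is zero-stable (V^E is power bounded). *)

theory Defs
  imports "HOL-Analysis.Analysis" "HOL-Library.Landau_Symbols"
begin

section \<open>Smooth functions and higher derivatives of curves\<close>

text \<open>On open sets of a Euclidean space this is \<open>C\<^sup>k\<close>: all directional derivatives of order up
  to \<open>k\<close> exist and are continuous.\<close>

primrec C_k_on :: "nat \<Rightarrow> ('a::real_normed_vector \<Rightarrow> 'b::real_normed_vector) \<Rightarrow> 'a set \<Rightarrow> bool" where
  "C_k_on 0 f S \<longleftrightarrow> continuous_on S f"
| "C_k_on (Suc k) f S \<longleftrightarrow>
     (\<forall>x\<in>S. f differentiable (at x)) \<and>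
     (\<forall>v. C_k_on k (\<lambda>x. frechet_derivative f (at x) v) S)"

definition smooth_on :: "('a::real_normed_vector \<Rightarrow> 'b::real_normed_vector) \<Rightarrow> 'a set \<Rightarrow> bool" where
  "smooth_on f S \<longleftrightarrow> (\<forall>k. C_k_on k f S)"

definition nth_deriv :: "nat \<Rightarrow> (real \<Rightarrow> 'a::real_normed_vector) \<Rightarrow> real \<Rightarrow> 'a" where
  "nth_deriv k y = ((\<lambda>u t. vector_derivative u (at t)) ^^ k) y"


section \<open>Eigenvalues of real matrices\<close>

text \<open>Eigenvalues of a real matrix are its complex ones; the spectrum is finite and nonempty,
  so the maximum below is attained.\<close>

definition complexify :: "real^'n^'n \<Rightarrow> complex^'n^'n" where
  "complexify A = (\<chi> i j. complex_of_real (A $ i $ j))"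

definition spectrum :: "real^'n^'n \<Rightarrow> complex set" where
  "spectrum A = {l. \<exists>v. v \<noteq> 0 \<and> complexify A *v v = l *s v}"

definition spectral_radius :: "real^'n^'n \<Rightarrow> real" where
  "spectral_radius A = Max (cmod ` spectrum A)"

definition positive_eigenvalues :: "real^'n^'n \<Rightarrow> bool" where
  "positive_eigenvalues A \<longleftrightarrow> (\<forall>l\<in>spectrum A. l \<in> \<real> \<and> Re l > 0)"

definition power_bounded :: "real^'n^'n \<Rightarrow> bool" where
  "power_bounded A \<longleftrightarrow> bounded (range (\<lambda>n. ((**) A ^^ n) (mat 1)))"


section \<open>General linear methods\<close>

text \<open>\<open>'s\<close> indexes the stages and \<open>'r\<close> the external vectors. In \<open>real^'b^'a\<close> the type \<open>'a\<close> indexes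
  the rows, so \<open>coeff_U\<close> is an \<open>s\<times>r\<close> matrix.\<close>

record ('s, 'r) glm =
  coeff_A :: "real^'s^'s"
  coeff_U :: "real^'r^'s"
  coeff_B :: "real^'s^'r"
  coeff_V :: "real^'r^'r"

definition strictly_lower_triangular :: "real^('s::{finite,linorder})^('s::{finite,linorder}) \<Rightarrow> bool" where
  "strictly_lower_triangular A \<longleftrightarrow> (\<forall>i j. i \<le> j \<longrightarrow> A $ i $ j = 0)"

definition M_infinity :: "('s::finite, 'r::finite) glm \<Rightarrow> real^'r^'r" where
  "M_infinity M = coeff_V M - coeff_B M ** matrix_inv (coeff_A M) ** coeff_U M"

definition cpow :: "real^'s \<Rightarrow> nat \<Rightarrow> real^'s" where
  "cpow c k = (\<chi> i. (c $ i) ^ k)"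

text \<open>The columns of \<open>W\<close> are \<open>w 0, \<dots>, w p\<close>; the values of \<open>w\<close> beyond \<open>p\<close> play no role.\<close>

definition glm_order ::
  "real^'s \<Rightarrow> ('s::finite, 'r::finite) glm \<Rightarrow> (nat \<Rightarrow> real^'r) \<Rightarrow> nat \<Rightarrow> nat \<Rightarrow> bool" where
  "glm_order c M w p q \<longleftrightarrow>
     q \<in> {p - 1, p} \<and>
     coeff_U M *v w 0 = 1 \<and> coeff_V M *v w 0 = w 0 \<and>
     (\<forall>k\<in>{1..q}. (1 / fact k) *\<^sub>R cpow c k
        - (1 / fact (k - 1)) *\<^sub>R (coeff_A M *v cpow c (k - 1)) - coeff_U M *v w k = 0) \<and>
     (\<forall>k\<in>{1..p}. (\<Sum>l\<le>k. (1 / fact l) *\<^sub>R w (k - l))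
        - (1 / fact (k - 1)) *\<^sub>R (coeff_B M *v cpow c (k - 1)) - coeff_V M *v w k = 0)"

definition imex_class ::
  "real^('s::{finite,linorder}) \<Rightarrow> ('s, 'r::finite) glm \<Rightarrow> ('s, 'r) glm \<Rightarrow>
   (nat \<Rightarrow> real^'r) \<Rightarrow> (nat \<Rightarrow> real^'r) \<Rightarrow> nat \<Rightarrow> nat \<Rightarrow> nat \<Rightarrow> bool" where
  "imex_class c ME MI wE wI p qE qI \<longleftrightarrow>
     1 \<le> p \<and>
     strictly_lower_triangular (coeff_A ME) \<and>
     glm_order c ME wE p qE \<and> glm_order c MI wI p qI \<and>
     positive_eigenvalues (coeff_A MI) \<and>
     spectral_radius (M_infinity MI) < 1"


section \<open>The method on the differential-algebraic problem\<close>

definition dae_solution ::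
  "((real^'m) \<times> (real^'m) \<Rightarrow> real^'m) \<Rightarrow> ((real^'m) \<times> (real^'m) \<Rightarrow> real^'m) \<Rightarrow> real set \<Rightarrow>
   (real \<Rightarrow> real^'m) \<Rightarrow> (real \<Rightarrow> real^'m) \<Rightarrow> bool" where
  "dae_solution f g T x z \<longleftrightarrow>
     continuous_on T z \<and>
     (\<forall>t\<in>T. (x has_vector_derivative f (x t, z t)) (at t) \<and> g (x t, z t) = 0)"

definition stagewise ::
  "((real^'m) \<times> (real^'m) \<Rightarrow> real^'m) \<Rightarrow> real^'m^'s \<Rightarrow> real^'m^'s \<Rightarrow> real^'m^'s" where
  "stagewise f X Z = (\<chi> i. f (X $ i, Z $ i))"

text \<open>A stacked vector of \<open>s\<close> blocks in \<open>\<real>\<^sup>m\<close> is an \<open>s\<times>m\<close> matrix with the blocks as rows; on it the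
  Kronecker product \<open>A \<otimes> I\<^sub>m\<close> acts as the matrix product \<open>A ** X\<close>. The predicate describes the first
  \<open>N\<close> steps of size \<open>h\<close>; \<open>\<xi> 0\<close> and \<open>\<zeta> 0\<close> are the starting vectors.\<close>

definition imex_dae_steps ::
  "('s::finite, 'r::finite) glm \<Rightarrow> ('s, 'r) glm \<Rightarrow>
   ((real^'m) \<times> (real^'m) \<Rightarrow> real^'m) \<Rightarrow> ((real^'m) \<times> (real^'m) \<Rightarrow> real^'m) \<Rightarrow> real \<Rightarrow> nat \<Rightarrow>
   (nat \<Rightarrow> real^'m^'s) \<Rightarrow> (nat \<Rightarrow> real^'m^'s) \<Rightarrow> (nat \<Rightarrow> real^'m^'r) \<Rightarrow> (nat \<Rightarrow> real^'m^'r) \<Rightarrow> bool" where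
  "imex_dae_steps ME MI f g h N X Z \<xi> \<zeta> \<longleftrightarrow> (\<forall>n\<in>{1..N}.
     X n = h *\<^sub>R (coeff_A ME ** stagewise f (X n) (Z n)) + coeff_U ME ** \<xi> (n - 1) \<and>
     stagewise g (X n) (Z n) = 0 \<and>
     \<xi> n = h *\<^sub>R (coeff_B ME ** stagewise f (X n) (Z n)) + coeff_V ME ** \<xi> (n - 1) \<and>
     \<zeta> n = (coeff_B MI ** matrix_inv (coeff_A MI)) ** Z n + M_infinity MI ** \<zeta> (n - 1))"

definition stage_values :: "(real \<Rightarrow> real^'m) \<Rightarrow> real^'s \<Rightarrow> real \<Rightarrow> real \<Rightarrow> real^'m^'s" where
  "stage_values y c h t = (\<chi> i. y (t + c $ i * h))"

definition eta :: "real \<Rightarrow> (real \<Rightarrow> real^'m) \<Rightarrow> real \<Rightarrow> nat \<Rightarrow> real^'m" where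
  "eta h y t k = h ^ k *\<^sub>R nth_deriv k y t"

text \<open>\<open>(W \<otimes> I\<^sub>m) \<eta>\<^sub>p(h, y, t)\<close>\<close>

definition external_values ::
  "(nat \<Rightarrow> real^'r) \<Rightarrow> nat \<Rightarrow> real \<Rightarrow> (real \<Rightarrow> real^'m) \<Rightarrow> real \<Rightarrow> real^'m^'r" where
  "external_values w p h y t = (\<chi> i. \<Sum>k\<le>p. (w k $ i) *\<^sub>R eta h y t k)"

text \<open>Selects the local branch \<open>Z = G(X)\<close> of \<open>g(X, Z) = 0\<close>. The neighbourhood has to move with time:
  the solution may return to the same \<open>x\<close> with another \<open>z\<close>, so that a neighbourhood
  of its trace in \<open>(x, z)\<close>-space would not determine the branch.\<close>

definition on_local_branch ::
  "(real \<Rightarrow> real^'m) \<Rightarrow> real^'s \<Rightarrow> real \<Rightarrow> real \<Rightarrow> real \<Rightarrow> nat \<Rightarrow> (nat \<Rightarrow> real^'m^'s) \<Rightarrow> bool" where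
  "on_local_branch z c t0 \<delta> h N Z \<longleftrightarrow>
     (\<forall>n\<in>{1..N}. \<forall>i. dist (Z n $ i) (stage_values z c h (t0 + real (n - 1) * h) $ i) < \<delta>)"

end

theory Submission
  imports Defs "HOL-Computational_Algebra.Fundamental_Theorem_Algebra"
begin

text \<open>Near the exact solution the equation \<open>g (x, z) = 0\<close> determines \<open>z\<close> from \<open>x\<close>, with a Lipschitz
  constant that is uniform in time (\<open>local_branch\<close>). On this branch an error in \<open>X\<close> passes to \<open>Z\<close> with a
  constant factor only, so \<open>\<xi>\<close> is propagated as by an explicit method for an ordinary differential
  equation, and \<open>\<zeta>\<close> merely follows.

  Consistency. The exact solution is smooth: its velocity is a smooth function of its position on \<open>D\<close>, so
  that time derivatives become Lie derivatives (\<open>z_deriv\<close>, \<open>solution_derivs\<close>). Its values in the equations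
  of a step can therefore be expanded in powers of \<open>h\<close>, and the order conditions say that the
  coefficients cancel: up to \<open>O(h\<^sup>p)\<close> in the stages (\<open>stage_residual\<close>) and up to
  \<open>O(h\<^sup>p\<^sup>+\<^sup>1)\<close> in the external vectors (\<open>external_residual\<close>). Eliminating the stage derivatives with
  \<open>(A\<^sup>I)\<^sup>-\<^sup>1\<close> yields a residual \<open>O(h\<^sup>p)\<close> for the update of \<open>\<zeta>\<close> (\<open>stiff_limit_residual\<close>).

  Stability. The stages enter the update of \<open>\<xi>\<close> with a factor \<open>h\<close>, which compensates their lower
  accuracy (\<open>one_step\<close>). As \<open>V\<^sup>E\<close> is power bounded, a discrete Gronwall argument gives a global error
  \<open>O(h\<^sup>p)\<close> (\<open>power_bounded_recurrence_bound\<close>). The update of \<open>\<zeta>\<close> has no factor \<open>h\<close>, and residuals of size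
  \<open>h\<^sup>p\<close> added up over \<open>1/h\<close> steps would cost one order. They do not add up: since the spectral radius of
  \<open>M\<^sup>I(\<infinity>)\<close> is less than \<open>1\<close>, its powers are summable (\<open>spectral_radius_less_1_summable\<close>,
  \<open>summable_recurrence_bound\<close>).

  All local estimates require the error to stay below some fixed \<open>r\<close>. As \<open>p \<ge> 1\<close>, the global bound
  \<open>C h\<^sup>p\<close> is below \<open>r\<close> for small \<open>h\<close>, so existence and error bound are obtained in one induction over
  the steps (\<open>trajectory_bounds\<close>).\<close>

section \<open>Calculus of continuously differentiable functions\<close>

lemma C_k_on_cong:
  assumes "open S" "\<forall>x\<in>S. f x = g x" "C_k_on k f S"
  shows "C_k_on k g S"
  using assms(2,3)
proof (induction k arbitrary: f g)
  case 0
  then show ?case using continuous_on_cong[of S S f g] by simp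
next
  case (Suc k)
  have der: "(g has_derivative frechet_derivative f (at x)) (at x)" if "x \<in> S" for x
  proof -
    have "(f has_derivative frechet_derivative f (at x)) (at x)"
      using Suc.prems that frechet_derivative_works by auto
    then show ?thesis
      by (rule has_derivative_transform_within_open[OF _ \<open>open S\<close> that])
        (use Suc.prems in auto)
  qed
  have eq: "\<forall>x\<in>S. frechet_derivative f (at x) v = frechet_derivative g (at x) v" for v
    by (simp add: frechet_derivative_at[OF der])
  have "C_k_on k (\<lambda>x. frechet_derivative g (at x) v) S" for v
    by (rule Suc.IH[OF eq]) (use Suc.prems in simp)
  moreover have "\<forall>x\<in>S. g differentiable (at x)"
    using der differentiable_def by blast
  ultimately show ?case by simp
qed

lemma C_k_onI_Suc:
  assumes "open S" and "\<And>x. x \<in> S \<Longrightarrow> (f has_derivative f' x) (at x)"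
    and "\<And>v. C_k_on k (\<lambda>x. f' x v) S"
  shows "C_k_on (Suc k) f S"
proof -
  have "\<forall>x\<in>S. f' x = frechet_derivative f (at x)"
    by (intro ballI frechet_derivative_at assms(2))
  then have "C_k_on k (\<lambda>x. frechet_derivative f (at x) v) S" for v
    by (intro C_k_on_cong[OF assms(1) _ assms(3)[of v]]) auto
  moreover have "\<forall>x\<in>S. f differentiable (at x)"
    using assms(2) differentiable_def by blast
  ultimately show ?thesis by simp
qed

lemma C_k_on_Suc_has_derivative:
  assumes "C_k_on (Suc k) f S" "x \<in> S"
  shows "(f has_derivative frechet_derivative f (at x)) (at x)"
  using assms frechet_derivative_works by auto

lemma C_k_on_SucD: "C_k_on (Suc k) f S \<Longrightarrow> C_k_on k f S"
proof (induction k arbitrary: f)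
  case 0
  then show ?case
    by (auto intro!: continuous_at_imp_continuous_on differentiable_imp_continuous_within)
qed auto

lemma C_k_on_imp_continuous_on: "C_k_on k f S \<Longrightarrow> continuous_on S f"
  by (induction k) (simp, metis C_k_on_SucD)

lemma C_k_on_const: "open S \<Longrightarrow> C_k_on k (\<lambda>x. c) S"
  by (induction k arbitrary: c) auto

lemma C_k_on_linear_compose:
  assumes "open S" "bounded_linear T" "C_k_on k f S"
  shows "C_k_on k (\<lambda>x. T (f x)) S"
  using assms(3)
proof (induction k arbitrary: f)
  case 0
  then show ?case
    by (simp add: bounded_linear.continuous_on[OF assms(2)])
next
  case (Suc k)
  show ?case
  proof (rule C_k_onI_Suc[OF \<open>open S\<close>])
    fix x assume "x \<in> S"
    show "((\<lambda>x. T (f x)) has_derivative (\<lambda>v. T (frechet_derivative f (at x) v))) (at x)"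
      by (rule bounded_linear.has_derivative[OF assms(2)
            C_k_on_Suc_has_derivative[OF Suc.prems \<open>x \<in> S\<close>]])
  qed (use Suc in auto)
qed

lemma C_k_on_add:
  assumes "open S" "C_k_on k f S" "C_k_on k g S"
  shows "C_k_on k (\<lambda>x. f x + g x) S"
  using assms(2,3)
proof (induction k arbitrary: f g)
  case 0
  then show ?case by (simp add: continuous_on_add)
next
  case (Suc k)
  show ?case
    by (rule C_k_onI_Suc[OF \<open>open S\<close> has_derivative_add[OF
        C_k_on_Suc_has_derivative[OF Suc.prems(1)] C_k_on_Suc_has_derivative[OF Suc.prems(2)]]])
      (use Suc in auto)
qed

lemma C_k_on_sum:
  assumes "open S" "\<And>i. i \<in> I \<Longrightarrow> C_k_on k (f i) S"
  shows "C_k_on k (\<lambda>x. \<Sum>i\<in>I. f i x) S"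
  using assms(2)
  by (induction I rule: infinite_finite_induct)
    (auto intro!: C_k_on_add C_k_on_const assms(1))

lemma C_k_on_bilinear:
  assumes "open S" "bounded_bilinear bop" "C_k_on k f S" "C_k_on k g S"
  shows "C_k_on k (\<lambda>x. bop (f x) (g x)) S"
  using assms(3,4)
proof (induction k arbitrary: f g)
  case 0
  then show ?case by (simp add: bounded_bilinear.continuous_on[OF assms(2)])
next
  case (Suc k)
  show ?case
    by (rule C_k_onI_Suc[OF \<open>open S\<close> bounded_bilinear.FDERIV[OF assms(2)
        C_k_on_Suc_has_derivative[OF Suc.prems(1)] C_k_on_Suc_has_derivative[OF Suc.prems(2)]]])
      (use Suc.prems in \<open>auto intro!: C_k_on_add[OF assms(1)] Suc.IH intro: C_k_on_SucD\<close>)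
qed

lemmas C_k_on_mult = C_k_on_bilinear[OF _ bounded_bilinear_mult]
lemmas C_k_on_scaleR = C_k_on_bilinear[OF _ bounded_bilinear_scaleR]

lemma C_k_on_prod:
  fixes f :: "'i \<Rightarrow> 'a::real_normed_vector \<Rightarrow> 'b::{real_normed_algebra,comm_ring_1}"
  assumes "open S" "\<And>i. i \<in> I \<Longrightarrow> C_k_on k (f i) S"
  shows "C_k_on k (\<lambda>x. \<Prod>i\<in>I. f i x) S"
  using assms(2)
  by (induction I rule: infinite_finite_induct)
    (auto intro!: C_k_on_mult C_k_on_const assms(1))

lemma C_k_on_inverse:
  fixes d :: "'a::real_normed_vector \<Rightarrow> real"
  assumes "open S" "C_k_on k d S" "\<forall>x\<in>S. d x \<noteq> 0"
  shows "C_k_on k (\<lambda>x. inverse (d x)) S"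
  using assms(2)
proof (induction k)
  case 0
  then show ?case using assms(3) by (simp add: continuous_on_inverse)
next
  case (Suc k)
  show ?case
  proof (rule C_k_onI_Suc[OF \<open>open S\<close>])
    fix x assume "x \<in> S"
    show "((\<lambda>x. inverse (d x)) has_derivative
        (\<lambda>v. - 1 * (inverse (d x) * frechet_derivative d (at x) v * inverse (d x)))) (at x)"
      using Deriv.has_derivative_inverse[OF _ C_k_on_Suc_has_derivative[OF Suc.prems \<open>x \<in> S\<close>]]
        assms(3) \<open>x \<in> S\<close> by simp
  next
    fix v
    show "C_k_on k (\<lambda>x. - 1 * (inverse (d x) * frechet_derivative d (at x) v * inverse (d x))) S"
      by (intro C_k_on_mult C_k_on_const \<open>open S\<close>)
        (use Suc.IH[OF C_k_on_SucD[OF Suc.prems]] Suc.prems in auto)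
  qed
qed

lemma C_k_on_det:
  fixes M :: "'a::real_normed_vector \<Rightarrow> real^'n^'n"
  assumes "open S" "\<And>i j. C_k_on k (\<lambda>x. M x $ i $ j) S"
  shows "C_k_on k (\<lambda>x. det (M x)) S"
  unfolding det_def
  by (intro C_k_on_sum C_k_on_mult C_k_on_const C_k_on_prod assms)

lemma
  fixes A :: "real^'n^'n"
  assumes "invertible A"
  shows matrix_mult_inv: "A ** matrix_inv A = mat 1"
    and matrix_inv_mult: "matrix_inv A ** A = mat 1"
  using assms unfolding invertible_def matrix_inv_def by (metis (mono_tags, lifting) someI_ex)+

text \<open>By Cramer's rule every entry of the inverse is a quotient of determinants, hence as smooth
  as the entries of the matrix.\<close>

lemma C_k_on_matrix_inv:
  fixes M :: "'a::real_normed_vector \<Rightarrow> real^'n^'n"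
  assumes "open S" "\<And>i j. C_k_on k (\<lambda>x. M x $ i $ j) S" "\<forall>x\<in>S. invertible (M x)"
  shows "C_k_on k (\<lambda>x. matrix_inv (M x) $ i $ j) S"
proof -
  let ?N = "\<lambda>x. \<chi> a b. if b = i then axis j 1 $ a else M x $ a $ b"
  have "det (?N x) * inverse (det (M x)) = matrix_inv (M x) $ i $ j" if "x \<in> S" for x
  proof -
    have "det (M x) \<noteq> 0" using assms(3) that invertible_det_nz by blast
    moreover have "M x *v (matrix_inv (M x) *v axis j 1) = axis j 1"
      using assms(3) that by (simp add: matrix_vector_mul_assoc matrix_mult_inv)
    ultimately have "matrix_inv (M x) *v axis j 1
        = (\<chi> k. det (\<chi> a b. if b = k then axis j 1 $ a else M x $ a $ b) / det (M x))"
      by (rule cramer[THEN iffD1])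
    then have "(matrix_inv (M x) *v axis j 1) $ i = det (?N x) / det (M x)"
      by simp
    then show ?thesis
      by (simp add: matrix_vector_mult_basis column_def field_simps)
  qed
  moreover have "C_k_on k (\<lambda>x. det (?N x) * inverse (det (M x))) S"
  proof (intro C_k_on_mult C_k_on_inverse C_k_on_det assms)
    show "C_k_on k (\<lambda>x. ?N x $ a $ b) S" for a b
      using assms by (cases "b = i") (auto intro: C_k_on_const)
    show "\<forall>x\<in>S. det (M x) \<noteq> 0" using assms(3) invertible_det_nz by blast
  qed
  ultimately show ?thesis by (rule C_k_on_cong[OF assms(1) ballI])
qed

lemma C_k_on_vec:
  fixes u :: "'a::real_normed_vector \<Rightarrow> 'b::euclidean_space^'n"
  assumes "open S" "\<And>i. C_k_on k (\<lambda>x. u x $ i) S"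
  shows "C_k_on k u S"
proof (rule C_k_on_cong[OF assms(1)])
  have "linear (\<lambda>v::'b. axis i v)" for i :: 'n
    by (rule linearI) (simp_all add: vec_eq_iff axis_def)
  then show "C_k_on k (\<lambda>x. \<Sum>i\<in>UNIV. axis i (u x $ i)) S"
    by (intro C_k_on_sum[OF assms(1)]) (rule C_k_on_linear_compose[OF assms(1) _ assms(2)],
        simp add: linear_conv_bounded_linear)
  show "\<forall>x\<in>S. (\<Sum>i\<in>UNIV. axis i (u x $ i)) = u x"
    by (simp add: vec_eq_iff axis_def)
qed

lemma C_k_on_matrix_vector_mult:
  fixes M :: "'a::real_normed_vector \<Rightarrow> real^'n^'m"
  assumes "open S" "\<And>i j. C_k_on k (\<lambda>x. M x $ i $ j) S" "C_k_on k u S"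
  shows "C_k_on k (\<lambda>x. M x *v u x) S"
proof (rule C_k_on_vec[OF assms(1)])
  fix i
  have "C_k_on k (\<lambda>x. \<Sum>j\<in>UNIV. M x $ i $ j * u x $ j) S"
    by (rule C_k_on_sum[OF assms(1) C_k_on_mult[OF assms(1) assms(2)
            C_k_on_linear_compose[OF assms(1) bounded_linear_vec_nth assms(3)]]])
  then show "C_k_on k (\<lambda>x. (M x *v u x) $ i) S"
    by (simp add: matrix_vector_mult_def)
qed

text \<open>Expanding the direction \<open>F w\<close> in the basis reduces a varying direction to the fixed
  directions of which the definition of \<open>C_k_on\<close> speaks.\<close>

lemma C_k_on_frechet_derivative:
  fixes \<phi> :: "'a::euclidean_space \<Rightarrow> 'b::real_normed_vector"
  assumes "open S" "C_k_on (Suc k) \<phi> S" "C_k_on k F S"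
  shows "C_k_on k (\<lambda>w. frechet_derivative \<phi> (at w) (F w)) S"
proof (rule C_k_on_cong[OF assms(1)])
  show "C_k_on k (\<lambda>w. \<Sum>b\<in>Basis. (F w \<bullet> b) *\<^sub>R frechet_derivative \<phi> (at w) b) S"
    using assms(2)
    by (intro C_k_on_sum C_k_on_scaleR C_k_on_linear_compose[OF _ bounded_linear_inner_left] assms)
      simp
  show "\<forall>w\<in>S. (\<Sum>b\<in>Basis. (F w \<bullet> b) *\<^sub>R frechet_derivative \<phi> (at w) b)
      = frechet_derivative \<phi> (at w) (F w)"
  proof
    fix w assume "w \<in> S"
    then have lin: "linear (frechet_derivative \<phi> (at w))"
      using C_k_on_Suc_has_derivative[OF assms(2)] has_derivative_linear by blast
    have "frechet_derivative \<phi> (at w) (\<Sum>b\<in>Basis. (F w \<bullet> b) *\<^sub>R b)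
        = (\<Sum>b\<in>Basis. (F w \<bullet> b) *\<^sub>R frechet_derivative \<phi> (at w) b)"
      by (simp add: linear_sum[OF lin] linear_scale[OF lin])
    then show "(\<Sum>b\<in>Basis. (F w \<bullet> b) *\<^sub>R frechet_derivative \<phi> (at w) b)
        = frechet_derivative \<phi> (at w) (F w)"
      by (simp add: euclidean_representation)
  qed
qed

text \<open>The derivative is bounded on a closed neighbourhood of \<open>K\<close>. That neighbourhood need not be
  convex, so the mean value inequality is applied in the single balls that make it up.\<close>

lemma uniform_lipschitz_near_compact:
  fixes \<phi> :: "'a::euclidean_space \<Rightarrow> 'b::real_normed_vector"
  assumes "open D" "C_k_on (Suc 0) \<phi> D" "compact K" "K \<subseteq> D"
  obtains \<delta> L where "\<delta> > 0" "L \<ge> 0" "\<And>y. y \<in> K \<Longrightarrow> cball y \<delta> \<subseteq> D"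
    "\<And>y w w'. y \<in> K \<Longrightarrow> w \<in> cball y \<delta> \<Longrightarrow> w' \<in> cball y \<delta> \<Longrightarrow>
       norm (\<phi> w - \<phi> w') \<le> L * norm (w - w')"
proof -
  obtain \<delta> where \<delta>: "\<delta> > 0" "(\<Union>y\<in>K. cball y \<delta>) \<subseteq> D"
    using compact_subset_open_imp_cball_epsilon_subset assms by metis
  let ?K = "\<Union>y\<in>K. cball y \<delta>"
  have "(\<Union>v\<in>cball 0 \<delta>. {y + v}) = cball y \<delta>" for y :: 'a
  proof -
    have "(\<Union>v\<in>cball 0 \<delta>. {y + v}) = (+) y ` cball 0 \<delta>" by blast
    also have "\<dots> = cball (0 + y) \<delta>" by (rule image_add_cball)
    finally show ?thesis by (simp only: add_0_left)
  qed
  then have "compact ?K" using compact_sums'[OF assms(3) compact_cball[of 0 \<delta>]] by simp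
  have cont: "continuous_on ?K (\<lambda>w. frechet_derivative \<phi> (at w) b)" for b
    using assms(2) \<delta>(2) by (auto intro: continuous_on_subset)
  have "continuous_on ?K (\<lambda>w. \<Sum>b\<in>Basis. norm (frechet_derivative \<phi> (at w) b))"
    by (intro continuous_intros cont)
  then have "bounded ((\<lambda>w. \<Sum>b\<in>Basis. norm (frechet_derivative \<phi> (at w) b)) ` ?K)"
    using \<open>compact ?K\<close> compact_continuous_image compact_imp_bounded by blast
  then obtain B where B': "\<forall>r\<in>(\<lambda>w. \<Sum>b\<in>Basis. norm (frechet_derivative \<phi> (at w) b)) ` ?K. norm r \<le> B"
    unfolding bounded_iff by blast
  have B: "\<bar>\<Sum>b\<in>Basis. norm (frechet_derivative \<phi> (at w) b)\<bar> \<le> B" if w: "w \<in> ?K" for w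
    using bspec[OF B' imageI[OF w]] by (simp only: real_norm_def)
  show thesis
  proof (rule that[of \<delta> "\<bar>B\<bar>"])
    fix y w w' assume y: "y \<in> K" and w: "w \<in> cball y \<delta>" "w' \<in> cball y \<delta>"
    show "norm (\<phi> w - \<phi> w') \<le> \<bar>B\<bar> * norm (w - w')"
    proof (rule differentiable_bound[OF convex_cball _ _ w(1) w(2)])
      fix v assume "v \<in> cball y \<delta>"
      then have v: "v \<in> ?K" using y by blast
      then have der: "(\<phi> has_derivative frechet_derivative \<phi> (at v)) (at v)"
        using C_k_on_Suc_has_derivative[OF assms(2)] \<delta>(2) by blast
      then show "(\<phi> has_derivative frechet_derivative \<phi> (at v)) (at v within cball y \<delta>)"
        by (rule has_derivative_at_withinI)
      interpret bounded_linear "frechet_derivative \<phi> (at v)"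
        using der by (rule has_derivative_bounded_linear)
      show "onorm (frechet_derivative \<phi> (at v)) \<le> \<bar>B\<bar>"
      proof (rule onorm_bound)
        fix u
        have "frechet_derivative \<phi> (at v) u
            = (\<Sum>b\<in>Basis. (u \<bullet> b) *\<^sub>R frechet_derivative \<phi> (at v) b)"
          using sum[of "\<lambda>b. (u \<bullet> b) *\<^sub>R b" Basis] by (simp add: scale euclidean_representation)
        also have "norm \<dots> \<le> (\<Sum>b\<in>Basis. norm u * norm (frechet_derivative \<phi> (at v) b))"
          by (intro sum_norm_le) (simp add: Basis_le_norm mult_right_mono)
        also have "\<dots> \<le> \<bar>B\<bar> * norm u"
          using mult_left_mono[OF order_trans[OF abs_ge_self order_trans[OF B[OF v] abs_ge_self]],
              of "norm u"]
          by (simp add: sum_distrib_left mult.commute)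
        finally show "norm (frechet_derivative \<phi> (at v) u) \<le> \<bar>B\<bar> * norm u" .
      qed simp
    qed
  qed (use \<delta> in auto)
qed

section \<open>Norms and powers of matrices\<close>

text \<open>A crude matrix norm, which bounds the action on vectors and on stacked vectors alike.\<close>

definition entry_norm :: "real^'n^'m \<Rightarrow> real" where
  "entry_norm A = (\<Sum>i\<in>UNIV. \<Sum>j\<in>UNIV. \<bar>A $ i $ j\<bar>)"

lemma entry_norm_nonneg: "0 \<le> entry_norm A"
  by (simp add: entry_norm_def sum_nonneg)

lemma matrix_mult_row:
  fixes X :: "real^'m^'s"
  shows "(A ** X) $ i = (\<Sum>j\<in>UNIV. A $ i $ j *\<^sub>R X $ j)"
  by (simp add: vec_eq_iff matrix_matrix_mult_def)

lemma norm_vec_le_sum: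
  fixes X :: "'a::real_normed_vector^'s"
  shows "norm X \<le> (\<Sum>i\<in>UNIV. norm (X $ i))"
  unfolding norm_vec_def by (rule L2_set_le_sum) simp

lemma norm_matrix_mult_le:
  fixes X :: "real^'m^'s"
  shows "norm (A ** X) \<le> entry_norm A * norm X"
proof -
  have "norm (A ** X) \<le> (\<Sum>i\<in>UNIV. \<Sum>j\<in>UNIV. \<bar>A $ i $ j\<bar> * norm X)"
    by (rule order_trans[OF norm_vec_le_sum])
      (auto intro!: sum_mono sum_norm_le simp: matrix_mult_row mult_left_mono Finite_Cartesian_Product.norm_nth_le)
  then show ?thesis by (simp add: entry_norm_def sum_distrib_right)
qed

lemma norm_vec_le_card:
  fixes X :: "'a::real_normed_vector^'s"
  assumes "\<And>i. norm (X $ i) \<le> B"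
  shows "norm X \<le> real CARD('s) * B"
  using order_trans[OF norm_vec_le_sum sum_mono[of UNIV "\<lambda>i. norm (X $ i)" "\<lambda>i. B"]] assms by simp

lemma norm_matrix_vector_le: "norm (A *v v) \<le> entry_norm A * norm v"
  for A :: "real^'n^'m"
proof -
  have "norm (A *v v) \<le> (\<Sum>i\<in>UNIV. norm ((A *v v) $ i))" by (rule norm_vec_le_sum)
  also have "\<dots> \<le> (\<Sum>i\<in>UNIV. \<Sum>j\<in>UNIV. \<bar>A $ i $ j\<bar> * norm v)"
  proof (rule sum_mono)
    fix i
    have "norm (\<Sum>j\<in>UNIV. A $ i $ j * v $ j) \<le> (\<Sum>j\<in>UNIV. \<bar>A $ i $ j\<bar> * norm v)"
      by (intro sum_norm_le) (simp add: abs_mult mult_left_mono component_le_norm_cart)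
    then show "norm ((A *v v) $ i) \<le> (\<Sum>j\<in>UNIV. \<bar>A $ i $ j\<bar> * norm v)"
      by (simp add: matrix_vector_mult_def)
  qed
  finally show ?thesis by (simp add: entry_norm_def sum_distrib_right)
qed

lemma entry_norm_le: "entry_norm A \<le> real (CARD('m)) * real (CARD('n)) * norm A"
  for A :: "real^'n^'m"
proof -
  have "\<bar>A $ i $ j\<bar> \<le> norm A" for i j
    by (metis Finite_Cartesian_Product.norm_nth_le order_trans real_norm_def)
  then have "entry_norm A \<le> (\<Sum>i\<in>(UNIV::'m set). \<Sum>j\<in>(UNIV::'n set). norm A)"
    unfolding entry_norm_def by (intro sum_mono)
  then show ?thesis by simp
qed

lemma matrix_mult_linear: "linear (\<lambda>X::real^'m^'s. A ** X)" for A :: "real^'s^'r"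
  by (rule linearI)
    (simp_all add: vec_eq_iff matrix_matrix_mult_def algebra_simps sum.distrib sum_distrib_left)

lemma matrix_power_mult:
  fixes A :: "real^'r^'r" and X :: "real^'m^'r"
  shows "((**) A ^^ n) X = ((**) A ^^ n) (mat 1) ** X"
  by (induction n) (simp_all add: matrix_mul_assoc)

lemma power_bounded_norm_le:
  fixes A :: "real^'r^'r"
  assumes "power_bounded A"
  obtains K where "K \<ge> 1" "\<And>n (X::real^'m^'r). norm (((**) A ^^ n) X) \<le> K * norm X"
proof -
  obtain B where B: "norm (((**) A ^^ n) (mat 1)) \<le> B" for n
    using assms unfolding power_bounded_def bounded_iff by auto
  have "entry_norm (((**) A ^^ n) (mat 1)) \<le> (\<Sum>i\<in>(UNIV::'r set). \<Sum>j\<in>(UNIV::'r set). B)" for n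
    unfolding entry_norm_def
    by (intro sum_mono order_trans[OF _ B[of n]])
      (metis Finite_Cartesian_Product.norm_nth_le order_trans real_norm_def)
  then have "norm (((**) A ^^ n) X) \<le> max 1 (\<Sum>i\<in>(UNIV::'r set). \<Sum>j\<in>(UNIV::'r set). B) * norm X"
    for n and X :: "real^'m^'r"
    unfolding matrix_power_mult[where n = n and X = X]
    by (intro order_trans[OF norm_matrix_mult_le] mult_right_mono) (auto simp: le_max_iff_disj)
  then show thesis by (rule that[rotated]) simp
qed

text \<open>The vector \<open>p(A) v\<close>.\<close>

definition poly_act :: "complex poly \<Rightarrow> complex^'n^'n \<Rightarrow> complex^'n \<Rightarrow> complex^'n" where
  "poly_act p A v = (\<Sum>i\<le>degree p. coeff p i *s ((*v) A ^^ i) v)"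

lemma poly_act_altdef:
  assumes "degree p \<le> d"
  shows "poly_act p A v = (\<Sum>i\<le>d. coeff p i *s ((*v) A ^^ i) v)"
  unfolding poly_act_def
  by (rule sum.mono_neutral_left) (use assms in \<open>auto simp: coeff_eq_0\<close>)

lemma poly_act_root_factor:
  "poly_act ([:- l, 1:] * q) A v = A *v poly_act q A v - l *s poly_act q A v"
proof -
  let ?d = "Suc (degree q)"
  have deg: "degree ([:- l, 1:] * q) \<le> ?d"
    using degree_mult_le[of "[:- l, 1:]" q] by simp
  have coeff: "coeff ([:- l, 1:] * q) i = coeff (pCons 0 q) i - l * coeff q i" for i
    by simp
  have "poly_act ([:- l, 1:] * q) A v =
      (\<Sum>i\<le>?d. coeff (pCons 0 q) i *s ((*v) A ^^ i) v) - (\<Sum>i\<le>?d. (l * coeff q i) *s ((*v) A ^^ i) v)"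
    unfolding poly_act_altdef[OF deg]
    by (simp only: coeff vec.scale_left_diff_distrib sum_subtractf)
  also have "(\<Sum>i\<le>?d. (l * coeff q i) *s ((*v) A ^^ i) v) = l *s poly_act q A v"
    unfolding poly_act_altdef[of q ?d, OF le_SucI[OF order_refl]]
    by (simp add: vec.scale_sum_right vector_smult_assoc)
  also have "(\<Sum>i\<le>?d. coeff (pCons 0 q) i *s ((*v) A ^^ i) v) = A *v poly_act q A v"
    unfolding sum.atMost_Suc_shift poly_act_def
    by (simp add: vec.linear_sum[OF matrix_vector_mul_linear_gen] vector_scalar_commute)
  finally show ?thesis .
qed

lemma poly_act_eigenvector:
  assumes "A *v v = l *s v"
  shows "poly_act p A v = poly p l *s v"
proof -
  have "((*v) A ^^ i) v = (l ^ i) *s v" for i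
    by (induction i) (simp_all add: vector_scalar_commute assms mult.commute)
  then show ?thesis
    by (simp add: poly_act_def poly_altdef vec.scale_sum_left)
qed

text \<open>Stated for families rather than sets, since the powers of a matrix may repeat.\<close>

lemma exists_linear_dependence:
  fixes u :: "nat \<Rightarrow> 'a::euclidean_space"
  shows "\<exists>c N. (\<exists>i\<le>N. c i \<noteq> 0) \<and> (\<Sum>i\<le>N. c i *\<^sub>R u i) = 0"
proof (cases "inj_on u {..DIM('a)}")
  case True
  then have "dependent (u ` {..DIM('a)})"
    by (intro dependent_biggerset) (simp add: card_image)
  then obtain k where k: "\<exists>v\<in>u ` {..DIM('a)}. k v \<noteq> 0" "(\<Sum>v\<in>u ` {..DIM('a)}. k v *\<^sub>R v) = 0"
    by (auto simp: dependent_finite)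
  then show ?thesis
    by (intro exI[of _ "k \<circ> u"] exI[of _ "DIM('a)"]) (auto simp: sum.reindex[OF True])
next
  case False
  then obtain i j where ij: "i \<le> DIM('a)" "j \<le> DIM('a)" "i \<noteq> j" "u i = u j"
    by (auto simp: inj_on_def)
  have "(\<Sum>k\<le>DIM('a). ((if k = i then 1 else 0) - (if k = j then 1 else 0)) *\<^sub>R u k) = 0"
    using ij by (simp add: scaleR_left_diff_distrib sum_subtractf if_distrib[of "\<lambda>a. a *\<^sub>R _"]
        cong: if_cong)
  then show ?thesis
    using ij by (intro exI[of _ "\<lambda>k. (if k = i then 1 else 0) - (if k = j then 1 else 0)"]
        exI[of _ "DIM('a)"] conjI exI[of _ i]) auto
qed

text \<open>The powers of \<open>A\<close> live in a space of finite dimension, so they are linearly dependent.\<close>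

lemma exists_annihilating_poly:
  fixes A :: "complex^'n^'n"
  shows "\<exists>p. p \<noteq> 0 \<and> (\<forall>v. poly_act p A v = 0)"
proof -
  obtain c N i where c: "i \<le> N" "c i \<noteq> 0" "(\<Sum>i\<le>N. c i *\<^sub>R ((**) A ^^ i) (mat 1)) = 0"
    using exists_linear_dependence[of "\<lambda>i. ((**) A ^^ i) (mat 1)"] by blast
  define p where "p = (\<Sum>i\<le>N. monom (complex_of_real (c i)) i)"
  have coeff: "coeff p j = (if j \<le> N then complex_of_real (c j) else 0)" for j
    by (simp add: p_def coeff_sum)
  then have "coeff p i \<noteq> 0" using c by simp
  then have "p \<noteq> 0" by auto
  moreover have "poly_act p A v = 0" for v
  proof -
    have pow: "((*v) A ^^ i) v = ((**) A ^^ i) (mat 1) *v v" for i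
      by (induction i) (simp_all add: matrix_vector_mul_assoc)
    have "degree p \<le> N" by (rule degree_le) (simp add: coeff)
    then have "poly_act p A v = (\<Sum>i\<le>N. complex_of_real (c i) *s (((**) A ^^ i) (mat 1) *v v))"
      by (simp add: poly_act_altdef coeff pow)
    also have "\<dots> = (\<Sum>i\<le>N. c i *\<^sub>R ((**) A ^^ i) (mat 1)) *v v"
    proof -
      have "(\<Sum>i\<le>n. complex_of_real (c i) *s (((**) A ^^ i) (mat 1) *v v)) =
          (\<Sum>i\<le>n. c i *\<^sub>R ((**) A ^^ i) (mat 1)) *v v" for n
      proof (induction n)
        case (Suc n)
        have "complex_of_real a *s (B *v v) = (a *\<^sub>R B) *v v" for a and B :: "complex^'n^'n"
          by (simp add: vec_eq_iff matrix_vector_mult_def scaleR_conv_of_real[where 'a = complex]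
              sum_distrib_left mult.assoc)
        then show ?case using Suc by (simp add: matrix_vector_mult_add_rdistrib)
      qed (simp add: vec_eq_iff matrix_vector_mult_def scaleR_conv_of_real[where 'a = complex]
              sum_distrib_left mult.assoc)
      then show ?thesis .
    qed
    finally show ?thesis using c(3) by simp
  qed
  ultimately show ?thesis by blast
qed

text \<open>Every eigenvalue is a root of an annihilating polynomial. Finiteness is what makes the maximum
  in the definition of the spectral radius an upper bound for the spectrum.\<close>

lemma finite_spectrum: "finite (spectrum A)"
proof -
  obtain p where p: "p \<noteq> 0" "\<And>v. poly_act p (complexify A) v = 0"
    using exists_annihilating_poly by blast
  have "poly p l = 0" if l: "l \<in> spectrum A" for l
  proof -
    obtain v where "v \<noteq> 0" "complexify A *v v = l *s v"
      using l by (auto simp: spectrum_def)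
    then show ?thesis using poly_act_eigenvector[of "complexify A" v l p] p(2) by simp
  qed
  then have "spectrum A \<subseteq> {l. poly p l = 0}" by auto
  then show ?thesis using poly_roots_finite[OF p(1)] finite_subset by blast
qed

lemma summable_of_affine_recurrence:
  fixes a b :: "nat \<Rightarrow> real"
  assumes "summable b" "\<And>n. 0 \<le> b n" "\<And>n. 0 \<le> a n" "\<And>n. a (Suc n) \<le> q * a n + b n"
    and q: "0 \<le> q" "q < 1"
  shows "summable a"
proof (rule summableI_nonneg_bounded)
  let ?X = "(a 0 + suminf b) / (1 - q)"
  have X: "a 0 + q * ?X + suminf b = ?X"
    using q by (simp add: field_simps)
  have nonneg: "0 \<le> ?X" using assms by (simp add: suminf_nonneg)
  fix n show "(\<Sum>i<n. a i) \<le> ?X"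
  proof (induction n)
    case (Suc n)
    have "(\<Sum>i<Suc n. a i) = a 0 + (\<Sum>i<n. a (Suc i))"
      by (rule sum.lessThan_Suc_shift)
    also have "\<dots> \<le> a 0 + (\<Sum>i<n. q * a i + b i)"
      using assms(4) by (intro add_left_mono sum_mono)
    also have "\<dots> = a 0 + q * (\<Sum>i<n. a i) + (\<Sum>i<n. b i)"
      by (simp add: sum.distrib sum_distrib_left)
    also have "\<dots> \<le> a 0 + q * ?X + suminf b"
      using Suc q sum_le_suminf[OF assms(1), of "{..<n}"] assms(2)
      by (intro add_mono mult_left_mono) auto
    finally show ?case using X by simp
  qed (use nonneg in simp)
qed (use assms in auto)

lemma scaleR_eq_complex_scale: "r *\<^sub>R v = complex_of_real r *s v" for v :: "complex^'n"
  by (simp add: vec_eq_iff scaleR_conv_of_real[where 'a = complex])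

lemma norm_complex_scale: "norm (l *s v) = cmod l * norm v" for v :: "complex^'n"
  by (simp add: norm_vec_def norm_mult L2_set_right_distrib)

text \<open>If \<open>|l| < 1\<close>, the orbit of \<open>v\<close> satisfies a contractive recurrence perturbed by the orbit of
  \<open>(A - l) v\<close>; otherwise \<open>l\<close> is not an eigenvalue, so \<open>A - l\<close> is bounded below, and it commutes with \<open>A\<close>.\<close>

lemma summable_orbit_of_factor:
  fixes A :: "complex^'n^'n"
  assumes spec: "\<And>v. v \<noteq> 0 \<Longrightarrow> A *v v = l *s v \<Longrightarrow> cmod l < 1"
    and sum: "summable (\<lambda>n. norm (((*v) A ^^ n) (A *v v - l *s v)))"
  shows "summable (\<lambda>n. norm (((*v) A ^^ n) v))"
proof -
  have orbit: "((*v) A ^^ n) (A *v v - l *s v) = A *v ((*v) A ^^ n) v - l *s ((*v) A ^^ n) v" for n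
    by (induction n) (simp_all add: matrix_vector_mult_diff_distrib vector_scalar_commute)
  show ?thesis
  proof (cases "cmod l < 1")
    case True
    have "norm (((*v) A ^^ Suc n) v) \<le>
        cmod l * norm (((*v) A ^^ n) v) + norm (((*v) A ^^ n) (A *v v - l *s v))" for n
      using norm_triangle_ineq[of "l *s ((*v) A ^^ n) v" "((*v) A ^^ n) (A *v v - l *s v)"]
      by (simp add: orbit norm_complex_scale)
    then show ?thesis
      by (intro summable_of_affine_recurrence[OF sum, of _ "cmod l"]) (use True in auto)
  next
    case False
    have lin: "linear (\<lambda>w. A *v w - l *s w)"
      by (rule linearI) (simp_all add: matrix_vector_right_distrib vec.scale_right_distrib
          scaleR_eq_complex_scale vector_scalar_commute vec.scale_right_diff_distrib mult.commute)
    moreover have "inj (\<lambda>w. A *v w - l *s w)"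
      using spec False by (auto simp: linear_injective_0[OF lin])
    ultimately obtain B where B: "B > 0" "\<And>w. B * norm w \<le> norm (A *v w - l *s w)"
      using linear_inj_bounded_below_pos by blast
    show ?thesis
    proof (rule summable_comparison_test'[OF summable_mult[OF sum, of "1 / B"]])
      fix n
      show "norm (norm (((*v) A ^^ n) v)) \<le> 1 / B * norm (((*v) A ^^ n) (A *v v - l *s v))"
        using B(2)[of "((*v) A ^^ n) v"] B(1) by (simp add: orbit field_simps)
    qed
  qed
qed

text \<open>Factoring an annihilating polynomial into linear factors and removing them one at a time with
  the previous lemma reduces every vector to \<open>0\<close>.\<close>

lemma summable_orbit:
  fixes A :: "complex^'n^'n"
  assumes spec: "\<And>l v. v \<noteq> 0 \<Longrightarrow> A *v v = l *s v \<Longrightarrow> cmod l < 1"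
  shows "summable (\<lambda>n. norm (((*v) A ^^ n) v))"
proof -
  have peel: "summable (\<lambda>n. norm (((*v) A ^^ n) v))"
    if "p \<noteq> 0" "summable (\<lambda>n. norm (((*v) A ^^ n) (poly_act p A v)))" for p
    using that
  proof (induction "degree p" arbitrary: p)
    case 0
    then obtain k where k: "p = [:k:]" "k \<noteq> 0" by (metis degree_eq_zeroE pCons_0_0)
    have "((*v) A ^^ n) (k *s v) = k *s ((*v) A ^^ n) v" for n
      by (induction n) (simp_all add: vector_scalar_commute)
    then have "summable (\<lambda>n. cmod k * norm (((*v) A ^^ n) v))"
      using 0 k by (simp add: poly_act_def norm_complex_scale)
    then show ?case using k by (simp add: summable_cmult_iff)
  next
    case (Suc d)
    have "\<not> (\<exists>a l. a \<noteq> 0 \<and> l = 0 \<and> p = pCons a l)"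
      using Suc.hyps(2) by auto
    then obtain l where "poly p l = 0" using fundamental_theorem_of_algebra_alt by blast
    then obtain q where q: "p = [:- l, 1:] * q" by (auto simp: poly_eq_0_iff_dvd elim: dvdE)
    then have "q \<noteq> 0" using Suc.prems by auto
    then have "degree p = Suc (degree q)" unfolding q by (subst degree_mult_eq) auto
    then have "d = degree q" using Suc.hyps by simp
    moreover have "summable (\<lambda>n. norm (((*v) A ^^ n) (poly_act q A v)))"
      using Suc.prems(2) unfolding q poly_act_root_factor
      by (rule summable_orbit_of_factor[rotated]) (rule spec)
    ultimately show ?case using Suc.hyps \<open>q \<noteq> 0\<close> by blast
  qed
  obtain p where p: "p \<noteq> 0" "\<And>v. poly_act p A v = 0"
    using exists_annihilating_poly by blast
  have "((*v) A ^^ n) 0 = 0" for n by (induction n) simp_all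
  then show ?thesis using peel[OF p(1)] p(2) by simp
qed

text \<open>The entries of the powers are components of the orbits of the unit vectors.\<close>

lemma spectral_radius_less_1_summable:
  fixes A :: "real^'r^'r"
  assumes "spectral_radius A < 1"
  obtains s where "summable s" "\<And>n. 0 \<le> s n"
    "\<And>n (X::real^'m^'r). norm (((**) A ^^ n) X) \<le> s n * norm X"
proof -
  have lt1: "cmod l < 1" if "v \<noteq> 0" "complexify A *v v = l *s v" for l v
  proof -
    have "l \<in> spectrum A" using that by (auto simp: spectrum_def)
    then have "cmod l \<le> spectral_radius A"
      unfolding spectral_radius_def using finite_spectrum by (intro Max_ge) auto
    then show ?thesis using assms by simp
  qed
  have pow: "((*v) (complexify A) ^^ n) v = complexify (((**) A ^^ n) (mat 1)) *v v" for n v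
  proof (induction n)
    case 0
    have "complexify (mat 1 :: real^'r^'r) = mat 1"
      by (simp add: complexify_def mat_def vec_eq_iff)
    then show ?case by simp
  next
    case (Suc n)
    have "complexify (A ** B) = complexify A ** complexify B" for B
      by (simp add: complexify_def matrix_matrix_mult_def vec_eq_iff)
    then show ?case using Suc by (simp add: matrix_vector_mul_assoc)
  qed
  have entry: "\<bar>((**) A ^^ n) (mat 1) $ i $ j\<bar> \<le> norm (((*v) (complexify A) ^^ n) (axis j 1))"
    for n i j
  proof -
    have "\<bar>((**) A ^^ n) (mat 1) $ i $ j\<bar> = norm ((((*v) (complexify A) ^^ n) (axis j 1)) $ i)"
      unfolding pow by (simp add: matrix_vector_mult_def axis_def if_distrib complexify_def
          cong: if_cong)
    also have "\<dots> \<le> norm (((*v) (complexify A) ^^ n) (axis j 1))" by (rule Finite_Cartesian_Product.norm_nth_le)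
    finally show ?thesis .
  qed
  show thesis
  proof (rule that[of "\<lambda>n. entry_norm (((**) A ^^ n) (mat 1))"])
    show "summable (\<lambda>n. entry_norm (((**) A ^^ n) (mat 1)))"
      unfolding entry_norm_def
      by (intro summable_sum summable_comparison_test'[OF summable_orbit[OF lt1]])
        (use entry in auto)
    show "norm (((**) A ^^ n) X) \<le> entry_norm (((**) A ^^ n) (mat 1)) * norm X"
      for n and X :: "real^'m^'r"
      by (subst matrix_power_mult) (rule norm_matrix_mult_le)
  qed (rule entry_norm_nonneg)
qed

lemma positive_eigenvalues_invertible:
  fixes A :: "real^'s^'s"
  assumes "positive_eigenvalues A"
  shows "invertible A"
proof -
  have "v = 0" if "A *v v = 0" for v
  proof (rule ccontr)
    assume "v \<noteq> 0"
    let ?w = "\<chi> i. complex_of_real (v $ i)"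
    have "?w \<noteq> 0" using \<open>v \<noteq> 0\<close> by (auto simp: vec_eq_iff)
    moreover have "complexify A *v ?w = (\<chi> i. complex_of_real ((A *v v) $ i))"
      by (simp add: complexify_def matrix_vector_mult_def vec_eq_iff)
    then have "complexify A *v ?w = 0 *s ?w" using that by (simp add: vec_eq_iff)
    ultimately have "0 \<in> spectrum A" unfolding spectrum_def by blast
    then show False using assms by (auto simp: positive_eigenvalues_def)
  qed
  then show ?thesis
    unfolding invertible_left_inverse matrix_left_invertible_ker by blast
qed

section \<open>The solution of an index-1 problem\<close>

definition lie_derivative ::
  "('a::real_normed_vector \<Rightarrow> 'a) \<Rightarrow> ('a \<Rightarrow> 'b::real_normed_vector) \<Rightarrow> 'a \<Rightarrow> 'b" where
  "lie_derivative F \<phi> w = frechet_derivative \<phi> (at w) (F w)"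

lemma smooth_on_lie_derivative:
  fixes F :: "'a::euclidean_space \<Rightarrow> 'a"
  assumes "open D" "smooth_on F D" "smooth_on \<phi> D"
  shows "smooth_on (lie_derivative F \<phi>) D"
  using assms C_k_on_frechet_derivative[of D _ \<phi> F]
  unfolding smooth_on_def lie_derivative_def[abs_def] by blast

lemma smooth_on_has_derivative:
  assumes "smooth_on \<phi> D" "w \<in> D"
  shows "(\<phi> has_derivative frechet_derivative \<phi> (at w)) (at w)"
  using assms C_k_on_Suc_has_derivative[of 0] unfolding smooth_on_def by blast

text \<open>Along an integral curve of a smooth field, differentiating in time is applying the Lie
  derivative to the observable; hence smooth observables of the curve have derivatives of all
  orders.\<close>

lemma nth_deriv_along_integral_curve:
  fixes F :: "'a::euclidean_space \<Rightarrow> 'a"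
  assumes D: "open D" "smooth_on F D" "smooth_on \<phi> D"
    and I: "open I" "\<And>t. t \<in> I \<Longrightarrow> y t \<in> D"
    and y: "\<And>t. t \<in> I \<Longrightarrow> (y has_vector_derivative F (y t)) (at t)"
    and "t \<in> I"
  shows "(nth_deriv k (\<lambda>t. \<phi> (y t)) has_vector_derivative nth_deriv (Suc k) (\<lambda>t. \<phi> (y t)) t) (at t)"
proof -
  let ?L = "\<lambda>k. (lie_derivative F ^^ k) \<phi>"
  have smooth: "smooth_on (?L k) D" for k
    by (induction k) (auto intro: smooth_on_lie_derivative D)
  have chain: "((\<lambda>t. ?L k (y t)) has_vector_derivative ?L (Suc k) (y t)) (at t)"
    if "t \<in> I" for k t
  proof -
    have "((\<lambda>t. ?L k (y t)) has_derivative
        (\<lambda>s. frechet_derivative (?L k) (at (y t)) (s *\<^sub>R F (y t)))) (at t)"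
      using y[OF that] smooth_on_has_derivative[OF smooth I(2)[OF that]]
      unfolding has_vector_derivative_def by (rule has_derivative_compose)
    moreover have "linear (frechet_derivative (?L k) (at (y t)))"
      using smooth_on_has_derivative[OF smooth I(2)[OF that]] by (rule has_derivative_linear)
    ultimately show ?thesis
      by (simp add: has_vector_derivative_def lie_derivative_def linear_scale)
  qed
  have eq: "nth_deriv k (\<lambda>t. \<phi> (y t)) t = ?L k (y t)"
    and der: "(nth_deriv k (\<lambda>t. \<phi> (y t)) has_vector_derivative ?L (Suc k) (y t)) (at t)"
    if "t \<in> I" for k t
  proof -
    have "\<forall>t\<in>I. nth_deriv k (\<lambda>t. \<phi> (y t)) t = ?L k (y t)" for k
    proof (induction k)
      case (Suc k)
      show ?case
      proof
        fix t assume t: "t \<in> I"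
        have "(nth_deriv k (\<lambda>t. \<phi> (y t)) has_vector_derivative ?L (Suc k) (y t)) (at t)"
          using chain[OF t, of k]
          by (rule has_vector_derivative_transform_within_open[OF _ I(1) t]) (use Suc in auto)
        then have "vector_derivative (nth_deriv k (\<lambda>t. \<phi> (y t))) (at t) = ?L (Suc k) (y t)"
          by (rule vector_derivative_at)
        then show "nth_deriv (Suc k) (\<lambda>t. \<phi> (y t)) t = ?L (Suc k) (y t)"
          by (simp add: nth_deriv_def)
      qed
    qed (simp add: nth_deriv_def)
    then show "nth_deriv k (\<lambda>t. \<phi> (y t)) t = ?L k (y t)"
      and "(nth_deriv k (\<lambda>t. \<phi> (y t)) has_vector_derivative ?L (Suc k) (y t)) (at t)"
      using has_vector_derivative_transform_within_open[OF chain[OF that] I(1) that] that by auto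
  qed
  show ?thesis using eq der \<open>t \<in> I\<close> by metis
qed

locale index_1_dae =
  fixes f g :: "(real^'m) \<times> (real^'m) \<Rightarrow> real^'m"
    and D :: "((real^'m) \<times> (real^'m)) set"
    and x z :: "real \<Rightarrow> real^'m" and a b :: real
  assumes solution: "dae_solution f g {a<..<b} x z"
    and open_D: "open D" and in_D: "\<And>t. t \<in> {a<..<b} \<Longrightarrow> (x t, z t) \<in> D"
    and smooth_f: "smooth_on f D" and smooth_g: "smooth_on g D"
    and index_1: "\<forall>(u, v)\<in>D. invertible (jacobian (\<lambda>v'. g (u, v')) (at v))"
begin

definition gz :: "(real^'m) \<times> (real^'m) \<Rightarrow> real^'m^'m" where
  "gz w = jacobian (\<lambda>v. g (fst w, v)) (at (snd w))"

lemma x_deriv: "t \<in> {a<..<b} \<Longrightarrow> (x has_vector_derivative f (x t, z t)) (at t)"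
  and g_zero: "t \<in> {a<..<b} \<Longrightarrow> g (x t, z t) = 0"
  and continuous_z: "continuous_on {a<..<b} z"
  using solution by (auto simp: dae_solution_def)

lemma g_has_partial_derivative:
  assumes "(u, v) \<in> D"
  shows "((\<lambda>v. g (u, v)) has_derivative (\<lambda>k. frechet_derivative g (at (u, v)) (0, k))) (at v)"
proof -
  have "((\<lambda>v. (u, v)) has_derivative (\<lambda>k. (0, k))) (at v)"
    by (auto intro!: derivative_eq_intros)
  then show ?thesis
    using smooth_on_has_derivative[OF smooth_g assms] by (rule has_derivative_compose)
qed

lemma gz_mult:
  assumes "w \<in> D"
  shows "frechet_derivative g (at w) (0, k) = gz w *v k"
proof -
  obtain u v where w: "w = (u, v)" by fastforce
  have "((\<lambda>v. g (u, v)) has_derivative (\<lambda>k. gz w *v k)) (at v)"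
    using g_has_partial_derivative assms w
    by (simp add: gz_def flip: jacobian_works) (blast intro: differentiableI)
  then show ?thesis
    using has_derivative_unique g_has_partial_derivative assms w by metis
qed

lemma gz_invertible: "w \<in> D \<Longrightarrow> invertible (gz w)"
  using index_1 by (auto simp: gz_def split: prod.splits)

lemma C_k_gz_entry: "C_k_on k (\<lambda>w. gz w $ i $ j) D"
proof (rule C_k_on_cong[OF open_D])
  show "\<forall>w\<in>D. frechet_derivative g (at w) (0, axis j 1) $ i = gz w $ i $ j"
    by (simp add: gz_mult matrix_vector_mult_basis column_def)
  have "C_k_on k (\<lambda>w. frechet_derivative g (at w) (0, axis j 1)) D"
    using smooth_g unfolding smooth_on_def by (metis C_k_on.simps(2))
  then show "C_k_on k (\<lambda>w. frechet_derivative g (at w) (0, axis j 1) $ i) D"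
    by (rule C_k_on_linear_compose[OF open_D bounded_linear_vec_nth])
qed

text \<open>The algebraic velocity is obtained by differentiating \<open>g (x, z) = 0\<close> along the flow.\<close>

definition zdot :: "(real^'m) \<times> (real^'m) \<Rightarrow> real^'m" where
  "zdot w = - (matrix_inv (gz w) *v frechet_derivative g (at w) (f w, 0))"

definition flow :: "(real^'m) \<times> (real^'m) \<Rightarrow> (real^'m) \<times> (real^'m)" where
  "flow w = (f w, zdot w)"

lemma smooth_flow: "smooth_on flow D"
  unfolding smooth_on_def
proof
  fix k
  have f: "C_k_on k f D" and g: "C_k_on (Suc k) g D"
    using smooth_f smooth_g unfolding smooth_on_def by blast+
  have lin: "bounded_linear (\<lambda>u::real^'m. (u, 0::real^'m))" "bounded_linear (\<lambda>u::real^'m. (0::real^'m, u))"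
    by (auto intro: bounded_linear_Pair bounded_linear_ident bounded_linear_zero)
  have "C_k_on k (\<lambda>w. matrix_inv (gz w) *v frechet_derivative g (at w) (f w, 0)) D"
    by (intro C_k_on_matrix_vector_mult C_k_on_matrix_inv C_k_gz_entry
        C_k_on_frechet_derivative[OF _ g] C_k_on_linear_compose[OF _ lin(1) f] open_D)
      (use gz_invertible in auto)
  then have "C_k_on k zdot D"
    unfolding zdot_def[abs_def]
    by (rule C_k_on_linear_compose[OF open_D bounded_linear_minus[OF bounded_linear_ident]])
  then have "C_k_on k (\<lambda>w. (f w, 0) + (0, zdot w)) D"
    by (intro C_k_on_add C_k_on_linear_compose[OF _ lin(1) f] C_k_on_linear_compose[OF _ lin(2)] open_D)
  then show "C_k_on k flow D" by (simp add: flow_def[abs_def])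
qed

lemma continuous_solution: "continuous_on {a<..<b} (\<lambda>t. (x t, z t))"
proof -
  have "continuous_on {a<..<b} x"
    using has_vector_derivative_continuous[OF x_deriv]
    by (intro continuous_at_imp_continuous_on) blast
  then show ?thesis using continuous_z by (intro continuous_on_Pair)
qed

text \<open>A quantitative implicit function theorem, uniform over a compact part of the solution. The
  simplified Newton map \<open>v \<mapsto> v - g\<^sub>z(x, z)\<^sup>-\<^sup>1 g(u, v)\<close>, with the matrix frozen on the solution, is a
  contraction with factor \<open>1/2\<close> near the solution; its fixed points are the zeros of \<open>g(u, \<cdot>)\<close>, and
  its displacement of \<open>z\<close> is bounded by the distance of \<open>u\<close> from \<open>x\<close>.\<close>

lemma local_branch:
  assumes "compact K" "K \<subseteq> {a<..<b}"
  obtains \<delta> \<rho> L where "\<delta> > 0" "\<rho> > 0" "L \<ge> 0"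
    "\<And>t u. t \<in> K \<Longrightarrow> norm (u - x t) \<le> \<rho> \<Longrightarrow> \<exists>v. norm (v - z t) < \<delta> \<and> g (u, v) = 0"
    "\<And>t u v. t \<in> K \<Longrightarrow> norm (u - x t) \<le> \<rho> \<Longrightarrow> norm (v - z t) < \<delta> \<Longrightarrow> g (u, v) = 0 \<Longrightarrow>
      norm (v - z t) \<le> L * norm (u - x t)"
    "\<And>t u v. t \<in> K \<Longrightarrow> norm (u - x t) \<le> \<rho> \<Longrightarrow> norm (v - z t) < \<delta> \<Longrightarrow>
      norm (f (u, v) - f (x t, z t)) \<le> L * (norm (u - x t) + norm (v - z t))"
proof -
  let ?y = "\<lambda>t. (x t, z t)"
  let ?H = "\<lambda>t. matrix_inv (gz (?y t))"
  have Y: "compact (?y ` K)" "?y ` K \<subseteq> D"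
    using assms in_D continuous_on_subset[OF continuous_solution]
    by (auto intro!: compact_continuous_image)
  have C1: "C_k_on (Suc 0) g D" "C_k_on (Suc 0) f D" "C_k_on (Suc 0) gz D"
    using smooth_g smooth_f unfolding smooth_on_def
    by (blast, blast, intro C_k_on_vec open_D C_k_gz_entry)
  obtain \<delta>g Lg where g: "\<delta>g > 0" "Lg \<ge> 0" "\<And>y. y \<in> ?y ` K \<Longrightarrow> cball y \<delta>g \<subseteq> D"
    "\<And>y w w'. y \<in> ?y ` K \<Longrightarrow> w \<in> cball y \<delta>g \<Longrightarrow> w' \<in> cball y \<delta>g \<Longrightarrow>
      norm (g w - g w') \<le> Lg * norm (w - w')"
    by (rule uniform_lipschitz_near_compact[OF open_D C1(1) Y]) (rule that; blast)
  obtain \<delta>f Lf where f: "\<delta>f > 0" "Lf \<ge> 0" "\<And>y. y \<in> ?y ` K \<Longrightarrow> cball y \<delta>f \<subseteq> D"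
    "\<And>y w w'. y \<in> ?y ` K \<Longrightarrow> w \<in> cball y \<delta>f \<Longrightarrow> w' \<in> cball y \<delta>f \<Longrightarrow>
      norm (f w - f w') \<le> Lf * norm (w - w')"
    by (rule uniform_lipschitz_near_compact[OF open_D C1(2) Y]) (rule that; blast)
  obtain \<delta>z Lz where gz: "\<delta>z > 0" "Lz \<ge> 0" "\<And>y. y \<in> ?y ` K \<Longrightarrow> cball y \<delta>z \<subseteq> D"
    "\<And>y w w'. y \<in> ?y ` K \<Longrightarrow> w \<in> cball y \<delta>z \<Longrightarrow> w' \<in> cball y \<delta>z \<Longrightarrow>
      norm (gz w - gz w') \<le> Lz * norm (w - w')"
    by (rule uniform_lipschitz_near_compact[OF open_D C1(3) Y]) (rule that; blast)
  have "continuous_on D (\<lambda>w. entry_norm (matrix_inv (gz w)))"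
    unfolding entry_norm_def
    by (intro continuous_on_sum continuous_on_rabs C_k_on_imp_continuous_on[of 0]
        C_k_on_matrix_inv open_D C_k_gz_entry) (use gz_invertible in auto)
  then have "bounded ((\<lambda>w. entry_norm (matrix_inv (gz w))) ` ?y ` K)"
    by (rule compact_imp_bounded[OF compact_continuous_image[OF continuous_on_subset[OF _ Y(2)] Y(1)]])
  then obtain H where "\<forall>r\<in>(\<lambda>w. entry_norm (matrix_inv (gz w))) ` ?y ` K. norm r \<le> H"
    unfolding bounded_iff by blast
  then have H': "entry_norm (?H t) \<le> H" if "t \<in> K" for t
    using that by (auto dest: abs_le_D1)
  define H1 where "H1 = max H 1"
  have H: "norm (?H t *v r) \<le> H1 * norm r" if "t \<in> K" for t r
    using norm_matrix_vector_le[of "?H t" r] mult_right_mono[OF H'[OF that], of "norm r"]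
      mult_right_mono[of H H1 "norm r"]
    unfolding H1_def by fastforce
  have H1: "H1 \<ge> 1" by (simp add: H1_def)
  define c where "c = real (CARD('m)) * real (CARD('m))"
  have c: "c > 0" by (simp add: c_def)
  \<comment> \<open>the last entry makes the simplified Newton map contract by \<open>1/2\<close>\<close>
  define d where "d = Min {\<delta>g, \<delta>f, \<delta>z, 1 / (2 * (H1 * c * (Lz + 1)))} / 2"
  have d: "d > 0" "2 * d \<le> \<delta>g" "2 * d \<le> \<delta>f" "2 * d \<le> \<delta>z" "2 * d \<le> 1 / (2 * (H1 * c * (Lz + 1)))"
    using g f gz H1 c unfolding d_def by (auto simp: Min_gr_iff)
  have near: "dist (?y t) (u, v) \<le> norm (u - x t) + norm (v - z t)" for t u v
    using norm_Pair_le[of "x t - u" "z t - v"]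
    unfolding norm_minus_commute[of u] norm_minus_commute[of v] by (simp add: dist_norm)
  define \<rho> where "\<rho> = min d (d / (4 * (H1 * (Lg + 1))))"
  have \<rho>: "\<rho> > 0" "\<rho> \<le> d" "H1 * (Lg * \<rho>) \<le> d / 4"
  proof -
    show "\<rho> > 0" "\<rho> \<le> d" using d H1 g unfolding \<rho>_def by auto
    have "H1 * (Lg * \<rho>) \<le> H1 * ((Lg + 1) * (d / (4 * (H1 * (Lg + 1)))))"
      using H1 g d \<open>\<rho> > 0\<close> unfolding \<rho>_def by (intro mult_left_mono mult_mono) auto
    also have "\<dots> = H1 * (Lg + 1) * (d / (4 * (H1 * (Lg + 1))))" by (simp only: mult.assoc)
    also have "\<dots> = d / 4"
    proof -
      have "k * (d / (4 * k)) = d / 4" if "k > 0" for k :: real using that by simp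
      then show ?thesis using H1 g(2) by simp
    qed
    finally show "H1 * (Lg * \<rho>) \<le> d / 4" .
  qed
  have newton: "norm ((v - ?H t *v g (u, v)) - (v' - ?H t *v g (u, v'))) \<le> 1/2 * norm (v - v')"
    if t: "t \<in> K" and u: "norm (u - x t) \<le> d" and v: "v \<in> cball (z t) d" "v' \<in> cball (z t) d"
    for t u v v'
  proof (rule differentiable_bound[OF convex_cball _ _ v,
        where f' = "\<lambda>v k. k - ?H t *v frechet_derivative g (at (u, v)) (0, k)"])
    fix v assume v: "v \<in> cball (z t) d"
    then have "norm (v - z t) \<le> d" by (simp add: dist_norm norm_minus_commute)
    then have dist: "dist (?y t) (u, v) \<le> 2 * d" using near[of t u v] u by linarith
    then have uv: "(u, v) \<in> D" using g(3)[of "?y t"] t d by auto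
    show "((\<lambda>v. v - ?H t *v g (u, v)) has_derivative
        (\<lambda>k. k - ?H t *v frechet_derivative g (at (u, v)) (0, k))) (at v within cball (z t) d)"
      by (rule has_derivative_at_withinI[OF has_derivative_diff[OF has_derivative_ident
            bounded_linear.has_derivative[OF matrix_vector_mul_bounded_linear
              g_has_partial_derivative[OF uv]]]])
    show "onorm (\<lambda>k. k - ?H t *v frechet_derivative g (at (u, v)) (0, k)) \<le> 1/2"
    proof (rule onorm_bound)
      fix k
      have "norm (gz (?y t) - gz (u, v)) \<le> Lz * (2 * d)"
        using gz(4)[of "?y t" "?y t" "(u, v)"] t dist d(4) gz(2) \<open>\<delta>z > 0\<close>
        by (smt (verit) dist_norm imageI mem_cball mult_left_mono dist_self)
      then have "entry_norm (gz (?y t) - gz (u, v)) \<le> c * (Lz * (2 * d))"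
        using entry_norm_le[of "gz (?y t) - gz (u, v)"] c unfolding c_def
        by (meson mult_left_mono order_trans less_imp_le)
      then have bound: "norm ((gz (?y t) - gz (u, v)) *v k) \<le> c * (Lz * (2 * d)) * norm k"
        by (meson norm_matrix_vector_le mult_right_mono order_trans norm_ge_zero)
      have "k = ?H t *v (gz (?y t) *v k)"
        using matrix_inv_mult[OF gz_invertible, of "?y t"] Y t
        by (simp add: matrix_vector_mul_assoc image_subset_iff)
      then have "k - ?H t *v frechet_derivative g (at (u, v)) (0, k)
          = ?H t *v ((gz (?y t) - gz (u, v)) *v k)"
        by (simp add: gz_mult[OF uv] matrix_vector_mult_diff_rdistrib matrix_vector_mult_diff_distrib)
      also have "norm \<dots> \<le> H1 * (c * (Lz * (2 * d)) * norm k)"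
        using H[OF t] bound H1 by (smt (verit) mult_left_mono)
      also have "\<dots> = (H1 * c * Lz * (2 * d)) * norm k" by simp
      also have "\<dots> \<le> 1/2 * norm k"
      proof (rule mult_right_mono)
        have "H1 * c * Lz * (2 * d) \<le> H1 * c * (Lz + 1) * (1 / (2 * (H1 * c * (Lz + 1))))"
          using d H1 c gz(2) by (intro mult_mono) auto
        also have "\<dots> = 1/2"
        proof -
          have "k * (1 / (2 * k)) = 1/2" if "k > 0" for k :: real using that by simp
          then show ?thesis using H1 c gz(2) by simp
        qed
        finally show "H1 * c * Lz * (2 * d) \<le> 1/2" .
      qed simp
      finally show "norm (k - ?H t *v frechet_derivative g (at (u, v)) (0, k)) \<le> 1/2 * norm k" .
    qed simp
  qed
  have displacement: "norm (?H t *v g (u, z t)) \<le> H1 * (Lg * norm (u - x t))"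
    if t: "t \<in> K" and u: "norm (u - x t) \<le> d" for t u
  proof -
    have "norm (g (u, z t) - g (?y t)) \<le> Lg * norm ((u, z t) - ?y t)"
      using near[of t u "z t"] u d t g(1) by (intro g(4)[of "?y t"]) auto
    also have "norm ((u, z t) - ?y t) = norm (u - x t)" by (simp add: norm_Pair)
    finally have "norm (g (u, z t)) \<le> Lg * norm (u - x t)"
      using g_zero[of t] assms(2) t by (simp add: subset_iff)
    then show ?thesis using H[OF t, of "g (u, z t)"] H1 by (smt (verit) mult_left_mono)
  qed
  define L where "L = max (2 * H1 * Lg) Lf"
  show thesis
  proof (rule that[of d \<rho> L])
    show "d > 0" "\<rho> > 0" using d \<rho> by auto
    show "L \<ge> 0" using f by (auto simp: L_def)
    fix t u assume t: "t \<in> K" and u: "norm (u - x t) \<le> \<rho>"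
    have u': "norm (u - x t) \<le> d" using u \<rho> by simp
    show "\<exists>v. norm (v - z t) < d \<and> g (u, v) = 0"
    proof -
      let ?N = "\<lambda>v. v - ?H t *v g (u, v)"
      have sub: "v \<in> cball (z t) (d/2) \<Longrightarrow> v \<in> cball (z t) d" for v using d by auto
      have "\<exists>!v\<in>cball (z t) (d/2). ?N v = v"
      proof (rule Banach_fix[where c = "1/2"])
        show "?N ` cball (z t) (d/2) \<subseteq> cball (z t) (d/2)"
        proof (rule image_subsetI)
          fix v assume v: "v \<in> cball (z t) (d/2)"
          have "norm (A - q) \<le> norm (A - (q - r)) + norm r" for A q r :: "real^'m"
            using norm_triangle_ineq4[of "A - (q - r)" r] by (simp add: algebra_simps)
          then have "norm (?N v - z t) \<le> norm (?N v - ?N (z t)) + norm (?H t *v g (u, z t))"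
            by blast
          also have "\<dots> \<le> 1/2 * norm (v - z t) + H1 * (Lg * \<rho>)"
          proof (rule add_mono)
            show "norm (?N v - ?N (z t)) \<le> 1/2 * norm (v - z t)"
              by (rule newton[OF t u' sub[OF v]]) (use d in simp)
            have "H1 * (Lg * norm (u - x t)) \<le> H1 * (Lg * \<rho>)"
              using u H1 g(2) by (intro mult_left_mono) auto
            then show "norm (?H t *v g (u, z t)) \<le> H1 * (Lg * \<rho>)"
              using displacement[OF t u'] by linarith
          qed
          also have "\<dots> \<le> d/2"
            using v \<rho>(3) by (simp add: dist_norm norm_minus_commute)
          finally show "?N v \<in> cball (z t) (d/2)" by (simp add: dist_norm norm_minus_commute)
        qed
        show "dist (?N v) (?N v') \<le> 1/2 * dist v v'"
          if "v \<in> cball (z t) (d/2)" "v' \<in> cball (z t) (d/2)" for v v'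
          using newton[OF t u' sub[OF that(1)] sub[OF that(2)]] by (simp only: dist_norm)
      qed (use d in \<open>auto intro: compact_imp_complete\<close>)
      then obtain v where v: "v \<in> cball (z t) (d/2)" "?H t *v g (u, v) = 0" by auto
      have "g (u, v) = gz (?y t) *v (?H t *v g (u, v))"
        using matrix_mult_inv[OF gz_invertible, of "?y t"] Y t
        by (simp add: matrix_vector_mul_assoc image_subset_iff)
      then have "g (u, v) = 0" using v by simp
      moreover have "norm (v - z t) < d" using v d by (simp add: dist_norm norm_minus_commute)
      ultimately show ?thesis by blast
    qed
    fix v assume v: "norm (v - z t) < d"
    then have v': "v \<in> cball (z t) d" by (simp add: dist_norm norm_minus_commute)
    show "norm (v - z t) \<le> L * norm (u - x t)" if "g (u, v) = 0"
    proof -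
      have "norm (v - z t) \<le> norm (v - z t + ?H t *v g (u, z t)) + norm (?H t *v g (u, z t))"
        using norm_triangle_ineq4[of "v - z t + ?H t *v g (u, z t)" "?H t *v g (u, z t)"] by simp
      also have "\<dots> \<le> 1/2 * norm (v - z t) + H1 * (Lg * norm (u - x t))"
      proof (rule add_mono[OF _ displacement[OF t u']])
        have "z t \<in> cball (z t) d" using d by simp
        moreover have "?H t *v g (u, v) = 0" using that by simp
        ultimately show "norm (v - z t + ?H t *v g (u, z t)) \<le> 1/2 * norm (v - z t)"
          using newton[OF t u' v', of "z t"] by (simp add: algebra_simps)
      qed
      finally have "norm (v - z t) \<le> 2 * H1 * Lg * norm (u - x t)" by simp
      also have "\<dots> \<le> L * norm (u - x t)" by (intro mult_right_mono) (auto simp: L_def)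
      finally show ?thesis .
    qed
    have "norm (f (u, v) - f (?y t)) \<le> Lf * norm ((u, v) - ?y t)"
      using near[of t u v] u' v d t f(1) by (intro f(4)[of "?y t"]) auto
    also have "\<dots> \<le> L * (norm (u - x t) + norm (v - z t))"
      using norm_Pair_le[of "u - x t" "v - z t"] f(2)
      by (intro mult_mono) (auto simp: L_def)
    finally show "norm (f (u, v) - f (?y t)) \<le> L * (norm (u - x t) + norm (v - z t))" .
  qed
qed

text \<open>The algebraic component is differentiable although only its continuity is assumed: near \<open>t\<close> it
  is the local branch over \<open>x\<close>, hence Lipschitz in time, so the remainder of the linearisation of
  \<open>g (x, z) = 0\<close> is \<open>o(s - t)\<close> and the linearisation can be solved for the increment of \<open>z\<close>.\<close>

lemma z_deriv:
  assumes t: "t \<in> {a<..<b}"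
  shows "(z has_vector_derivative zdot (x t, z t)) (at t)"
proof -
  let ?y = "\<lambda>t. (x t, z t)"
  let ?G = "frechet_derivative g (at (?y t))" and ?H = "matrix_inv (gz (?y t))"
  define e where "e s = g (?y s) - g (?y t) - ?G (?y s - ?y t)" for s
  note G = smooth_on_has_derivative[OF smooth_g in_D[OF t]]
  interpret G: bounded_linear ?G using G by (rule has_derivative_bounded_linear)
  obtain \<delta> \<rho> L where branch: "\<delta> > 0" "\<rho> > 0" "L \<ge> 0"
    "\<And>u v. norm (u - x t) \<le> \<rho> \<Longrightarrow> norm (v - z t) < \<delta> \<Longrightarrow> g (u, v) = 0 \<Longrightarrow>
      norm (v - z t) \<le> L * norm (u - x t)"
    using local_branch[of "{t}"] t by (metis compact_sing empty_subsetI insert_subset singletonI)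
  obtain d0 where d0: "d0 > 0" "{t - d0<..<t + d0} \<subseteq> {a<..<b}"
  proof (rule that[of "min (t - a) (b - t)"])
  qed (use t in auto)
  have xc: "isCont x t" using x_deriv[OF t] has_vector_derivative_continuous by blast
  have zc: "isCont z t" using continuous_z t by (simp add: continuous_on_eq_continuous_at)
  define C where "C = (1 + L) * (norm (f (?y t)) + 1)"
  have C: "C > 0" using branch(3) by (simp add: C_def add_nonneg_pos)
  have lip: "\<exists>d>0. \<forall>s. \<bar>s - t\<bar> < d \<longrightarrow> s \<in> {a<..<b} \<and> norm (?y s - ?y t) \<le> C * \<bar>s - t\<bar>"
  proof -
    obtain d1 where d1: "d1 > 0" "\<And>s. \<bar>s - t\<bar> < d1 \<Longrightarrow>
        norm (x s - x t - (s - t) *\<^sub>R f (?y t)) \<le> 1 * norm (s - t)"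
      using x_deriv[OF t] unfolding has_vector_derivative_def has_derivative_at_alt
      by (metis real_norm_def zero_less_one)
    obtain d2 where d2: "d2 > 0" "\<And>s. \<bar>s - t\<bar> < d2 \<Longrightarrow> norm (x s - x t) < \<rho>"
      using xc branch(2) unfolding continuous_at_eps_delta by (metis dist_norm real_norm_def)
    obtain d3 where d3: "d3 > 0" "\<And>s. \<bar>s - t\<bar> < d3 \<Longrightarrow> norm (z s - z t) < \<delta>"
      using zc branch(1) unfolding continuous_at_eps_delta by (metis dist_norm real_norm_def)
    show ?thesis
    proof (intro exI[of _ "min (min d0 d1) (min d2 d3)"] conjI allI impI)
      fix s assume s: "\<bar>s - t\<bar> < min (min d0 d1) (min d2 d3)"
      then have "s \<in> {t - d0<..<t + d0}" by (auto simp: abs_less_iff)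
      then show I: "s \<in> {a<..<b}" using d0(2) by blast
      have "norm (x s - x t) \<le> norm (x s - x t - (s - t) *\<^sub>R f (?y t)) + norm ((s - t) *\<^sub>R f (?y t))"
        using norm_triangle_ineq[of "x s - x t - (s - t) *\<^sub>R f (?y t)" "(s - t) *\<^sub>R f (?y t)"] by simp
      also have "\<dots> \<le> \<bar>s - t\<bar> + \<bar>s - t\<bar> * norm (f (?y t))"
        using d1(2)[of s] s by simp
      also have "\<dots> = (norm (f (?y t)) + 1) * \<bar>s - t\<bar>" by (simp add: algebra_simps)
      finally have xs: "norm (x s - x t) \<le> (norm (f (?y t)) + 1) * \<bar>s - t\<bar>" .
      have "norm (z s - z t) \<le> L * norm (x s - x t)"
        using branch(4)[of "x s" "z s"] d2(2)[of s] d3(2)[of s] s g_zero[OF I] by simp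
      then have "norm (?y s - ?y t) \<le> (1 + L) * norm (x s - x t)"
        using norm_Pair_le[of "x s - x t" "z s - z t"] by (simp add: algebra_simps)
      also have "\<dots> \<le> (1 + L) * ((norm (f (?y t)) + 1) * \<bar>s - t\<bar>)"
        using xs branch(3) by (intro mult_left_mono) auto
      finally show "norm (?y s - ?y t) \<le> C * \<bar>s - t\<bar>" by (simp add: C_def)
    qed (use d0 d1 d2 d3 in auto)
  qed
  have e_deriv: "(e has_derivative (\<lambda>_. 0)) (at t)"
    unfolding has_derivative_at_alt
  proof (intro conjI allI impI)
    fix \<epsilon> :: real assume "\<epsilon> > 0"
    then have "\<epsilon> / C > 0" using C by simp
    then obtain d1 where d1: "d1 > 0" "\<And>w. norm (w - ?y t) < d1 \<Longrightarrow>
        norm (g w - g (?y t) - ?G (w - ?y t)) \<le> \<epsilon> / C * norm (w - ?y t)"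
      using G unfolding has_derivative_at_alt by blast
    obtain d2 where d2: "d2 > 0" "\<And>s. \<bar>s - t\<bar> < d2 \<Longrightarrow> norm (?y s - ?y t) \<le> C * \<bar>s - t\<bar>"
      using lip by blast
    show "\<exists>d>0. \<forall>s. norm (s - t) < d \<longrightarrow> norm (e s - e t - 0) \<le> \<epsilon> * norm (s - t)"
    proof (intro exI[of _ "min d2 (d1 / C)"] conjI allI impI)
      fix s assume s: "norm (s - t) < min d2 (d1 / C)"
      then have ys: "norm (?y s - ?y t) \<le> C * \<bar>s - t\<bar>" and "C * \<bar>s - t\<bar> < d1"
        using d2(2)[of s] C by (auto simp: field_simps)
      then have "norm (?y s - ?y t) < d1" by linarith
      then have "norm (e s) \<le> \<epsilon> / C * norm (?y s - ?y t)"
        unfolding e_def by (rule d1(2))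
      also have "\<dots> \<le> \<epsilon> / C * (C * \<bar>s - t\<bar>)"
        using ys \<open>\<epsilon> / C > 0\<close> by (intro mult_left_mono) auto
      finally show "norm (e s - e t - 0) \<le> \<epsilon> * norm (s - t)"
        using C by (simp add: e_def G.zero)
    qed (use d1 d2 C in auto)
  qed simp
  have increment: "z t - ?H *v ?G (x s - x t, 0) - ?H *v e s = z s" if s: "s \<in> {a<..<b}" for s
  proof -
    have "?G (?y s - ?y t) = ?G (x s - x t, 0) + gz (?y t) *v (z s - z t)"
      using G.add[of "(x s - x t, 0)" "(0, z s - z t)"] gz_mult[OF in_D[OF t]] by simp
    then have "?G (x s - x t, 0) + gz (?y t) *v (z s - z t) + e s = 0"
      by (simp add: e_def g_zero[OF s] g_zero[OF t])
    then have "?H *v ?G (x s - x t, 0) + ?H *v (gz (?y t) *v (z s - z t)) + ?H *v e s = 0"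
      by (metis matrix_vector_right_distrib matrix_vector_mult_0_right)
    moreover have "?H *v (gz (?y t) *v (z s - z t)) = z s - z t"
      using matrix_inv_mult[OF gz_invertible[OF in_D[OF t]]] by (simp add: matrix_vector_mul_assoc)
    moreover have "A + (q - p) + C = 0 \<Longrightarrow> p - A - C = q" for A C p q :: "real^'m"
      by (simp add: algebra_simps)
    ultimately show ?thesis by metis
  qed
  have "((\<lambda>s. z t - ?H *v ?G (x s - x t, 0) - ?H *v e s) has_vector_derivative
      zdot (?y t)) (at t)"
  proof -
    have "((\<lambda>s. (x s - x t, 0)) has_derivative (\<lambda>k. (k *\<^sub>R f (?y t), 0))) (at t)"
      using x_deriv[OF t] unfolding has_vector_derivative_def
      by (auto intro!: derivative_eq_intros)
    note d1 = bounded_linear.has_derivative[OF matrix_vector_mul_bounded_linear[of ?H]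
        G.has_derivative[OF this]]
    note d2 = bounded_linear.has_derivative[OF matrix_vector_mul_bounded_linear[of ?H] e_deriv]
    have "((\<lambda>s. z t - ?H *v ?G (x s - x t, 0) - ?H *v e s) has_derivative
        (\<lambda>k. 0 - ?H *v ?G (k *\<^sub>R f (?y t), 0) - ?H *v 0)) (at t)"
      by (intro has_derivative_diff has_derivative_const d1 d2)
    moreover have "0 - ?H *v ?G (k *\<^sub>R f (?y t), 0) - ?H *v 0 = k *\<^sub>R zdot (?y t)" for k
      using G.scale[of k "(f (?y t), 0)"]
      by (simp add: zdot_def matrix_vector_mult_scaleR)
    ultimately show ?thesis by (simp add: has_vector_derivative_def)
  qed
  then show ?thesis
    by (rule has_vector_derivative_transform_within_open[OF _ open_greaterThanLessThan t])
      (use increment in auto)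
qed

lemma solution_derivs:
  assumes t: "t \<in> {a<..<b}"
  shows "(nth_deriv k x has_vector_derivative nth_deriv (Suc k) x t) (at t)"
    and "(nth_deriv k z has_vector_derivative nth_deriv (Suc k) z t) (at t)"
proof -
  let ?y = "\<lambda>t. (x t, z t)"
  have y: "(?y has_vector_derivative flow (?y t)) (at t)" if "t \<in> {a<..<b}" for t
    using x_deriv[OF that] z_deriv[OF that]
    unfolding has_vector_derivative_def flow_def
    by (auto intro!: derivative_eq_intros)
  have "smooth_on T D" if T: "bounded_linear T" for T :: "(real^'m) \<times> (real^'m) \<Rightarrow> real^'m"
    unfolding smooth_on_def
  proof
    have "(T has_derivative T) (at w)" for w by (rule bounded_linear_imp_has_derivative[OF T])
    then show "C_k_on k T D" for k
    proof (cases k)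
      case 0
      then show ?thesis using T by (simp add: linear_continuous_on)
    next
      case (Suc k)
      show ?thesis unfolding Suc
        by (rule C_k_onI_Suc[OF open_D bounded_linear_imp_has_derivative[OF T]
              C_k_on_const[OF open_D]])
    qed
  qed
  note deriv = nth_deriv_along_integral_curve[OF open_D smooth_flow this open_greaterThanLessThan
      in_D y t]
  show "(nth_deriv k x has_vector_derivative nth_deriv (Suc k) x t) (at t)"
    using deriv[OF bounded_linear_fst] by simp
  show "(nth_deriv k z has_vector_derivative nth_deriv (Suc k) z t) (at t)"
    using deriv[OF bounded_linear_snd] by simp
qed

lemma nth_deriv_1_x: "t \<in> {a<..<b} \<Longrightarrow> nth_deriv 1 x t = f (x t, z t)"
  using x_deriv by (simp add: nth_deriv_def vector_derivative_at)

end

section \<open>Expansions in the step size\<close>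

definition uniform_O :: "real \<Rightarrow> real \<Rightarrow> nat \<Rightarrow> (real \<Rightarrow> real \<Rightarrow> 'v::real_normed_vector) \<Rightarrow> bool" where
  "uniform_O t0 tF m \<Phi> \<longleftrightarrow>
     (\<exists>C. eventually (\<lambda>h. \<forall>t\<in>{t0..tF}. norm (\<Phi> t h) \<le> C * h ^ m) (at_right 0))"

lemma uniform_O_zero: "uniform_O t0 tF m (\<lambda>t h. 0)"
  unfolding uniform_O_def by (auto intro!: exI[of _ 0])

lemma uniform_O_add:
  assumes "uniform_O t0 tF m \<Phi>" "uniform_O t0 tF m \<Psi>"
  shows "uniform_O t0 tF m (\<lambda>t h. \<Phi> t h + \<Psi> t h)"
proof -
  obtain C C' where
    "eventually (\<lambda>h. \<forall>t\<in>{t0..tF}. norm (\<Phi> t h) \<le> C * h ^ m) (at_right 0)"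
    "eventually (\<lambda>h. \<forall>t\<in>{t0..tF}. norm (\<Psi> t h) \<le> C' * h ^ m) (at_right 0)"
    using assms unfolding uniform_O_def by blast
  then have "eventually (\<lambda>h. \<forall>t\<in>{t0..tF}. norm (\<Phi> t h + \<Psi> t h) \<le> (C + C') * h ^ m) (at_right 0)"
  proof eventually_elim
    case (elim h)
    then show ?case by (auto simp: distrib_right intro!: norm_triangle_le add_mono)
  qed
  then show ?thesis unfolding uniform_O_def by blast
qed

lemma uniform_O_linear:
  assumes "\<And>v. norm (T v) \<le> B * norm v" "0 \<le> B" "uniform_O t0 tF m \<Phi>"
  shows "uniform_O t0 tF m (\<lambda>t h. T (\<Phi> t h))"
proof -
  obtain C where
    "eventually (\<lambda>h. \<forall>t\<in>{t0..tF}. norm (\<Phi> t h) \<le> C * h ^ m) (at_right 0)"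
    using assms(3) unfolding uniform_O_def by blast
  then have "eventually (\<lambda>h. \<forall>t\<in>{t0..tF}. norm (T (\<Phi> t h)) \<le> (B * C) * h ^ m) (at_right 0)"
  proof eventually_elim
    case (elim h)
    then show ?case using assms(1,2) by (metis mult.assoc mult_left_mono order_trans)
  qed
  then show ?thesis unfolding uniform_O_def by blast
qed

lemma uniform_O_scaleR: "uniform_O t0 tF m \<Phi> \<Longrightarrow> uniform_O t0 tF m (\<lambda>t h. r *\<^sub>R \<Phi> t h)"
  by (rule uniform_O_linear[of "\<lambda>v. r *\<^sub>R v" "\<bar>r\<bar>"]) simp_all

lemma uniform_O_diff:
  assumes "uniform_O t0 tF m \<Phi>" "uniform_O t0 tF m \<Psi>"
  shows "uniform_O t0 tF m (\<lambda>t h. \<Phi> t h - \<Psi> t h)"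
  using uniform_O_add[OF assms(1) uniform_O_scaleR[OF assms(2), of "- 1"]] by simp

lemma uniform_O_sum:
  assumes "\<And>i. i \<in> I \<Longrightarrow> uniform_O t0 tF m (\<Phi> i)"
  shows "uniform_O t0 tF m (\<lambda>t h. \<Sum>i\<in>I. \<Phi> i t h)"
  using assms
  by (induction I rule: infinite_finite_induct) (auto intro: uniform_O_zero uniform_O_add)

lemma uniform_O_vec:
  fixes \<Phi> :: "real \<Rightarrow> real \<Rightarrow> 'v::euclidean_space^'n"
  assumes "\<And>i. uniform_O t0 tF m (\<lambda>t h. \<Phi> t h $ i)"
  shows "uniform_O t0 tF m \<Phi>"
proof -
  have "norm (axis i v :: 'v^'n) \<le> 1 * norm v" for i :: 'n and v
    using norm_vec_le_sum[of "axis i v :: 'v^'n"] by (simp add: axis_def if_distrib cong: if_cong)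
  then have "uniform_O t0 tF m (\<lambda>t h. axis i (\<Phi> t h $ i) :: 'v^'n)" for i
    by (rule uniform_O_linear[OF _ _ assms]) simp
  then have "uniform_O t0 tF m (\<lambda>t h. \<Sum>i\<in>UNIV. axis i (\<Phi> t h $ i) :: 'v^'n)"
    by (rule uniform_O_sum)
  moreover have "(\<Sum>i\<in>UNIV. axis i (\<Phi> t h $ i)) = \<Phi> t h" for t h
    by (simp add: vec_eq_iff axis_def)
  ultimately show ?thesis by simp
qed

text \<open>\<open>expands t0 tF y m \<phi> a\<close>: the Taylor polynomial of \<open>\<phi> t h\<close> in \<open>h\<close> is the sum of
  \<open>a k h\<^sup>k y\<^sup>(\<^sup>k\<^sup>) t\<close> over \<open>k < m\<close>, with a remainder \<open>O(h\<^sup>m)\<close> uniform in \<open>t\<close>. Order conditions say that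
  these coefficients vanish.\<close>

definition expands ::
  "real \<Rightarrow> real \<Rightarrow> (real \<Rightarrow> 'v::real_normed_vector) \<Rightarrow> nat \<Rightarrow> (real \<Rightarrow> real \<Rightarrow> 'v) \<Rightarrow> (nat \<Rightarrow> real) \<Rightarrow> bool"
  where
  "expands t0 tF y m \<phi> a \<longleftrightarrow>
     uniform_O t0 tF m (\<lambda>t h. \<phi> t h - (\<Sum>k<m. (a k * h ^ k) *\<^sub>R nth_deriv k y t))"

lemma expands_add:
  assumes "expands t0 tF y m \<phi> a" "expands t0 tF y m \<psi> b"
  shows "expands t0 tF y m (\<lambda>t h. \<phi> t h + \<psi> t h) (\<lambda>k. a k + b k)"
  using uniform_O_add[OF assms[unfolded expands_def]] unfolding expands_def
  by (simp add: distrib_right scaleR_left_distrib sum.distrib add_diff_add)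

lemma expands_scaleR:
  assumes "expands t0 tF y m \<phi> a"
  shows "expands t0 tF y m (\<lambda>t h. r *\<^sub>R \<phi> t h) (\<lambda>k. r * a k)"
  using uniform_O_scaleR[OF assms[unfolded expands_def], of r] unfolding expands_def
  by (simp add: scaleR_right_diff_distrib scaleR_sum_right mult.assoc)

lemma expands_diff:
  assumes "expands t0 tF y m \<phi> a" "expands t0 tF y m \<psi> b"
  shows "expands t0 tF y m (\<lambda>t h. \<phi> t h - \<psi> t h) (\<lambda>k. a k - b k)"
  using expands_add[OF assms(1) expands_scaleR[OF assms(2), of "- 1"]] by simp

lemma expands_sum:
  assumes "finite I" "\<And>i. i \<in> I \<Longrightarrow> expands t0 tF y m (\<phi> i) (a i)"
  shows "expands t0 tF y m (\<lambda>t h. \<Sum>i\<in>I. \<phi> i t h) (\<lambda>k. \<Sum>i\<in>I. a i k)"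
  using assms
proof (induction I rule: finite_induct)
  case empty
  then show ?case by (simp add: expands_def uniform_O_zero)
next
  case (insert i I)
  then show ?case using expands_add[of t0 tF y m "\<phi> i" "a i"] by simp
qed

lemma expands_zero_imp_uniform_O:
  assumes "expands t0 tF y m \<phi> a" "\<And>k. k < m \<Longrightarrow> a k = 0"
  shows "uniform_O t0 tF m \<phi>"
  using assms by (simp add: expands_def)

text \<open>The expansion points may lie on either side of each other, because abscissae may be negative. For
  \<open>n = 0\<close> the estimate is a bound for \<open>Y 0\<close>.\<close>

lemma vector_taylor_bound:
  fixes Y :: "nat \<Rightarrow> real \<Rightarrow> 'v::euclidean_space"
  assumes S: "convex S" "compact S"
    and der: "\<And>k t. t \<in> S \<Longrightarrow> (Y k has_vector_derivative Y (Suc k) t) (at t)"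
  obtains C where "0 \<le> C" "\<And>s t. s \<in> S \<Longrightarrow> t \<in> S \<Longrightarrow>
    norm (Y 0 s - (\<Sum>i<n. ((s - t) ^ i / fact i) *\<^sub>R Y i t)) \<le> C * \<bar>s - t\<bar> ^ n"
proof -
  have "continuous_on S (Y n)"
    using has_vector_derivative_continuous[OF der] by (intro continuous_at_imp_continuous_on) blast
  then have "bounded (Y n ` S)"
    by (intro compact_imp_bounded compact_continuous_image S)
  then obtain B where B: "0 \<le> B" "\<And>t. t \<in> S \<Longrightarrow> norm (Y n t) \<le> B"
    unfolding bounded_pos by (metis imageI less_imp_le)
  have bound: "norm (Y 0 s - (\<Sum>i<n. ((s - t) ^ i / fact i) *\<^sub>R Y i t)) \<le> real DIM('v) * B * \<bar>s - t\<bar> ^ n"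
    if s: "s \<in> S" and t: "t \<in> S" for s t
  proof -
    have "\<bar>(Y 0 s - (\<Sum>i<n. ((s - t) ^ i / fact i) *\<^sub>R Y i t)) \<bullet> b\<bar> \<le> B * \<bar>s - t\<bar> ^ n"
      if b: "b \<in> Basis" for b
    proof -
      have comp: "\<bar>Y n t \<bullet> b\<bar> \<le> B" if "t \<in> S" for t
        using Basis_le_norm[OF b, of "Y n t"] B(2)[OF that] by linarith
      show ?thesis
      proof (cases n)
        case 0
        then show ?thesis using comp[OF s] by simp
      next
        case (Suc l)
        have "norm (Y 0 s \<bullet> b - (\<Sum>i\<le>l. (Y i t \<bullet> b) * (s - t) ^ i / fact i))
            \<le> B * norm (s - t) ^ Suc l / fact l"
        proof (rule field_Taylor[OF S(1) _ _ t s, where f = "\<lambda>i t. Y i t \<bullet> b"])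
          show "((\<lambda>t. Y i t \<bullet> b) has_field_derivative Y (Suc i) u \<bullet> b) (at u within S)"
            if "u \<in> S" for i u
            using bounded_linear.has_vector_derivative[OF bounded_linear_inner_left der[OF that], of i b]
            by (simp add: has_real_derivative_iff_has_vector_derivative
                has_vector_derivative_at_within)
        qed (use comp Suc in auto)
        also have "\<dots> \<le> B * \<bar>s - t\<bar> ^ n"
        proof -
          have "B * \<bar>s - t\<bar> ^ n / fact l \<le> B * \<bar>s - t\<bar> ^ n / 1"
            using B(1) by (intro divide_left_mono) auto
          then show ?thesis using Suc by simp
        qed
        finally show ?thesis
          using Suc by (simp add: inner_diff_left inner_sum_left lessThan_Suc_atMost mult.commute)
      qed
    qed
    then have "(\<Sum>b\<in>Basis. \<bar>(Y 0 s - (\<Sum>i<n. ((s - t) ^ i / fact i) *\<^sub>R Y i t)) \<bullet> b\<bar>)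
        \<le> (\<Sum>b\<in>(Basis::'v set). B * \<bar>s - t\<bar> ^ n)"
      by (rule sum_mono)
    then show ?thesis
      using norm_le_l1[of "Y 0 s - (\<Sum>i<n. ((s - t) ^ i / fact i) *\<^sub>R Y i t)"] by simp
  qed
  show thesis by (rule that[OF _ bound]) (use B in auto)
qed

text \<open>The curve is given beyond \<open>[t0, tF]\<close>, so that for small \<open>h\<close> it is defined at all abscissae of all
  steps, also at those outside \<open>[0, 1]\<close>.\<close>

locale smooth_curve =
  fixes y :: "real \<Rightarrow> real^'m" and a b t0 tF :: real
  assumes derivs: "\<And>k t. t \<in> {a<..<b} \<Longrightarrow>
      (nth_deriv k y has_vector_derivative nth_deriv (Suc k) y t) (at t)"
    and interval: "a < t0" "tF < b"
begin

text \<open>Because of the factor \<open>h\<^sup>d\<close> the first \<open>m - d\<close> Taylor coefficients of the derivative suffice; for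
  \<open>d \<ge> m\<close> the truncated difference is \<open>0\<close> and boundedness is enough.\<close>

lemma expands_taylor:
  "expands t0 tF y m (\<lambda>t h. h ^ d *\<^sub>R nth_deriv d y (t + \<gamma> * h))
     (\<lambda>k. if d \<le> k then \<gamma> ^ (k - d) / fact (k - d) else 0)"
proof -
  let ?S = "{(a + t0) / 2..(tF + b) / 2}"
  have "(nth_deriv (d + k) y has_vector_derivative nth_deriv (d + Suc k) y t) (at t)"
    if "t \<in> ?S" for k t
    using derivs[of t "d + k"] interval that by auto
  then obtain C where C: "0 \<le> C" "\<And>s t. s \<in> ?S \<Longrightarrow> t \<in> ?S \<Longrightarrow>
      norm (nth_deriv (d + 0) y s - (\<Sum>i<m - d. ((s - t) ^ i / fact i) *\<^sub>R nth_deriv (d + i) y t))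
        \<le> C * \<bar>s - t\<bar> ^ (m - d)"
    by (rule vector_taylor_bound[where S = ?S and Y = "\<lambda>k. nth_deriv (d + k) y" and n = "m - d",
          OF convex_real_interval(5) compact_Icc]) (assumption | rule that | blast)+
  \<comment> \<open>for \<open>h < ?r\<close> the points \<open>t + \<gamma> h\<close> use at most half of the margins of \<open>[t0, tF]\<close> in \<open>(a, b)\<close>\<close>
  let ?r = "min (t0 - a) (b - tF) / (2 * (\<bar>\<gamma>\<bar> + 1))"
  have "0 < ?r" using interval by simp
  then have "eventually (\<lambda>h. h \<in> {0<..<min ?r 1}) (at_right 0)"
    by (intro eventually_at_right_real) simp
  then have "eventually (\<lambda>h. \<forall>t\<in>{t0..tF}. norm (h ^ d *\<^sub>R nth_deriv d y (t + \<gamma> * h)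
      - (\<Sum>k<m. ((if d \<le> k then \<gamma> ^ (k - d) / fact (k - d) else 0) * h ^ k) *\<^sub>R nth_deriv k y t))
      \<le> (C * \<bar>\<gamma>\<bar> ^ (m - d)) * h ^ m) (at_right 0)"
  proof eventually_elim
    case (elim h)
    then have h: "0 < h" "h < ?r" "h \<le> 1" by auto
    show ?case
    proof
      fix t assume t: "t \<in> {t0..tF}"
      have "\<bar>\<gamma> * h\<bar> \<le> (\<bar>\<gamma>\<bar> + 1) * h" using h by (simp add: abs_mult)
      also have "\<dots> \<le> (\<bar>\<gamma>\<bar> + 1) * ?r" using h by (intro mult_left_mono) auto
      also have "\<dots> = min (t0 - a) (b - tF) / 2"
      proof -
        have "k * (u / (2 * k)) = u / 2" if "k > 0" for k u :: real using that by simp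
        moreover have "0 < \<bar>\<gamma>\<bar> + 1" by simp
        ultimately show ?thesis .
      qed
      finally have "\<bar>\<gamma> * h\<bar> \<le> (t0 - a) / 2" "\<bar>\<gamma> * h\<bar> \<le> (b - tF) / 2" by auto
      then have s: "t + \<gamma> * h \<in> ?S" and tS: "t \<in> ?S"
        using t interval unfolding abs_le_iff by (auto simp: field_simps)
      let ?F = "\<lambda>k. ((if d \<le> k then \<gamma> ^ (k - d) / fact (k - d) else 0) * h ^ k) *\<^sub>R nth_deriv k y t"
      have "(\<Sum>k<m. ?F k) = (\<Sum>k\<in>{d..<m}. ?F k)"
        by (rule sum.mono_neutral_right) auto
      also have "\<dots> = (\<Sum>i<m - d. ?F (d + i))"
        by (rule sum.reindex_bij_witness[of _ "\<lambda>i. d + i" "\<lambda>k. k - d"]) auto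
      also have "\<dots> = h ^ d *\<^sub>R (\<Sum>i<m - d. ((t + \<gamma> * h - t) ^ i / fact i) *\<^sub>R nth_deriv (d + i) y t)"
        by (simp add: scaleR_sum_right power_mult_distrib power_add field_simps)
      finally have "norm (h ^ d *\<^sub>R nth_deriv d y (t + \<gamma> * h) - (\<Sum>k<m. ?F k))
          = h ^ d * norm (nth_deriv (d + 0) y (t + \<gamma> * h)
              - (\<Sum>i<m - d. ((t + \<gamma> * h - t) ^ i / fact i) *\<^sub>R nth_deriv (d + i) y t))"
        using h by (simp flip: scaleR_right_diff_distrib)
      also have "\<dots> \<le> h ^ d * (C * \<bar>t + \<gamma> * h - t\<bar> ^ (m - d))"
        using h by (intro mult_left_mono C(2)[OF s tS]) auto
      also have "\<dots> = (C * \<bar>\<gamma>\<bar> ^ (m - d)) * h ^ (d + (m - d))"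
        using h by (simp add: abs_mult power_mult_distrib power_add)
      also have "\<dots> \<le> (C * \<bar>\<gamma>\<bar> ^ (m - d)) * h ^ m"
        using h C(1) by (intro mult_left_mono power_decreasing) auto
      finally show "norm (h ^ d *\<^sub>R nth_deriv d y (t + \<gamma> * h) - (\<Sum>k<m. ?F k))
          \<le> (C * \<bar>\<gamma>\<bar> ^ (m - d)) * h ^ m" .
    qed
  qed
  then show ?thesis unfolding expands_def uniform_O_def by blast
qed

lemma expands_stage_value:
  "expands t0 tF y m (\<lambda>t h. stage_values y c h t $ i) (\<lambda>k. c $ i ^ k / fact k)"
  using expands_taylor[of m 0 "c $ i"] by (simp add: stage_values_def nth_deriv_def)

lemma expands_stage_derivative:
  "expands t0 tF y m (\<lambda>t h. h *\<^sub>R stage_values (nth_deriv 1 y) c h t $ i)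
     (\<lambda>k. if 1 \<le> k then c $ i ^ (k - 1) / fact (k - 1) else 0)"
  using expands_taylor[of m 1 "c $ i"] by (simp add: stage_values_def)

lemma sum_taylor_coefficients_at_0:
  fixes u :: "nat \<Rightarrow> real"
  assumes "k \<le> p"
  shows "(\<Sum>d\<le>p. u d * (if d \<le> k then 0 ^ (k - d) / fact (k - d) else 0)) = u k"
proof -
  have "(\<Sum>d\<le>p. u d * (if d \<le> k then 0 ^ (k - d) / fact (k - d) else 0))
      = (\<Sum>d\<le>p. if d = k then u k else 0)"
    by (intro sum.cong) (auto simp: power_0_left)
  then show ?thesis using assms by simp
qed

lemma expands_external_value:
  "expands t0 tF y m (\<lambda>t h. external_values w p h y (t + \<gamma> * h) $ i)
     (\<lambda>k. \<Sum>d\<le>p. w d $ i * (if d \<le> k then \<gamma> ^ (k - d) / fact (k - d) else 0))"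
  unfolding external_values_def eta_def vec_lambda_beta
  by (intro expands_sum expands_scaleR expands_taylor) simp

text \<open>The stage order conditions are available up to degree \<open>q \<ge> p - 1\<close>. They cancel all terms below \<open>h\<^sup>p\<close>,
  and the term of degree \<open>p\<close> is left in the remainder.\<close>

lemma stage_residual:
  fixes c :: "real^'s" and M :: "('s::finite, 'r::finite) glm"
  assumes "glm_order c M w p q"
  shows "uniform_O t0 tF p (\<lambda>t h. stage_values y c h t
     - h *\<^sub>R (coeff_A M ** stage_values (nth_deriv 1 y) c h t) - coeff_U M ** external_values w p h y t)"
proof (rule uniform_O_vec)
  fix i
  let ?a = "\<lambda>k. c $ i ^ k / fact k
    - (\<Sum>j\<in>UNIV. coeff_A M $ i $ j * (if 1 \<le> k then c $ j ^ (k - 1) / fact (k - 1) else 0))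
    - (\<Sum>l\<in>UNIV. coeff_U M $ i $ l * (\<Sum>d\<le>p. w d $ l * (if d \<le> k then 0 ^ (k - d) / fact (k - d) else 0)))"
  have "expands t0 tF y p (\<lambda>t h. stage_values y c h t $ i
      - (\<Sum>j\<in>UNIV. coeff_A M $ i $ j *\<^sub>R (h *\<^sub>R stage_values (nth_deriv 1 y) c h t $ j))
      - (\<Sum>l\<in>UNIV. coeff_U M $ i $ l *\<^sub>R external_values w p h y (t + 0 * h) $ l)) ?a"
    by (intro expands_diff expands_sum expands_scaleR expands_stage_value expands_stage_derivative
        expands_external_value finite)
  moreover have "?a k = 0" if k: "k < p" for k
  proof -
    have w: "(\<Sum>d\<le>p. w d $ l * (if d \<le> k then 0 ^ (k - d) / fact (k - d) else 0)) = w k $ l" for l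
      using k by (intro sum_taylor_coefficients_at_0) simp
    show ?thesis
    proof (cases "k = 0")
      case True
      have "(coeff_U M *v w 0) $ i = 1" using assms by (simp add: glm_order_def)
      then show ?thesis unfolding w using True by (simp add: matrix_vector_mult_def)
    next
      case False
      then have "k \<in> {1..q}" using k assms by (auto simp: glm_order_def)
      then have "(1 / fact k) *\<^sub>R cpow c k - (1 / fact (k - 1)) *\<^sub>R (coeff_A M *v cpow c (k - 1))
          - coeff_U M *v w k = 0"
        using assms unfolding glm_order_def by blast
      from arg_cong[OF this, of "\<lambda>v. v $ i"] show ?thesis unfolding w using False
        by (simp add: matrix_vector_mult_def cpow_def sum_divide_distrib)
    qed
  qed
  ultimately have "uniform_O t0 tF p (\<lambda>t h. stage_values y c h t $ i
      - (\<Sum>j\<in>UNIV. coeff_A M $ i $ j *\<^sub>R (h *\<^sub>R stage_values (nth_deriv 1 y) c h t $ j))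
      - (\<Sum>l\<in>UNIV. coeff_U M $ i $ l *\<^sub>R external_values w p h y (t + 0 * h) $ l))"
    by (rule expands_zero_imp_uniform_O)
  then show "uniform_O t0 tF p (\<lambda>t h. (stage_values y c h t
     - h *\<^sub>R (coeff_A M ** stage_values (nth_deriv 1 y) c h t) - coeff_U M ** external_values w p h y t) $ i)"
    by (simp add: matrix_mult_row scaleR_sum_right mult.commute)
qed

text \<open>The external order conditions hold up to degree \<open>p\<close>, one degree more than is asked of the stages;
  this is the order that the factor \<open>1/h\<close> in the number of steps consumes.\<close>

lemma external_residual:
  fixes c :: "real^'s" and M :: "('s::finite, 'r::finite) glm"
  assumes "glm_order c M w p q"
  shows "uniform_O t0 tF (Suc p) (\<lambda>t h. external_values w p h y (t + h)
     - h *\<^sub>R (coeff_B M ** stage_values (nth_deriv 1 y) c h t) - coeff_V M ** external_values w p h y t)"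
proof (rule uniform_O_vec)
  fix i
  let ?a = "\<lambda>k. (\<Sum>d\<le>p. w d $ i * (if d \<le> k then 1 ^ (k - d) / fact (k - d) else 0))
    - (\<Sum>j\<in>UNIV. coeff_B M $ i $ j * (if 1 \<le> k then c $ j ^ (k - 1) / fact (k - 1) else 0))
    - (\<Sum>l\<in>UNIV. coeff_V M $ i $ l * (\<Sum>d\<le>p. w d $ l * (if d \<le> k then 0 ^ (k - d) / fact (k - d) else 0)))"
  have "expands t0 tF y (Suc p) (\<lambda>t h. external_values w p h y (t + 1 * h) $ i
      - (\<Sum>j\<in>UNIV. coeff_B M $ i $ j *\<^sub>R (h *\<^sub>R stage_values (nth_deriv 1 y) c h t $ j))
      - (\<Sum>l\<in>UNIV. coeff_V M $ i $ l *\<^sub>R external_values w p h y (t + 0 * h) $ l)) ?a"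
    by (intro expands_diff expands_sum expands_scaleR expands_stage_derivative
        expands_external_value finite)
  moreover have "?a k = 0" if k: "k < Suc p" for k
  proof -
    have w: "(\<Sum>d\<le>p. w d $ l * (if d \<le> k then 0 ^ (k - d) / fact (k - d) else 0)) = w k $ l" for l
      using k by (intro sum_taylor_coefficients_at_0) simp
    have "(\<Sum>d\<le>p. w d $ i * (if d \<le> k then 1 ^ (k - d) / fact (k - d) else 0))
        = (\<Sum>d\<le>k. w d $ i / fact (k - d))"
      by (rule sum.mono_neutral_cong_right) (use k in auto)
    also have "\<dots> = (\<Sum>l\<le>k. w (k - l) $ i / fact l)"
      by (rule sum.reindex_bij_witness[of _ "\<lambda>l. k - l" "\<lambda>l. k - l"]) auto
    finally have shift: "(\<Sum>d\<le>p. w d $ i * (if d \<le> k then 1 ^ (k - d) / fact (k - d) else 0))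
        = (\<Sum>l\<le>k. w (k - l) $ i / fact l)" .
    show ?thesis
    proof (cases "k = 0")
      case True
      have "(coeff_V M *v w 0) $ i = w 0 $ i" using assms by (simp add: glm_order_def)
      then show ?thesis unfolding w shift using True by (simp add: matrix_vector_mult_def)
    next
      case False
      then have "k \<in> {1..p}" using k by simp
      then have "(\<Sum>l\<le>k. (1 / fact l) *\<^sub>R w (k - l))
          - (1 / fact (k - 1)) *\<^sub>R (coeff_B M *v cpow c (k - 1)) - coeff_V M *v w k = 0"
        using assms unfolding glm_order_def by blast
      from arg_cong[OF this, of "\<lambda>v. v $ i"] show ?thesis unfolding w shift using False
        by (simp add: matrix_vector_mult_def cpow_def sum_divide_distrib)
    qed
  qed
  ultimately have "uniform_O t0 tF (Suc p) (\<lambda>t h. external_values w p h y (t + 1 * h) $ i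
      - (\<Sum>j\<in>UNIV. coeff_B M $ i $ j *\<^sub>R (h *\<^sub>R stage_values (nth_deriv 1 y) c h t $ j))
      - (\<Sum>l\<in>UNIV. coeff_V M $ i $ l *\<^sub>R external_values w p h y (t + 0 * h) $ l))"
    by (rule expands_zero_imp_uniform_O)
  then show "uniform_O t0 tF (Suc p) (\<lambda>t h. (external_values w p h y (t + h)
     - h *\<^sub>R (coeff_B M ** stage_values (nth_deriv 1 y) c h t) - coeff_V M ** external_values w p h y t) $ i)"
    by (simp add: matrix_mult_row scaleR_sum_right mult.commute)
qed

text \<open>Eliminating the stage derivatives through the inverse of the stage equations turns the two
  residuals into the residual of the update in the stiff limit.\<close>

lemma stiff_limit_residual:
  fixes c :: "real^'s" and M :: "('s::finite, 'r::finite) glm"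
  assumes order: "glm_order c M w p q" and inv: "invertible (coeff_A M)"
  shows "uniform_O t0 tF p (\<lambda>t h. external_values w p h y (t + h)
     - (coeff_B M ** matrix_inv (coeff_A M)) ** stage_values y c h t
     - M_infinity M ** external_values w p h y t)"
proof -
  let ?BA = "coeff_B M ** matrix_inv (coeff_A M)"
  let ?e = "\<lambda>t h. external_values w p h y t"
  let ?y = "\<lambda>t h. stage_values y c h t"
  let ?y' = "\<lambda>t h. stage_values (nth_deriv 1 y) c h t"
  let ?R = "\<lambda>t h. ?e (t + h) h - h *\<^sub>R (coeff_B M ** ?y' t h) - coeff_V M ** ?e t h"
  let ?S = "\<lambda>t h. ?y t h - h *\<^sub>R (coeff_A M ** ?y' t h) - coeff_U M ** ?e t h"
  obtain C where C: "eventually (\<lambda>h. \<forall>t\<in>{t0..tF}. norm (?R t h) \<le> C * h ^ Suc p) (at_right 0)"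
    using external_residual[OF order] unfolding uniform_O_def by blast
  have "eventually (\<lambda>h::real. h \<in> {0<..<1}) (at_right 0)"
    by (rule eventually_at_right_real) simp
  with C have "eventually (\<lambda>h. \<forall>t\<in>{t0..tF}. norm (?R t h) \<le> \<bar>C\<bar> * h ^ p) (at_right 0)"
  proof eventually_elim
    case (elim h)
    have "C * h ^ Suc p \<le> \<bar>C\<bar> * h ^ p"
      using elim(2) by (intro mult_mono power_decreasing) auto
    then show ?case using elim(1) by fastforce
  qed
  then have R: "uniform_O t0 tF p ?R" unfolding uniform_O_def by blast
  have "uniform_O t0 tF p (\<lambda>t h. ?R t h - ?BA ** ?S t h)"
    by (rule uniform_O_diff[OF R uniform_O_linear[where T = "\<lambda>X. ?BA ** X",
            OF norm_matrix_mult_le entry_norm_nonneg stage_residual[OF order]]])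
  moreover have "?R t h - ?BA ** ?S t h = ?e (t + h) h - ?BA ** ?y t h - M_infinity M ** ?e t h" for t h
  proof -
    have "?BA ** coeff_A M = coeff_B M"
      by (simp add: matrix_mul_assoc[symmetric] matrix_inv_mult[OF inv])
    then have 1: "?BA ** (coeff_A M ** ?y' t h) = coeff_B M ** ?y' t h"
      by (simp only: matrix_mul_assoc)
    have 2: "X ** (P - h *\<^sub>R Q - S) = X ** P - h *\<^sub>R (X ** Q) - X ** S"
      for X :: "real^'s^'r" and P Q S :: "real^'m^'s"
      by (simp add: vec_eq_iff matrix_matrix_mult_def algebra_simps sum_subtractf sum.distrib
          sum_distrib_left)
    have "(P - Q) ** X = P ** X - Q ** X" for P Q :: "real^'r^'r" and X :: "real^'m^'r"
      by (simp add: vec_eq_iff matrix_matrix_mult_def algebra_simps sum_subtractf)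
    then have 3: "M_infinity M ** ?e t h = coeff_V M ** ?e t h - ?BA ** (coeff_U M ** ?e t h)"
      by (simp only: M_infinity_def matrix_mul_assoc)
    have "e - hb - v - (y - hb - u) = e - y - (v - u)" for e hb v y u :: "real^'m^'r"
      by (simp add: algebra_simps)
    then show ?thesis unfolding 1 2 3 by blast
  qed
  ultimately show ?thesis by (simp only:)
qed

end

section \<open>Error propagation\<close>

text \<open>Variation of constants.\<close>

lemma affine_recurrence_solution:
  assumes "linear T" "\<And>n. n < N \<Longrightarrow> e (Suc n) = T (e n) + d n" "n \<le> N"
  shows "e n = (T ^^ n) (e 0) + (\<Sum>j<n. (T ^^ (n - Suc j)) (d j))"
  using assms(3)
proof (induction n)
  case (Suc n)
  have "e (Suc n) = T ((T ^^ n) (e 0) + (\<Sum>j<n. (T ^^ (n - Suc j)) (d j))) + d n"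
    using Suc assms(2)[of n] by simp
  also have "\<dots> = (T ^^ Suc n) (e 0) + (\<Sum>j<n. T ((T ^^ (n - Suc j)) (d j))) + d n"
    by (simp add: linear_add[OF assms(1)] linear_sum[OF assms(1)])
  also have "(\<Sum>j<n. T ((T ^^ (n - Suc j)) (d j))) = (\<Sum>j<n. (T ^^ (Suc n - Suc j)) (d j))"
  proof (rule sum.cong[OF refl])
    fix j assume "j \<in> {..<n}"
    then have "Suc n - Suc j = Suc (n - Suc j)" by auto
    then show "T ((T ^^ (n - Suc j)) (d j)) = (T ^^ (Suc n - Suc j)) (d j)"
      by (simp only: funpow.simps o_apply)
  qed
  finally show ?case by (simp add: add.assoc)
qed simp

lemma discrete_gronwall:
  fixes u :: "nat \<Rightarrow> real"
  assumes "0 \<le> \<beta>" "\<And>n. n \<le> N \<Longrightarrow> u n \<le> \<alpha> + \<beta> * (\<Sum>j<n. u j)" "n \<le> N"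
  shows "u n \<le> \<alpha> * (1 + \<beta>) ^ n"
proof -
  have G: "\<alpha> + \<beta> * (\<Sum>j<n. u j) \<le> \<alpha> * (1 + \<beta>) ^ n" if "n \<le> N" for n
    using that
  proof (induction n)
    case (Suc n)
    have "\<beta> * u n \<le> \<beta> * (\<alpha> + \<beta> * (\<Sum>j<n. u j))"
      using assms(1,2) Suc.prems by (intro mult_left_mono) auto
    then have "\<alpha> + \<beta> * (\<Sum>j<Suc n. u j) \<le> (1 + \<beta>) * (\<alpha> + \<beta> * (\<Sum>j<n. u j))"
      by (simp add: algebra_simps)
    also have "\<dots> \<le> (1 + \<beta>) * (\<alpha> * (1 + \<beta>) ^ n)"
      using assms(1) Suc by (intro mult_left_mono) auto
    finally show ?case by (simp add: mult_ac)
  qed simp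
  show ?thesis using assms(2)[OF assms(3)] G[OF assms(3)] by linarith
qed

text \<open>The local error estimate is only available while the error is at most \<open>r\<close>; the resulting
  bound keeps it there.\<close>

lemma power_bounded_recurrence_bound:
  fixes e d :: "nat \<Rightarrow> 'v::real_normed_vector"
  assumes T: "linear T" "\<And>n v. norm ((T ^^ n) v) \<le> K * norm v" and K: "0 \<le> K"
    and rec: "\<And>n. n < N \<Longrightarrow> e (Suc n) = T (e n) + d n"
    and d: "\<And>n. n < N \<Longrightarrow> norm (e n) \<le> r \<Longrightarrow> norm (d n) \<le> h * (L * norm (e n) + \<epsilon>)"
    and nonneg: "0 \<le> h" "0 \<le> L" "0 \<le> \<epsilon>" and \<tau>: "real N * h \<le> \<tau>"
    and small: "K * (norm (e 0) + \<tau> * \<epsilon>) * exp (K * L * \<tau>) \<le> r"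
    and "n \<le> N"
  shows "norm (e n) \<le> K * (norm (e 0) + \<tau> * \<epsilon>) * exp (K * L * \<tau>)"
  using \<open>n \<le> N\<close>
proof (induction n rule: less_induct)
  case (less n)
  have dj: "norm (d j) \<le> h * (L * norm (e j) + \<epsilon>)" if "j < n" for j
    using d[of j] less.IH[OF that] less.prems that small by auto
  define \<alpha> where "\<alpha> = K * (norm (e 0) + \<tau> * \<epsilon>)"
  have \<tau>0: "0 \<le> \<tau>" using \<tau> nonneg by (meson mult_nonneg_nonneg of_nat_0_le_iff order_trans)
  have bound: "norm (e k) \<le> \<alpha> + (K * h * L) * (\<Sum>j<k. norm (e j))" if k: "k \<le> n" for k
  proof -
    have "norm (e k) \<le> norm ((T ^^ k) (e 0)) + norm (\<Sum>j<k. (T ^^ (k - Suc j)) (d j))"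
      by (subst affine_recurrence_solution[where e = e and d = d and n = k, OF T(1) rec])
        (use k less.prems in \<open>auto intro: norm_triangle_ineq\<close>)
    also have "\<dots> \<le> K * norm (e 0) + (\<Sum>j<k. K * (h * (L * norm (e j) + \<epsilon>)))"
    proof (intro add_mono T(2) sum_norm_le)
      fix j assume "j \<in> {..<k}"
      then have "K * norm (d j) \<le> K * (h * (L * norm (e j) + \<epsilon>))"
        using dj[of j] k K by (intro mult_left_mono) auto
      then show "norm ((T ^^ (k - Suc j)) (d j)) \<le> K * (h * (L * norm (e j) + \<epsilon>))"
        using T(2)[of "k - Suc j" "d j"] by linarith
    qed
    also have "\<dots> = K * norm (e 0) + (K * h * L) * (\<Sum>j<k. norm (e j)) + K * ((real k * h) * \<epsilon>)"
      by (simp add: distrib_left sum.distrib sum_distrib_left mult_ac)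
    also have "K * ((real k * h) * \<epsilon>) \<le> K * (\<tau> * \<epsilon>)"
    proof (intro mult_left_mono mult_right_mono K nonneg)
      have "real k * h \<le> real N * h" using k less.prems nonneg by (intro mult_right_mono) auto
      then show "real k * h \<le> \<tau>" using \<tau> by linarith
    qed
    finally show ?thesis by (simp add: \<alpha>_def algebra_simps)
  qed
  have \<beta>: "0 \<le> K * h * L" using K nonneg by simp
  have "norm (e n) \<le> \<alpha> * (1 + K * h * L) ^ n"
    by (rule discrete_gronwall[OF \<beta> bound order_refl])
  also have "\<dots> \<le> \<alpha> * exp (K * L * \<tau>)"
  proof (rule mult_left_mono)
    have "(1 + K * h * L) ^ n \<le> exp (K * h * L) ^ n"
      using \<beta> by (intro power_mono) (auto simp: exp_ge_add_one_self)
    also have "\<dots> = exp (K * L * (real n * h))" by (simp add: exp_of_nat_mult[symmetric] mult_ac)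
    also have "\<dots> \<le> exp (K * L * \<tau>)"
    proof -
      have "real n * h \<le> real N * h" using less.prems nonneg by (intro mult_right_mono) auto
      then show ?thesis using \<tau> K nonneg by (simp add: mult_left_mono)
    qed
    finally show "(1 + K * h * L) ^ n \<le> exp (K * L * \<tau>)" .
    show "0 \<le> \<alpha>" using K nonneg \<tau>0 by (simp add: \<alpha>_def)
  qed
  finally show ?case by (simp add: \<alpha>_def)
qed

text \<open>What a step adds is damped by the following steps, so that perturbations which are merely bounded
  do not accumulate with the number of steps.\<close>

lemma summable_recurrence_bound:
  fixes e d :: "nat \<Rightarrow> 'v::real_normed_vector"
  assumes T: "linear T" "\<And>n v. norm ((T ^^ n) v) \<le> s n * norm v"
    and s: "summable s" "\<And>n. 0 \<le> s n"
    and rec: "\<And>n. n < N \<Longrightarrow> e (Suc n) = T (e n) + d n"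
    and d: "\<And>n. n < N \<Longrightarrow> norm (d n) \<le> \<epsilon>" and \<epsilon>: "0 \<le> \<epsilon>"
    and n: "n \<le> N"
  shows "norm (e n) \<le> suminf s * (norm (e 0) + \<epsilon>)"
proof -
  have "norm (e n) \<le> norm ((T ^^ n) (e 0)) + norm (\<Sum>j<n. (T ^^ (n - Suc j)) (d j))"
    by (subst affine_recurrence_solution[where e = e and d = d, OF T(1) rec n])
      (auto intro: norm_triangle_ineq)
  also have "\<dots> \<le> s n * norm (e 0) + (\<Sum>j<n. s (n - Suc j) * \<epsilon>)"
  proof (intro add_mono T(2) sum_norm_le)
    fix j assume "j \<in> {..<n}"
    then have "s (n - Suc j) * norm (d j) \<le> s (n - Suc j) * \<epsilon>"
      using d[of j] n s by (intro mult_left_mono) auto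
    then show "norm ((T ^^ (n - Suc j)) (d j)) \<le> s (n - Suc j) * \<epsilon>"
      using T(2)[of "n - Suc j" "d j"] by linarith
  qed
  also have "(\<Sum>j<n. s (n - Suc j) * \<epsilon>) = (\<Sum>j<n. s j) * \<epsilon>"
    using sum.nat_diff_reindex[of s n] by (simp flip: sum_distrib_right)
  also have "s n * norm (e 0) + (\<Sum>j<n. s j) * \<epsilon> \<le> suminf s * norm (e 0) + suminf s * \<epsilon>"
    using sum_le_suminf[OF s(1), of "{..<n}"] sum_le_suminf[OF s(1), of "{n}"] s(2) \<epsilon>
    by (intro add_mono mult_right_mono) auto
  finally show ?thesis by (simp add: distrib_left)
qed

section \<open>One step of the method\<close>

lemma finite_linorder_induct [case_names less]:
  fixes i :: "'s::{finite,linorder}"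
  assumes "\<And>i. (\<And>j. j < i \<Longrightarrow> P j) \<Longrightarrow> P i"
  shows "P i"
proof (induction i rule: measure_induct_rule[of "\<lambda>i. card {..<i}"])
  case (less i)
  have "card {..<j} < card {..<i}" if "j < i" for j
    using that by (intro psubset_card_mono) auto
  then show ?case using less assms by blast
qed

locale imex_dae = index_1_dae f g D x z a b
  for f g :: "(real^'m) \<times> (real^'m) \<Rightarrow> real^'m" and D and x z :: "real \<Rightarrow> real^'m" and a b +
  fixes t0 tF :: real
    and c :: "real^('s::{finite,linorder})"
    and ME MI :: "('s, 'r::finite) glm"
    and wE wI :: "nat \<Rightarrow> real^'r"
    and p qE qI :: nat
  assumes interval: "a < t0" "t0 < tF" "tF < b"
    and imex: "imex_class c ME MI wE wI p qE qI"
    and zero_stable: "power_bounded (coeff_V ME)"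
begin

lemma orders: "glm_order c ME wE p qE" "glm_order c MI wI p qI"
  and explicit: "i \<le> j \<Longrightarrow> coeff_A ME $ i $ j = 0"
  and invertible_AI: "invertible (coeff_A MI)"
  and radius: "spectral_radius (M_infinity MI) < 1"
  using imex positive_eigenvalues_invertible
  by (auto simp: imex_class_def strictly_lower_triangular_def)

sublocale x_curve: smooth_curve x a b t0 tF
  by unfold_locales (use solution_derivs interval in auto)

sublocale z_curve: smooth_curve z a b t0 tF
  by unfold_locales (use solution_derivs interval in auto)

definition "step \<delta> h t \<xi> X Z \<longleftrightarrow>
   X = h *\<^sub>R (coeff_A ME ** stagewise f X Z) + coeff_U ME ** \<xi> \<and> stagewise g X Z = 0 \<and>
   (\<forall>i. dist (Z $ i) (stage_values z c h t $ i) < \<delta>)"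

text \<open>The equations of a single stage: stage \<open>i\<close> depends on earlier stages only, which permits
  construction and estimation stage by stage.\<close>

definition "stage \<delta> h t \<xi> X Z i \<longleftrightarrow>
   X $ i = (h *\<^sub>R (coeff_A ME ** stagewise f X Z) + coeff_U ME ** \<xi>) $ i \<and> g (X $ i, Z $ i) = 0 \<and>
   norm (Z $ i - z (t + c $ i * h)) < \<delta>"

lemma step_iff_stages: "step \<delta> h t \<xi> X Z \<longleftrightarrow> (\<forall>i. stage \<delta> h t \<xi> X Z i)"
  by (auto simp: step_def stage_def vec_eq_iff stagewise_def stage_values_def dist_norm)

lemma explicit_stage_cong:
  assumes "\<And>j. j < i \<Longrightarrow> X $ j = X' $ j" "\<And>j. j < i \<Longrightarrow> Z $ j = Z' $ j"
  shows "(coeff_A ME ** stagewise f X Z) $ i = (coeff_A ME ** stagewise f X' Z') $ i"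
  unfolding matrix_mult_row
proof (rule sum.cong[OF refl])
  fix j
  show "coeff_A ME $ i $ j *\<^sub>R stagewise f X Z $ j = coeff_A ME $ i $ j *\<^sub>R stagewise f X' Z' $ j"
    using assms explicit[of i j] by (cases "j < i") (auto simp: stagewise_def)
qed

definition
  "exact_f h t = stagewise f (stage_values x c h t) (stage_values z c h t)"

text \<open>Earlier stages enter with a factor \<open>h\<close>, so for small \<open>h\<close> their errors add at most another \<open>E\<close> to
  the error \<open>E\<close> that stems from the input and from the stage residual. Hence the factor \<open>2\<close> serves
  for all stages and does not grow from one stage to the next.\<close>

lemma stage_error_bound:
  assumes Lip: "\<And>j. j < i \<Longrightarrow> norm (f (X $ j, Z $ j) - f (x (t + c $ j * h), z (t + c $ j * h)))
      \<le> L * (norm (X $ j - x (t + c $ j * h)) + norm (Z $ j - z (t + c $ j * h)))"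
    and prev: "\<And>j. j < i \<Longrightarrow> norm (X $ j - x (t + c $ j * h)) \<le> 2 * E"
      "\<And>j. j < i \<Longrightarrow> norm (Z $ j - z (t + c $ j * h)) \<le> L * (2 * E)"
    and X: "X $ i = (h *\<^sub>R (coeff_A ME ** stagewise f X Z) + coeff_U ME ** \<xi>) $ i"
    and E: "norm (coeff_U ME ** (\<xi> - \<xi>') + R) \<le> E"
    and exact: "stage_values x c h t - h *\<^sub>R (coeff_A ME ** exact_f h t) - coeff_U ME ** \<xi>' = - R"
    and h: "0 < h" "h * (entry_norm (coeff_A ME) * (L * (2 + 2 * L))) \<le> 1" and L: "0 \<le> L"
  shows "norm (X $ i - x (t + c $ i * h)) \<le> 2 * E"
proof -
  have E0: "0 \<le> E" by (rule order_trans[OF norm_ge_zero E])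
  let ?d = "\<lambda>j. coeff_A ME $ i $ j *\<^sub>R (f (X $ j, Z $ j) - f (x (t + c $ j * h), z (t + c $ j * h)))"
  have "norm (?d j) \<le> \<bar>coeff_A ME $ i $ j\<bar> * (L * (2 + 2 * L) * E)" for j
  proof (cases "j < i")
    case True
    have "norm (f (X $ j, Z $ j) - f (x (t + c $ j * h), z (t + c $ j * h))) \<le> L * (2 * E + L * (2 * E))"
      using Lip[OF True] mult_left_mono[OF add_mono[OF prev[OF True]] L] by (rule order_trans)
    also have "L * (2 * E + L * (2 * E)) = L * (2 + 2 * L) * E" by (simp add: algebra_simps)
    finally show ?thesis unfolding norm_scaleR by (intro mult_left_mono) auto
  qed (use explicit[of i j] in auto)
  then have "norm (\<Sum>j\<in>UNIV. ?d j) \<le> (\<Sum>j\<in>UNIV. \<bar>coeff_A ME $ i $ j\<bar> * (L * (2 + 2 * L) * E))"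
    by (intro sum_norm_le)
  also have "\<dots> = (\<Sum>j\<in>UNIV. \<bar>coeff_A ME $ i $ j\<bar>) * (L * (2 + 2 * L) * E)"
    by (simp add: sum_distrib_right)
  also have "\<dots> \<le> entry_norm (coeff_A ME) * (L * (2 + 2 * L) * E)"
    unfolding entry_norm_def using L E0
    by (intro mult_right_mono member_le_sum[of i UNIV "\<lambda>i. \<Sum>j\<in>UNIV. \<bar>coeff_A ME $ i $ j\<bar>"])
      (auto simp: sum_nonneg)
  finally have "h * norm (\<Sum>j\<in>UNIV. ?d j) \<le> h * (entry_norm (coeff_A ME) * (L * (2 + 2 * L) * E))"
    using h by (intro mult_left_mono) auto
  also have "\<dots> = (h * (entry_norm (coeff_A ME) * (L * (2 + 2 * L)))) * E" by (simp add: mult_ac)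
  also have "\<dots> \<le> 1 * E" using h(2) E0 by (rule mult_right_mono)
  finally have 1: "norm (h *\<^sub>R (\<Sum>j\<in>UNIV. ?d j)) \<le> E" using h by simp
  have "stage_values x c h t $ i - h *\<^sub>R (coeff_A ME ** exact_f h t) $ i - (coeff_U ME ** \<xi>') $ i = - (R $ i)"
    using arg_cong[OF exact, of "\<lambda>v. v $ i"] by simp
  then have "X $ i - x (t + c $ i * h) = h *\<^sub>R ((coeff_A ME ** stagewise f X Z) $ i - (coeff_A ME ** exact_f h t) $ i)
      + ((coeff_U ME ** \<xi>) $ i - (coeff_U ME ** \<xi>') $ i + R $ i)"
    using X by (simp add: stage_values_def algebra_simps)
  also have "(coeff_A ME ** stagewise f X Z) $ i - (coeff_A ME ** exact_f h t) $ i = (\<Sum>j\<in>UNIV. ?d j)"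
    by (simp add: matrix_mult_row exact_f_def stagewise_def stage_values_def
        scaleR_right_diff_distrib sum_subtractf)
  also have "(coeff_U ME ** \<xi>) $ i - (coeff_U ME ** \<xi>') $ i + R $ i
      = (coeff_U ME ** (\<xi> - \<xi>') + R) $ i"
    by (simp add: linear_diff[OF matrix_mult_linear])
  finally have "norm (X $ i - x (t + c $ i * h))
      \<le> norm (h *\<^sub>R (\<Sum>j\<in>UNIV. ?d j)) + norm ((coeff_U ME ** (\<xi> - \<xi>') + R) $ i)"
    by (simp only: norm_triangle_ineq)
  also have "\<dots> \<le> E + E"
    using 1 E Finite_Cartesian_Product.norm_nth_le[of "coeff_U ME ** (\<xi> - \<xi>') + R" i] by linarith
  finally show ?thesis by simp
qed

text \<open>Stages are built one after the other: the new \<open>X\<close> component is explicit, by the previous lemma it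
  stays in the region where the local branch exists, and the branch supplies the \<open>Z\<close> component. The
  factor \<open>h\<close> in the last estimate is the one in front of \<open>B\<^sup>E\<close>; it makes up for the stages being
  accurate to order \<open>p\<close> only.\<close>

lemma one_step:
  obtains \<delta> r \<Lambda> where "0 < \<delta>" "0 < r" "0 \<le> \<Lambda>"
    "eventually (\<lambda>h. \<forall>t\<in>{t0..tF}. \<forall>\<xi>. norm (\<xi> - external_values wE p h x t) \<le> r \<longrightarrow>
       (\<exists>X Z. step \<delta> h t \<xi> X Z) \<and>
       (\<forall>X Z. step \<delta> h t \<xi> X Z \<longrightarrow>
          norm (X - stage_values x c h t) \<le> \<Lambda> * (norm (\<xi> - external_values wE p h x t) + h ^ p) \<and>
          norm (Z - stage_values z c h t) \<le> \<Lambda> * (norm (\<xi> - external_values wE p h x t) + h ^ p) \<and>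
          norm (h *\<^sub>R (coeff_B ME ** stagewise f X Z) + coeff_V ME ** \<xi> - external_values wE p h x (t + h)
              - coeff_V ME ** (\<xi> - external_values wE p h x t))
            \<le> h * (\<Lambda> * (norm (\<xi> - external_values wE p h x t) + h ^ p)))) (at_right 0)"
proof -
  let ?K = "{(a + t0) / 2..(tF + b) / 2}"
  have "?K \<subseteq> {a<..<b}" using interval by auto
  then obtain \<delta> \<rho> L where branch: "\<delta> > 0" "\<rho> > 0" "L \<ge> 0"
    "\<And>t u. t \<in> ?K \<Longrightarrow> norm (u - x t) \<le> \<rho> \<Longrightarrow> \<exists>v. norm (v - z t) < \<delta> \<and> g (u, v) = 0"
    "\<And>t u v. t \<in> ?K \<Longrightarrow> norm (u - x t) \<le> \<rho> \<Longrightarrow> norm (v - z t) < \<delta> \<Longrightarrow> g (u, v) = 0 \<Longrightarrow>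
      norm (v - z t) \<le> L * norm (u - x t)"
    "\<And>t u v. t \<in> ?K \<Longrightarrow> norm (u - x t) \<le> \<rho> \<Longrightarrow> norm (v - z t) < \<delta> \<Longrightarrow>
      norm (f (u, v) - f (x t, z t)) \<le> L * (norm (u - x t) + norm (v - z t))"
    by (rule local_branch[OF compact_Icc]) (rule that; blast)
  obtain C1' where C1': "eventually (\<lambda>h. \<forall>t\<in>{t0..tF}. norm (stage_values x c h t
     - h *\<^sub>R (coeff_A ME ** stage_values (nth_deriv 1 x) c h t) - coeff_U ME ** external_values wE p h x t)
     \<le> C1' * h ^ p) (at_right 0)"
    using x_curve.stage_residual[OF orders(1)] unfolding uniform_O_def by blast
  obtain C2' where C2': "eventually (\<lambda>h. \<forall>t\<in>{t0..tF}. norm (external_values wE p h x (t + h)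
     - h *\<^sub>R (coeff_B ME ** stage_values (nth_deriv 1 x) c h t) - coeff_V ME ** external_values wE p h x t)
     \<le> C2' * h ^ Suc p) (at_right 0)"
    using x_curve.external_residual[OF orders(1)] unfolding uniform_O_def by blast
  \<comment> \<open>\<open>\<kappa>\<close> turns \<open>\<Delta>\<close>, the input error plus \<open>h\<^sup>p\<close>, into the \<open>E\<close> of the previous lemma, and \<open>r\<close> is chosen
    such that \<open>2 E \<le> \<rho>\<close> whenever the input error and \<open>h\<^sup>p\<close> are at most \<open>r\<close>\<close>
  define \<kappa> where "\<kappa> = max (entry_norm (coeff_U ME)) (max C1' 1)"
  define \<Lambda>1 where "\<Lambda>1 = real CARD('s) * (2 * \<kappa> * (1 + L))"
  define \<Lambda>2 where "\<Lambda>2 = entry_norm (coeff_B ME) * (real CARD('s) * (L * (2 + 2 * L) * \<kappa>)) + \<bar>C2'\<bar>"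
  have \<kappa>: "1 \<le> \<kappa>" "entry_norm (coeff_U ME) \<le> \<kappa>" "C1' \<le> \<kappa>" by (auto simp: \<kappa>_def)
  define r where "r = \<rho> / (4 * \<kappa>)"
  have r: "0 < r" using branch \<kappa> by (simp add: r_def)
  have p: "0 < p" using imex by (simp add: imex_class_def)
  have "eventually (\<lambda>h::real. h ^ p < r) (at_right 0)"
  proof -
    have "((\<lambda>h::real. h ^ p) \<longlongrightarrow> 0 ^ p) (at_right 0)" by (intro tendsto_intros)
    then show ?thesis using r p by (intro order_tendstoD(2)[of _ 0]) auto
  qed
  moreover have "eventually (\<lambda>h. h * (entry_norm (coeff_A ME) * (L * (2 + 2 * L))) < 1) (at_right 0)"
  proof -
    have "((\<lambda>h. h * (entry_norm (coeff_A ME) * (L * (2 + 2 * L)))) \<longlongrightarrow> 0) (at_right 0)"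
      by (auto intro!: tendsto_eq_intros)
    then show ?thesis by (intro order_tendstoD(2)[of _ 0]) auto
  qed
  moreover have "eventually (\<lambda>h. \<forall>i. \<bar>c $ i * h\<bar> < min (t0 - a) (b - tF) / 2) (at_right 0)"
  proof (rule eventually_all_finite)
    fix i
    have "((\<lambda>h. \<bar>c $ i * h\<bar>) \<longlongrightarrow> 0) (at_right 0)"
      by (auto intro!: tendsto_eq_intros)
    then show "eventually (\<lambda>h. \<bar>c $ i * h\<bar> < min (t0 - a) (b - tF) / 2) (at_right 0)"
      using interval by (intro order_tendstoD(2)[of _ 0]) auto
  qed
  moreover have "eventually (\<lambda>h::real. 0 < h) (at_right 0)" by (rule eventually_at_right_less)
  ultimately have "eventually (\<lambda>h. \<forall>t\<in>{t0..tF}. \<forall>\<xi>. norm (\<xi> - external_values wE p h x t) \<le> r \<longrightarrow>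
       (\<exists>X Z. step \<delta> h t \<xi> X Z) \<and>
       (\<forall>X Z. step \<delta> h t \<xi> X Z \<longrightarrow>
          norm (X - stage_values x c h t) \<le> max \<Lambda>1 \<Lambda>2 * (norm (\<xi> - external_values wE p h x t) + h ^ p) \<and>
          norm (Z - stage_values z c h t) \<le> max \<Lambda>1 \<Lambda>2 * (norm (\<xi> - external_values wE p h x t) + h ^ p) \<and>
          norm (h *\<^sub>R (coeff_B ME ** stagewise f X Z) + coeff_V ME ** \<xi> - external_values wE p h x (t + h)
              - coeff_V ME ** (\<xi> - external_values wE p h x t))
            \<le> h * (max \<Lambda>1 \<Lambda>2 * (norm (\<xi> - external_values wE p h x t) + h ^ p)))) (at_right 0)"
    using C1' C2'
  proof eventually_elim
    case (elim h)
    show ?case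
    proof (intro ballI allI impI)
      fix t \<xi> assume t: "t \<in> {t0..tF}"
      define \<xi>' where "\<xi>' = external_values wE p h x t"
      define \<Delta> where "\<Delta> = norm (\<xi> - \<xi>') + h ^ p"
      assume "norm (\<xi> - external_values wE p h x t) \<le> r"
      then have "\<Delta> \<le> 2 * r" using elim(1) by (simp add: \<Delta>_def \<xi>'_def)
      define E where "E = \<kappa> * \<Delta>"
      have h: "0 < h" "h * (entry_norm (coeff_A ME) * (L * (2 + 2 * L))) \<le> 1" using elim by auto
      have \<Delta>0: "0 \<le> \<Delta>" using h by (simp add: \<Delta>_def)
      have "2 * E \<le> 2 * (\<kappa> * (2 * r))"
        unfolding E_def using \<open>\<Delta> \<le> 2 * r\<close> \<kappa> by (intro mult_left_mono) auto
      then have E\<rho>: "2 * E \<le> \<rho>" using \<kappa> by (simp add: r_def)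
      have tK: "t + c $ i * h \<in> ?K" and tI: "t + c $ i * h \<in> {a<..<b}" for i
      proof -
        have "\<bar>c $ i * h\<bar> < min (t0 - a) (b - tF) / 2" using elim(3) by blast
        then show "t + c $ i * h \<in> ?K" using t by (auto simp: abs_less_iff field_simps)
        then show "t + c $ i * h \<in> {a<..<b}" using \<open>?K \<subseteq> {a<..<b}\<close> by blast
      qed
      have "stage_values (nth_deriv 1 x) c h t = exact_f h t"
        using nth_deriv_1_x[OF tI]
        by (simp add: exact_f_def stagewise_def stage_values_def vec_eq_iff)
      note res = elim(5,6)[rule_format, OF t, unfolded this, folded \<xi>'_def]
      define R where "R = - (stage_values x c h t - h *\<^sub>R (coeff_A ME ** exact_f h t) - coeff_U ME ** \<xi>')"
      have exact: "stage_values x c h t - h *\<^sub>R (coeff_A ME ** exact_f h t) - coeff_U ME ** \<xi>' = - R"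
        by (simp add: R_def)
      have E: "norm (coeff_U ME ** (\<xi> - \<xi>') + R) \<le> E"
      proof -
        have "norm R \<le> C1' * h ^ p" using res(1) by (simp only: R_def norm_minus_cancel)
        also have "\<dots> \<le> \<kappa> * h ^ p" using \<kappa> h by (intro mult_right_mono) auto
        finally have "norm R \<le> \<kappa> * h ^ p" .
        moreover have "norm (coeff_U ME ** (\<xi> - \<xi>')) \<le> \<kappa> * norm (\<xi> - \<xi>')"
          using norm_matrix_mult_le[of "coeff_U ME" "\<xi> - \<xi>'"] mult_right_mono[OF \<kappa>(2), of "norm (\<xi> - \<xi>')"]
          by simp
        ultimately show ?thesis
          using norm_triangle_ineq[of "coeff_U ME ** (\<xi> - \<xi>')" R]
          by (simp add: E_def \<Delta>_def distrib_left)
      qed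
      have stage_error: "norm (X $ i - x (t + c $ i * h)) \<le> 2 * E"
        if prev: "\<And>j. j < i \<Longrightarrow> norm (X $ j - x (t + c $ j * h)) \<le> 2 * E"
          "\<And>j. j < i \<Longrightarrow> stage \<delta> h t \<xi> X Z j"
          and X: "X $ i = (h *\<^sub>R (coeff_A ME ** stagewise f X Z) + coeff_U ME ** \<xi>) $ i" for X Z i
      proof (rule stage_error_bound[OF _ prev(1) _ X E exact h branch(3)])
        fix j assume j: "j < i"
        have near: "norm (X $ j - x (t + c $ j * h)) \<le> \<rho>" "norm (Z $ j - z (t + c $ j * h)) < \<delta>"
          "g (X $ j, Z $ j) = 0"
          using prev[OF j] E\<rho> by (auto simp: stage_def)
        show "norm (f (X $ j, Z $ j) - f (x (t + c $ j * h), z (t + c $ j * h)))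
            \<le> L * (norm (X $ j - x (t + c $ j * h)) + norm (Z $ j - z (t + c $ j * h)))"
          by (rule branch(6)[OF tK near(1,2)])
        have "norm (Z $ j - z (t + c $ j * h)) \<le> L * norm (X $ j - x (t + c $ j * h))"
          by (rule branch(5)[OF tK near])
        also have "\<dots> \<le> L * (2 * E)" using prev(1)[OF j] branch(3) by (rule mult_left_mono)
        finally show "norm (Z $ j - z (t + c $ j * h)) \<le> L * (2 * E)" .
      qed
      have stages_error: "norm (X $ i - x (t + c $ i * h)) \<le> 2 * E"
        if "\<And>j. j \<le> i \<Longrightarrow> stage \<delta> h t \<xi> X Z j" for X Z i
        using that
      proof (induction i rule: finite_linorder_induct)
        case (less i)
        show ?case
        proof (rule stage_error)
          show "X $ i = (h *\<^sub>R (coeff_A ME ** stagewise f X Z) + coeff_U ME ** \<xi>) $ i"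
            using less.prems[of i] by (simp add: stage_def)
        qed (use less in auto)
      qed
      \<comment> \<open>the stages up to \<open>i\<close> are extended from those before \<open>i\<close>\<close>
      have "\<exists>X Z. \<forall>j\<le>i. stage \<delta> h t \<xi> X Z j" for i
      proof (induction i rule: finite_linorder_induct)
        case (less i)
        obtain X Z where XZ: "\<forall>j<i. stage \<delta> h t \<xi> X Z j"
        proof (cases "{..<i} = {}")
          case False
          then have max: "Max {..<i} < i" "\<And>j. j < i \<Longrightarrow> j \<le> Max {..<i}"
            using Max_in[of "{..<i}"] by auto
          then show thesis using less.IH[OF max(1)] that by blast
        qed (use that in blast)
        define X' where "X' = (\<chi> j. if j = i then (h *\<^sub>R (coeff_A ME ** stagewise f X Z) + coeff_U ME ** \<xi>) $ i
          else X $ j)"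
        have row: "(coeff_A ME ** stagewise f X' Z') $ j = (coeff_A ME ** stagewise f X Z) $ j"
          if "j \<le> i" "\<And>k. k < i \<Longrightarrow> Z' $ k = Z $ k" for j Z'
          by (rule explicit_stage_cong) (use that in \<open>auto simp: X'_def\<close>)
        have X'i: "X' $ i = (h *\<^sub>R (coeff_A ME ** stagewise f X' Z) + coeff_U ME ** \<xi>) $ i"
          by (simp add: row) (simp add: X'_def)
        have lower: "stage \<delta> h t \<xi> X' Z' j" if "j < i" "\<And>k. k < i \<Longrightarrow> Z' $ k = Z $ k" for j Z'
        proof -
          have eqs: "X' $ j = X $ j" "Z' $ j = Z $ j"
            "(coeff_A ME ** stagewise f X' Z') $ j = (coeff_A ME ** stagewise f X Z) $ j"
            using row[of j Z', OF less_imp_le[OF that(1)]] that by (auto simp: X'_def[THEN arg_cong[of _ _ "\<lambda>v. v $ j"]])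
          have "stage \<delta> h t \<xi> X Z j" using XZ that by blast
          then show ?thesis
            unfolding stage_def vector_add_component vector_scaleR_component eqs .
        qed
        have "norm (X' $ i - x (t + c $ i * h)) \<le> 2 * E"
        proof (rule stage_error[OF _ _ X'i])
          show "norm (X' $ j - x (t + c $ j * h)) \<le> 2 * E" if "j < i" for j
            using lower that by (intro stages_error[of j X' Z]) auto
        qed (use lower in auto)
        then have "norm (X' $ i - x (t + c $ i * h)) \<le> \<rho>" using E\<rho> by simp
        then obtain v where v: "norm (v - z (t + c $ i * h)) < \<delta>" "g (X' $ i, v) = 0"
          using branch(4)[OF tK] by blast
        define Z' where "Z' = (\<chi> j. if j = i then v else Z $ j)"
        have Z': "Z' $ k = Z $ k" if "k < i" for k using that by (auto simp: Z'_def)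
        have "stage \<delta> h t \<xi> X' Z' i"
        proof -
          have eqs: "(coeff_A ME ** stagewise f X' Z') $ i = (coeff_A ME ** stagewise f X' Z) $ i"
            "Z' $ i = v"
            using row[of i Z'] row[of i Z] Z' by (simp_all add: Z'_def)
          show ?thesis
            using v X'i unfolding stage_def vector_add_component vector_scaleR_component eqs by blast
        qed
        then have "\<forall>j\<le>i. stage \<delta> h t \<xi> X' Z' j"
          using lower[OF _ Z'] by (auto simp: order_le_less)
        then show ?case by blast
      qed
      from this[of "Max UNIV"] have exists: "\<exists>X Z. step \<delta> h t \<xi> X Z"
        by (auto simp: step_iff_stages)
      have errors: "norm (X - stage_values x c h t) \<le> max \<Lambda>1 \<Lambda>2 * \<Delta> \<and>
          norm (Z - stage_values z c h t) \<le> max \<Lambda>1 \<Lambda>2 * \<Delta> \<and>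
          norm (h *\<^sub>R (coeff_B ME ** stagewise f X Z) + coeff_V ME ** \<xi> - external_values wE p h x (t + h)
              - coeff_V ME ** (\<xi> - \<xi>')) \<le> h * (max \<Lambda>1 \<Lambda>2 * \<Delta>)"
        if "step \<delta> h t \<xi> X Z" for X Z
      proof -
        have st: "stage \<delta> h t \<xi> X Z i" for i using that by (simp add: step_iff_stages)
        have Xi: "norm (X $ i - x (t + c $ i * h)) \<le> 2 * E" for i by (rule stages_error) (rule st)
        have near: "norm (X $ i - x (t + c $ i * h)) \<le> \<rho>" "norm (Z $ i - z (t + c $ i * h)) < \<delta>"
          "g (X $ i, Z $ i) = 0" for i
          using Xi[of i] E\<rho> st[of i] by (auto simp: stage_def)
        have Zi: "norm (Z $ i - z (t + c $ i * h)) \<le> L * (2 * E)" for i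
          using branch(5)[OF tK near] mult_left_mono[OF Xi[of i] branch(3)] by (rule order_trans)
        have fi: "norm (f (X $ i, Z $ i) - f (x (t + c $ i * h), z (t + c $ i * h))) \<le> L * (2 + 2 * L) * \<kappa> * \<Delta>" for i
        proof -
          have "norm (f (X $ i, Z $ i) - f (x (t + c $ i * h), z (t + c $ i * h))) \<le> L * (2 * E + L * (2 * E))"
            using branch(6)[OF tK near(1,2)] mult_left_mono[OF add_mono[OF Xi Zi] branch(3)]
            by (rule order_trans)
          then show ?thesis by (simp add: E_def algebra_simps)
        qed
        have \<Lambda>1: "real CARD('s) * (2 * E) \<le> max \<Lambda>1 \<Lambda>2 * \<Delta>" "real CARD('s) * (L * (2 * E)) \<le> max \<Lambda>1 \<Lambda>2 * \<Delta>"
        proof -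
          have "0 \<le> E" using \<kappa> \<Delta>0 by (simp add: E_def)
          then have "0 \<le> real CARD('s) * (2 * E)" "0 \<le> real CARD('s) * (L * (2 * E))"
            using branch(3) by auto
          moreover have "\<Lambda>1 * \<Delta> = real CARD('s) * (2 * E) + real CARD('s) * (L * (2 * E))"
            by (simp add: \<Lambda>1_def E_def algebra_simps)
          ultimately have "real CARD('s) * (2 * E) \<le> \<Lambda>1 * \<Delta>" "real CARD('s) * (L * (2 * E)) \<le> \<Lambda>1 * \<Delta>"
            by linarith+
          moreover have "\<Lambda>1 * \<Delta> \<le> max \<Lambda>1 \<Lambda>2 * \<Delta>" using \<Delta>0 by (intro mult_right_mono) auto
          ultimately show "real CARD('s) * (2 * E) \<le> max \<Lambda>1 \<Lambda>2 * \<Delta>"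
            "real CARD('s) * (L * (2 * E)) \<le> max \<Lambda>1 \<Lambda>2 * \<Delta>" by linarith+
        qed
        have eX: "norm (X - stage_values x c h t) \<le> real CARD('s) * (2 * E)"
          using Xi by (intro norm_vec_le_card) (simp add: stage_values_def)
        have eZ: "norm (Z - stage_values z c h t) \<le> real CARD('s) * (L * (2 * E))"
          using Zi by (intro norm_vec_le_card) (simp add: stage_values_def)
        have eF: "norm (stagewise f X Z - exact_f h t) \<le> real CARD('s) * (L * (2 + 2 * L) * \<kappa> * \<Delta>)"
          using fi by (intro norm_vec_le_card) (simp add: stage_values_def exact_f_def stagewise_def)
        have "norm (h *\<^sub>R (coeff_B ME ** stagewise f X Z) + coeff_V ME ** \<xi> - external_values wE p h x (t + h)
              - coeff_V ME ** (\<xi> - \<xi>')) \<le> h * (max \<Lambda>1 \<Lambda>2 * \<Delta>)"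
        proof -
          let ?P = "external_values wE p h x (t + h) - h *\<^sub>R (coeff_B ME ** exact_f h t) - coeff_V ME ** \<xi>'"
          let ?F = "stagewise f X Z - exact_f h t"
          have "h *\<^sub>R (coeff_B ME ** stagewise f X Z) + coeff_V ME ** \<xi> - external_values wE p h x (t + h)
              - coeff_V ME ** (\<xi> - \<xi>') = h *\<^sub>R (coeff_B ME ** ?F) - ?P"
            by (simp add: linear_diff[OF matrix_mult_linear] scaleR_right_diff_distrib)
          then have "norm (h *\<^sub>R (coeff_B ME ** stagewise f X Z) + coeff_V ME ** \<xi> - external_values wE p h x (t + h)
              - coeff_V ME ** (\<xi> - \<xi>')) \<le> norm (h *\<^sub>R (coeff_B ME ** ?F)) + norm ?P"
            by (simp only: norm_triangle_ineq4)
          also have "\<dots> \<le> h * (entry_norm (coeff_B ME) * (real CARD('s) * (L * (2 + 2 * L) * \<kappa>)) * \<Delta>)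
              + h * (\<bar>C2'\<bar> * \<Delta>)"
          proof (rule add_mono)
            have "norm (coeff_B ME ** ?F) \<le> entry_norm (coeff_B ME) * norm ?F" by (rule norm_matrix_mult_le)
            also have "\<dots> \<le> entry_norm (coeff_B ME) * (real CARD('s) * (L * (2 + 2 * L) * \<kappa> * \<Delta>))"
              by (rule mult_left_mono[OF eF entry_norm_nonneg])
            finally show "norm (h *\<^sub>R (coeff_B ME ** ?F))
                \<le> h * (entry_norm (coeff_B ME) * (real CARD('s) * (L * (2 + 2 * L) * \<kappa>)) * \<Delta>)"
              using h(1) by (simp add: mult.assoc)
            have "norm ?P \<le> C2' * h ^ Suc p" by (rule res(2))
            also have "\<dots> \<le> \<bar>C2'\<bar> * (h * \<Delta>)"
              using h by (intro mult_mono) (auto simp: \<Delta>_def)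
            finally show "norm ?P \<le> h * (\<bar>C2'\<bar> * \<Delta>)" by (simp add: mult_ac)
          qed
          also have "\<dots> = h * (\<Lambda>2 * \<Delta>)" by (simp add: \<Lambda>2_def algebra_simps)
          also have "\<dots> \<le> h * (max \<Lambda>1 \<Lambda>2 * \<Delta>)"
            using h \<Delta>0 by (intro mult_left_mono mult_right_mono) auto
          finally show ?thesis .
        qed
        then show ?thesis using order_trans[OF eX \<Lambda>1(1)] order_trans[OF eZ \<Lambda>1(2)] by blast
      qed
      show "(\<exists>X Z. step \<delta> h t \<xi> X Z) \<and>
       (\<forall>X Z. step \<delta> h t \<xi> X Z \<longrightarrow>
          norm (X - stage_values x c h t) \<le> max \<Lambda>1 \<Lambda>2 * (norm (\<xi> - external_values wE p h x t) + h ^ p) \<and>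
          norm (Z - stage_values z c h t) \<le> max \<Lambda>1 \<Lambda>2 * (norm (\<xi> - external_values wE p h x t) + h ^ p) \<and>
          norm (h *\<^sub>R (coeff_B ME ** stagewise f X Z) + coeff_V ME ** \<xi> - external_values wE p h x (t + h)
              - coeff_V ME ** (\<xi> - external_values wE p h x t))
            \<le> h * (max \<Lambda>1 \<Lambda>2 * (norm (\<xi> - external_values wE p h x t) + h ^ p)))"
        by (rule conjI[OF exists]) (intro allI impI, rule errors[unfolded \<Delta>_def \<xi>'_def])
    qed
  qed
  then show thesis
    by (rule that[OF branch(1) r, rotated]) (use \<kappa> branch(3) in \<open>simp add: \<Lambda>1_def le_max_iff_disj\<close>)
qed

end

section \<open>Convergence\<close>

lemma ball_atLeast1AtMost: "(\<forall>n\<in>{1..N}. P n) \<longleftrightarrow> (\<forall>n<N. P (Suc n))"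
  unfolding image_Suc_lessThan[symmetric] by auto

context imex_dae
begin

text \<open>Steps are numbered from \<open>0\<close>, so that step \<open>n\<close> starts at \<open>t0 + n h\<close>.\<close>

definition "trajectory \<delta> h N X Z \<xi> \<zeta> \<longleftrightarrow> (\<forall>n<N.
   step \<delta> h (t0 + real n * h) (\<xi> n) (X (Suc n)) (Z (Suc n)) \<and>
   \<xi> (Suc n) = h *\<^sub>R (coeff_B ME ** stagewise f (X (Suc n)) (Z (Suc n))) + coeff_V ME ** \<xi> n \<and>
   \<zeta> (Suc n) = (coeff_B MI ** matrix_inv (coeff_A MI)) ** Z (Suc n) + M_infinity MI ** \<zeta> n)"

lemma trajectory_iff:
  "imex_dae_steps ME MI f g h N X Z \<xi> \<zeta> \<and> on_local_branch z c t0 \<delta> h N Z \<longleftrightarrow>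
     trajectory \<delta> h N X Z \<xi> \<zeta>"
  unfolding imex_dae_steps_def on_local_branch_def ball_atLeast1AtMost trajectory_def step_def
    diff_Suc_1 by blast

text \<open>The step size is one at which all local estimates hold. The error bound \<open>B h\<^sup>p \<le> r\<close> for every solution with
  fewer steps keeps its last value within reach of the one-step result; this gives both the next
  error estimate and, by induction on \<open>N\<close>, existence.\<close>

lemma trajectory_bounds:
  assumes h: "0 < h"
    and step_props: "\<forall>t\<in>{t0..tF}. \<forall>\<xi>. norm (\<xi> - external_values wE p h x t) \<le> r \<longrightarrow>
       (\<exists>X Z. step \<delta> h t \<xi> X Z) \<and>
       (\<forall>X Z. step \<delta> h t \<xi> X Z \<longrightarrow>
          norm (X - stage_values x c h t) \<le> \<Lambda> * (norm (\<xi> - external_values wE p h x t) + h ^ p) \<and>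
          norm (Z - stage_values z c h t) \<le> \<Lambda> * (norm (\<xi> - external_values wE p h x t) + h ^ p) \<and>
          norm (h *\<^sub>R (coeff_B ME ** stagewise f X Z) + coeff_V ME ** \<xi> - external_values wE p h x (t + h)
              - coeff_V ME ** (\<xi> - external_values wE p h x t))
            \<le> h * (\<Lambda> * (norm (\<xi> - external_values wE p h x t) + h ^ p)))"
    and \<Lambda>: "0 \<le> \<Lambda>"
    and stiff: "\<forall>t\<in>{t0..tF}. norm (external_values wI p h z (t + h)
       - (coeff_B MI ** matrix_inv (coeff_A MI)) ** stage_values z c h t
       - M_infinity MI ** external_values wI p h z t) \<le> Cz * h ^ p"
    and K: "1 \<le> K" "\<And>n (X::real^'m^'r). norm (((**) (coeff_V ME) ^^ n) X) \<le> K * norm X"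
    and s: "summable s" "\<And>n. 0 \<le> s n"
      "\<And>n (X::real^'m^'r). norm (((**) (M_infinity MI) ^^ n) X) \<le> s n * norm X"
    and start: "norm (\<xi>\<^sub>0 - external_values wE p h x t0) \<le> Cx * h ^ p"
      "norm (\<zeta>\<^sub>0 - external_values wI p h z t0) \<le> C\<zeta> * h ^ p"
    and B: "B = K * (Cx + (tF - t0) * \<Lambda>) * exp (K * \<Lambda> * (tF - t0))" "B * h ^ p \<le> r" "0 \<le> B"
    and N: "t0 + real N * h \<le> tF"
  shows "\<exists>X Z \<xi> \<zeta>. \<xi> 0 = \<xi>\<^sub>0 \<and> \<zeta> 0 = \<zeta>\<^sub>0 \<and> trajectory \<delta> h N X Z \<xi> \<zeta>"
    and "\<lbrakk>\<xi> 0 = \<xi>\<^sub>0; \<zeta> 0 = \<zeta>\<^sub>0; trajectory \<delta> h N X Z \<xi> \<zeta>; n < N\<rbrakk> \<Longrightarrow>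
      norm (X (Suc n) - stage_values x c h (t0 + real n * h)) \<le> \<Lambda> * (B + 1) * h ^ p \<and>
      norm (\<xi> (Suc n) - external_values wE p h x (t0 + real (Suc n) * h)) \<le> B * h ^ p \<and>
      norm (Z (Suc n) - stage_values z c h (t0 + real n * h)) \<le> \<Lambda> * (B + 1) * h ^ p \<and>
      norm (\<zeta> (Suc n) - external_values wI p h z (t0 + real (Suc n) * h))
        \<le> suminf s * (C\<zeta> + (entry_norm (coeff_B MI ** matrix_inv (coeff_A MI)) * (\<Lambda> * (B + 1)) + \<bar>Cz\<bar>)) * h ^ p"
proof -
  have time: "t0 + real n * h \<in> {t0..tF}" if "n \<le> N'" "t0 + real N' * h \<le> tF" for n N'
  proof -
    have "real n * h \<le> real N' * h" "0 \<le> real n * h"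
      using that(1) h by (auto intro: mult_right_mono)
    then show ?thesis unfolding atLeastAtMost_iff using that(2) by linarith
  qed
  have xi_bound: "norm (\<xi> n - external_values wE p h x (t0 + real n * h)) \<le> B * h ^ p"
    if "\<xi> 0 = \<xi>\<^sub>0" and tr: "trajectory \<delta> h N' X Z \<xi> \<zeta>" and N': "t0 + real N' * h \<le> tF" and n: "n \<le> N'"
    for X Z \<xi> \<zeta> N' n
  proof -
    define e where "e n = \<xi> n - external_values wE p h x (t0 + real n * h)" for n
    define d where "d n = e (Suc n) - coeff_V ME ** e n" for n
    have d_le: "norm (d n) \<le> h * (\<Lambda> * norm (e n) + \<Lambda> * h ^ p)" if "n < N'" "norm (e n) \<le> r" for n
    proof -
      have "step \<delta> h (t0 + real n * h) (\<xi> n) (X (Suc n)) (Z (Suc n))"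
        and \<xi>: "\<xi> (Suc n) = h *\<^sub>R (coeff_B ME ** stagewise f (X (Suc n)) (Z (Suc n))) + coeff_V ME ** \<xi> n"
        using tr \<open>n < N'\<close> unfolding trajectory_def by blast+
      then have "norm (h *\<^sub>R (coeff_B ME ** stagewise f (X (Suc n)) (Z (Suc n))) + coeff_V ME ** \<xi> n
          - external_values wE p h x (t0 + real n * h + h) - coeff_V ME ** e n)
          \<le> h * (\<Lambda> * (norm (e n) + h ^ p))"
        using step_props time[OF less_imp_le[OF \<open>n < N'\<close>] N'] that(2) unfolding e_def by blast
      moreover have "t0 + real n * h + h = t0 + real (Suc n) * h" by (simp add: algebra_simps)
      ultimately show ?thesis by (simp add: d_def e_def[of "Suc n"] \<xi> distrib_left)
    qed
    have small: "K * (norm (e 0) + (tF - t0) * (\<Lambda> * h ^ p)) * exp (K * \<Lambda> * (tF - t0)) \<le> B * h ^ p"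
    proof -
      have "norm (e 0) + (tF - t0) * (\<Lambda> * h ^ p) \<le> (Cx + (tF - t0) * \<Lambda>) * h ^ p"
        using start(1) \<open>\<xi> 0 = \<xi>\<^sub>0\<close> by (simp add: e_def algebra_simps)
      then have "K * (norm (e 0) + (tF - t0) * (\<Lambda> * h ^ p)) * exp (K * \<Lambda> * (tF - t0))
          \<le> K * ((Cx + (tF - t0) * \<Lambda>) * h ^ p) * exp (K * \<Lambda> * (tF - t0))"
        using K(1) by (intro mult_right_mono mult_left_mono) auto
      then show ?thesis by (simp add: B(1) mult_ac)
    qed
    have "norm (e n) \<le> K * (norm (e 0) + (tF - t0) * (\<Lambda> * h ^ p)) * exp (K * \<Lambda> * (tF - t0))"
    proof (rule power_bounded_recurrence_bound[OF matrix_mult_linear K(2), where d = d and r = r and h = h])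
      show "e (Suc n) = coeff_V ME ** e n + d n" for n by (simp add: d_def)
      show "K * (norm (e 0) + (tF - t0) * (\<Lambda> * h ^ p)) * exp (K * \<Lambda> * (tF - t0)) \<le> r"
        using small B(2) by linarith
      show "real N' * h \<le> tF - t0" using N' by simp
    qed (use K(1) d_le h \<Lambda> n in auto)
    then show ?thesis using small unfolding e_def by linarith
  qed
  show "\<exists>X Z \<xi> \<zeta>. \<xi> 0 = \<xi>\<^sub>0 \<and> \<zeta> 0 = \<zeta>\<^sub>0 \<and> trajectory \<delta> h N X Z \<xi> \<zeta>"
    using N
  proof (induction N)
    case 0
    show ?case by (rule exI, rule exI, rule exI[of _ "\<lambda>_. \<xi>\<^sub>0"], rule exI[of _ "\<lambda>_. \<zeta>\<^sub>0"])
        (simp add: trajectory_def)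
  next
    case (Suc N)
    have N: "t0 + real N * h \<le> tF" using Suc.prems h by (simp add: algebra_simps)
    then obtain X Z \<xi> \<zeta> where IH: "\<xi> 0 = \<xi>\<^sub>0" "\<zeta> 0 = \<zeta>\<^sub>0" "trajectory \<delta> h N X Z \<xi> \<zeta>"
      using Suc.IH by blast
    have "norm (\<xi> N - external_values wE p h x (t0 + real N * h)) \<le> r"
      using xi_bound[OF IH(1,3) N order_refl] B(2) by linarith
    then obtain X' Z' where step': "step \<delta> h (t0 + real N * h) (\<xi> N) X' Z'"
      using step_props time[OF order_refl N] by blast
    define \<xi>' where "\<xi>' = h *\<^sub>R (coeff_B ME ** stagewise f X' Z') + coeff_V ME ** \<xi> N"
    define \<zeta>' where "\<zeta>' = (coeff_B MI ** matrix_inv (coeff_A MI)) ** Z' + M_infinity MI ** \<zeta> N"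
    have "trajectory \<delta> h (Suc N) (X(Suc N := X')) (Z(Suc N := Z')) (\<xi>(Suc N := \<xi>')) (\<zeta>(Suc N := \<zeta>'))"
      using IH(3) step' unfolding trajectory_def
      by (auto simp: less_Suc_eq \<xi>'_def \<zeta>'_def)
    moreover have "(\<xi>(Suc N := \<xi>')) 0 = \<xi>\<^sub>0" "(\<zeta>(Suc N := \<zeta>')) 0 = \<zeta>\<^sub>0" using IH by auto
    ultimately show ?case by blast
  qed
  assume \<xi>0: "\<xi> 0 = \<xi>\<^sub>0" and \<zeta>0: "\<zeta> 0 = \<zeta>\<^sub>0" and tr: "trajectory \<delta> h N X Z \<xi> \<zeta>" and n: "n < N"
  note \<xi>_bound = xi_bound[OF \<xi>0 tr N]
  have stages: "norm (X (Suc n) - stage_values x c h (t0 + real n * h)) \<le> \<Lambda> * (B + 1) * h ^ p"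
    "norm (Z (Suc n) - stage_values z c h (t0 + real n * h)) \<le> \<Lambda> * (B + 1) * h ^ p" if n: "n < N" for n
  proof -
    let ?\<Delta> = "norm (\<xi> n - external_values wE p h x (t0 + real n * h))"
    have "step \<delta> h (t0 + real n * h) (\<xi> n) (X (Suc n)) (Z (Suc n))"
      using tr n unfolding trajectory_def by blast
    moreover have \<Delta>: "?\<Delta> \<le> B * h ^ p" using \<xi>_bound n by simp
    then have "?\<Delta> \<le> r" using B(2) by linarith
    ultimately have "norm (X (Suc n) - stage_values x c h (t0 + real n * h)) \<le> \<Lambda> * (?\<Delta> + h ^ p)"
      "norm (Z (Suc n) - stage_values z c h (t0 + real n * h)) \<le> \<Lambda> * (?\<Delta> + h ^ p)"
      using step_props time[OF less_imp_le[OF n] N] by blast+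
    moreover have "\<Lambda> * (?\<Delta> + h ^ p) \<le> \<Lambda> * (B * h ^ p + h ^ p)"
      using \<Delta> \<Lambda> by (intro mult_left_mono) auto
    moreover have "\<Lambda> * (B * h ^ p + h ^ p) = \<Lambda> * (B + 1) * h ^ p" by (simp add: algebra_simps)
    ultimately show "norm (X (Suc n) - stage_values x c h (t0 + real n * h)) \<le> \<Lambda> * (B + 1) * h ^ p"
      "norm (Z (Suc n) - stage_values z c h (t0 + real n * h)) \<le> \<Lambda> * (B + 1) * h ^ p" by linarith+
  qed
  let ?BA = "coeff_B MI ** matrix_inv (coeff_A MI)"
  define e where "e n = \<zeta> n - external_values wI p h z (t0 + real n * h)" for n
  define d where "d n = e (Suc n) - M_infinity MI ** e n" for n
  let ?\<epsilon> = "(entry_norm ?BA * (\<Lambda> * (B + 1)) + \<bar>Cz\<bar>) * h ^ p"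
  have "norm (e (Suc n)) \<le> suminf s * (norm (e 0) + ?\<epsilon>)"
  proof (rule summable_recurrence_bound[OF matrix_mult_linear s(3) s(1,2), where d = d])
    show "e (Suc n) = M_infinity MI ** e n + d n" for n by (simp add: d_def)
    show "0 \<le> ?\<epsilon>" using \<Lambda> B(3) h entry_norm_nonneg[of ?BA] by simp
    fix n assume n: "n < N"
    let ?t = "t0 + real n * h"
    let ?R = "external_values wI p h z (?t + h) - ?BA ** stage_values z c h ?t
        - M_infinity MI ** external_values wI p h z ?t"
    have \<zeta>_Suc: "\<zeta> (Suc n) = ?BA ** Z (Suc n) + M_infinity MI ** \<zeta> n"
      using tr n unfolding trajectory_def by blast
    have t_Suc: "t0 + real (Suc n) * h = ?t + h" by (simp add: algebra_simps)
    have "d n = ?BA ** (Z (Suc n) - stage_values z c h ?t) - ?R"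
      unfolding d_def e_def \<zeta>_Suc t_Suc linear_diff[OF matrix_mult_linear] by simp
    then have "norm (d n) \<le> norm (?BA ** (Z (Suc n) - stage_values z c h ?t)) + norm ?R"
      by (simp only: norm_triangle_ineq4)
    also have "\<dots> \<le> entry_norm ?BA * (\<Lambda> * (B + 1) * h ^ p) + \<bar>Cz\<bar> * h ^ p"
    proof (rule add_mono)
      show "norm (?BA ** (Z (Suc n) - stage_values z c h ?t)) \<le> entry_norm ?BA * (\<Lambda> * (B + 1) * h ^ p)"
        using norm_matrix_mult_le mult_left_mono[OF stages(2)[OF n] entry_norm_nonneg]
        by (rule order_trans)
      have "norm ?R \<le> Cz * h ^ p" using stiff time[OF less_imp_le[OF n] N] by blast
      also have "\<dots> \<le> \<bar>Cz\<bar> * h ^ p" using h by (intro mult_right_mono) auto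
      finally show "norm ?R \<le> \<bar>Cz\<bar> * h ^ p" .
    qed
    finally show "norm (d n) \<le> ?\<epsilon>" by (simp add: algebra_simps)
  qed (use n in auto)
  also have "\<dots> \<le> suminf s * (C\<zeta> * h ^ p + ?\<epsilon>)"
    using start(2) \<zeta>0 s by (intro mult_left_mono suminf_nonneg) (auto simp: e_def)
  also have "\<dots> = suminf s * (C\<zeta> + (entry_norm ?BA * (\<Lambda> * (B + 1)) + \<bar>Cz\<bar>)) * h ^ p"
    by (simp add: algebra_simps)
  finally show "norm (X (Suc n) - stage_values x c h (t0 + real n * h)) \<le> \<Lambda> * (B + 1) * h ^ p \<and>
      norm (\<xi> (Suc n) - external_values wE p h x (t0 + real (Suc n) * h)) \<le> B * h ^ p \<and>
      norm (Z (Suc n) - stage_values z c h (t0 + real n * h)) \<le> \<Lambda> * (B + 1) * h ^ p \<and>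
      norm (\<zeta> (Suc n) - external_values wI p h z (t0 + real (Suc n) * h))
        \<le> suminf s * (C\<zeta> + (entry_norm ?BA * (\<Lambda> * (B + 1)) + \<bar>Cz\<bar>)) * h ^ p"
    using stages[OF n] \<xi>_bound[of "Suc n"] n unfolding e_def by auto
qed

lemma convergence:
  fixes \<xi>\<^sub>0 \<zeta>\<^sub>0 :: "real \<Rightarrow> real^'m^'r"
  assumes start_xi: "(\<lambda>h. norm (\<xi>\<^sub>0 h - external_values wE p h x t0)) \<in> O[at_right 0](\<lambda>h. h ^ p)"
    and start_zeta: "(\<lambda>h. norm (\<zeta>\<^sub>0 h - external_values wI p h z t0)) \<in> O[at_right 0](\<lambda>h. h ^ p)"
  shows "\<exists>\<delta>>0. \<exists>C. \<exists>h\<^sub>0>0. \<forall>h\<in>{0<..h\<^sub>0}. \<forall>N. t0 + real N * h \<le> tF \<longrightarrow>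
    (\<exists>X Z \<xi> \<zeta>. \<xi> 0 = \<xi>\<^sub>0 h \<and> \<zeta> 0 = \<zeta>\<^sub>0 h \<and> trajectory \<delta> h N X Z \<xi> \<zeta>) \<and>
    (\<forall>X Z \<xi> \<zeta>. \<xi> 0 = \<xi>\<^sub>0 h \<and> \<zeta> 0 = \<zeta>\<^sub>0 h \<and> trajectory \<delta> h N X Z \<xi> \<zeta> \<longrightarrow>
       (\<forall>n<N.
          norm (X (Suc n) - stage_values x c h (t0 + real n * h)) \<le> C * h ^ p \<and>
          norm (\<xi> (Suc n) - external_values wE p h x (t0 + real (Suc n) * h)) \<le> C * h ^ p \<and>
          norm (Z (Suc n) - stage_values z c h (t0 + real n * h)) \<le> C * h ^ p \<and>
          norm (\<zeta> (Suc n) - external_values wI p h z (t0 + real (Suc n) * h)) \<le> C * h ^ p))"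
    (is "\<exists>\<delta>>0. \<exists>C. \<exists>h\<^sub>0>0. \<forall>h\<in>{0<..h\<^sub>0}. ?P \<delta> C h")
proof -
  obtain \<delta> r \<Lambda> where \<delta>: "0 < \<delta>" and r: "0 < r" and \<Lambda>: "0 \<le> \<Lambda>" and step_props:
    "eventually (\<lambda>h. \<forall>t\<in>{t0..tF}. \<forall>\<xi>. norm (\<xi> - external_values wE p h x t) \<le> r \<longrightarrow>
       (\<exists>X Z. step \<delta> h t \<xi> X Z) \<and>
       (\<forall>X Z. step \<delta> h t \<xi> X Z \<longrightarrow>
          norm (X - stage_values x c h t) \<le> \<Lambda> * (norm (\<xi> - external_values wE p h x t) + h ^ p) \<and>
          norm (Z - stage_values z c h t) \<le> \<Lambda> * (norm (\<xi> - external_values wE p h x t) + h ^ p) \<and>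
          norm (h *\<^sub>R (coeff_B ME ** stagewise f X Z) + coeff_V ME ** \<xi> - external_values wE p h x (t + h)
              - coeff_V ME ** (\<xi> - external_values wE p h x t))
            \<le> h * (\<Lambda> * (norm (\<xi> - external_values wE p h x t) + h ^ p)))) (at_right 0)"
    by (rule one_step)
  obtain Cz where stiff: "eventually (\<lambda>h. \<forall>t\<in>{t0..tF}. norm (external_values wI p h z (t + h)
       - (coeff_B MI ** matrix_inv (coeff_A MI)) ** stage_values z c h t
       - M_infinity MI ** external_values wI p h z t) \<le> Cz * h ^ p) (at_right 0)"
    using z_curve.stiff_limit_residual[OF orders(2) invertible_AI] unfolding uniform_O_def by blast
  obtain K where K: "1 \<le> K" "\<And>n (X::real^'m^'r). norm (((**) (coeff_V ME) ^^ n) X) \<le> K * norm X"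
    using power_bounded_norm_le[OF zero_stable] by metis
  obtain s where s: "summable s" "\<And>n. 0 \<le> s n"
      "\<And>n (X::real^'m^'r). norm (((**) (M_infinity MI) ^^ n) X) \<le> s n * norm X"
    using spectral_radius_less_1_summable[OF radius] by metis
  obtain Cx where Cx: "0 < Cx"
    "eventually (\<lambda>h. norm (norm (\<xi>\<^sub>0 h - external_values wE p h x t0)) \<le> Cx * norm (h ^ p)) (at_right 0)"
    using start_xi by (elim landau_o.bigE) blast
  obtain C\<zeta> where C\<zeta>: "0 < C\<zeta>"
    "eventually (\<lambda>h. norm (norm (\<zeta>\<^sub>0 h - external_values wI p h z t0)) \<le> C\<zeta> * norm (h ^ p)) (at_right 0)"
    using start_zeta by (elim landau_o.bigE) blast
  define B where "B = K * (Cx + (tF - t0) * \<Lambda>) * exp (K * \<Lambda> * (tF - t0))"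
  define C where "C = Max {\<Lambda> * (B + 1), B,
    suminf s * (C\<zeta> + (entry_norm (coeff_B MI ** matrix_inv (coeff_A MI)) * (\<Lambda> * (B + 1)) + \<bar>Cz\<bar>))}"
  have B0: "0 \<le> B" using K(1) Cx(1) \<Lambda> interval by (simp add: B_def)
  have p: "0 < p" using imex by (simp add: imex_class_def)
  have "eventually (\<lambda>h::real. B * h ^ p < r) (at_right 0)"
  proof -
    have "((\<lambda>h::real. B * h ^ p) \<longlongrightarrow> B * 0 ^ p) (at_right 0)" by (intro tendsto_intros)
    then have "((\<lambda>h::real. B * h ^ p) \<longlongrightarrow> 0) (at_right 0)"
      using p by (simp only: zero_power mult_zero_right)
    then show ?thesis using r by (rule order_tendstoD(2))
  qed
  then have "eventually (\<lambda>h. B * h ^ p \<le> r) (at_right 0)"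
    by eventually_elim simp
  moreover have "eventually (\<lambda>h::real. 0 < h) (at_right 0)" by (rule eventually_at_right_less)
  ultimately have "eventually (?P \<delta> C) (at_right 0)"
    using step_props stiff Cx(2) C\<zeta>(2)
  proof eventually_elim
    case (elim h)
    have start: "norm (\<xi>\<^sub>0 h - external_values wE p h x t0) \<le> Cx * h ^ p"
      "norm (\<zeta>\<^sub>0 h - external_values wI p h z t0) \<le> C\<zeta> * h ^ p"
      using elim by simp_all
    note bounds = trajectory_bounds[OF \<open>0 < h\<close> elim(3) \<Lambda> elim(4) K s start B_def elim(1) B0]
    have C: "\<Lambda> * (B + 1) * h ^ p \<le> C * h ^ p" "B * h ^ p \<le> C * h ^ p"
      "suminf s * (C\<zeta> + (entry_norm (coeff_B MI ** matrix_inv (coeff_A MI)) * (\<Lambda> * (B + 1)) + \<bar>Cz\<bar>)) * h ^ p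
        \<le> C * h ^ p"
      using \<open>0 < h\<close> by (auto simp: C_def intro!: mult_right_mono)
    show ?case
    proof (intro allI impI conjI)
      fix N assume N: "t0 + real N * h \<le> tF"
      show "\<exists>X Z \<xi> \<zeta>. \<xi> 0 = \<xi>\<^sub>0 h \<and> \<zeta> 0 = \<zeta>\<^sub>0 h \<and> trajectory \<delta> h N X Z \<xi> \<zeta>"
        by (rule bounds(1)[OF N])
      fix X Z \<xi> \<zeta> n
      assume tr: "\<xi> 0 = \<xi>\<^sub>0 h \<and> \<zeta> 0 = \<zeta>\<^sub>0 h \<and> trajectory \<delta> h N X Z \<xi> \<zeta>" and n: "n < N"
      note bound = bounds(2)[OF N conjunct1[OF tr] conjunct1[OF conjunct2[OF tr]]
          conjunct2[OF conjunct2[OF tr]] n]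
      show "norm (X (Suc n) - stage_values x c h (t0 + real n * h)) \<le> C * h ^ p"
        "norm (\<xi> (Suc n) - external_values wE p h x (t0 + real (Suc n) * h)) \<le> C * h ^ p"
        "norm (Z (Suc n) - stage_values z c h (t0 + real n * h)) \<le> C * h ^ p"
        "norm (\<zeta> (Suc n) - external_values wI p h z (t0 + real (Suc n) * h)) \<le> C * h ^ p"
        using bound C by linarith+
    qed
  qed
  then obtain h1 where h1: "0 < h1" "\<And>h. 0 < h \<Longrightarrow> h < h1 \<Longrightarrow> ?P \<delta> C h"
    unfolding eventually_at_right_field by blast
  show ?thesis
  proof (rule exI[of _ \<delta>], rule conjI[OF \<delta>], rule exI[of _ C], rule exI[of _ "h1 / 2"],
      intro conjI ballI)
    show "?P \<delta> C h" if "h \<in> {0<..h1 / 2}" for h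
      using that h1(1) by (intro h1(2)) auto
  qed (use h1 in simp)
qed

end

theorem corollary1:
  fixes f g :: "(real^'m) \<times> (real^'m) \<Rightarrow> real^'m"
    and D :: "((real^'m) \<times> (real^'m)) set"
    and x z :: "real \<Rightarrow> real^'m"
    and t0 tF a b :: real
    and c :: "real^('s::{finite,linorder})"
    and ME MI :: "('s, 'r::finite) glm"
    and wE wI :: "nat \<Rightarrow> real^'r"
    and p qE qI :: nat
    and \<xi>\<^sub>0 \<zeta>\<^sub>0 :: "real \<Rightarrow> real^'m^'r"
  assumes interval: "a < t0" "t0 < tF" "tF < b"
    and solution: "dae_solution f g {a<..<b} x z"
    and neighbourhood: "open D" "\<forall>t\<in>{a<..<b}. (x t, z t) \<in> D"
    and smooth: "smooth_on f D" "smooth_on g D"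
    and index_1: "\<forall>(u, v)\<in>D. invertible (jacobian (\<lambda>v'. g (u, v')) (at v))"
    and imex: "imex_class c ME MI wE wI p qE qI"
    and zero_stable: "power_bounded (coeff_V ME)"
    and start_xi: "(\<lambda>h. norm (\<xi>\<^sub>0 h - external_values wE p h x t0)) \<in> O[at_right 0](\<lambda>h. h ^ p)"
    and start_zeta: "(\<lambda>h. norm (\<zeta>\<^sub>0 h - external_values wI p h z t0)) \<in> O[at_right 0](\<lambda>h. h ^ p)"
  shows "\<exists>\<delta>>0. \<exists>C. \<exists>h\<^sub>0>0. \<forall>h\<in>{0<..h\<^sub>0}. \<forall>N. t0 + real N * h \<le> tF \<longrightarrow>
    (\<exists>X Z \<xi> \<zeta>. \<xi> 0 = \<xi>\<^sub>0 h \<and> \<zeta> 0 = \<zeta>\<^sub>0 h \<and>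
       imex_dae_steps ME MI f g h N X Z \<xi> \<zeta> \<and> on_local_branch z c t0 \<delta> h N Z) \<and>
    (\<forall>X Z \<xi> \<zeta>. \<xi> 0 = \<xi>\<^sub>0 h \<and> \<zeta> 0 = \<zeta>\<^sub>0 h \<and>
       imex_dae_steps ME MI f g h N X Z \<xi> \<zeta> \<and> on_local_branch z c t0 \<delta> h N Z \<longrightarrow>
       (\<forall>n\<in>{1..N}.
          norm (X n - stage_values x c h (t0 + real (n - 1) * h)) \<le> C * h ^ p \<and>
          norm (\<xi> n - external_values wE p h x (t0 + real n * h)) \<le> C * h ^ p \<and>
          norm (Z n - stage_values z c h (t0 + real (n - 1) * h)) \<le> C * h ^ p \<and>
          norm (\<zeta> n - external_values wI p h z (t0 + real n * h)) \<le> C * h ^ p))"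
proof -
  interpret imex_dae f g D x z a b t0 tF c ME MI wE wI p qE qI
    by unfold_locales (use assms in auto)
  show ?thesis
    unfolding trajectory_iff ball_atLeast1AtMost diff_Suc_1
    by (rule convergence[OF start_xi start_zeta])
qed

end
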